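(* Let $\mathcal{H}$ be a regular unitarily invariant complete Pick space of holomorphic functions on $\mathbb{B}_d$. The following are equivalent for a complex Borel measure $\nu$ on $\partial\mathbb{B}_d$: (i) $\nu$ is $\operatorname{Mult}(\mathcal{H})$-totally singular; (ii) $\nu$ is singular with respect to every Borel probability measure on $\partial\mathbb{B}_d$ of finite $\mathcal{H}$-energy; (iii) $\nu$ is concentrated on an $F_\sigma$ subset of $\partial\mathbb{B}_d$ of inner $\mathcal{H}$-capacity zero.
   Context: $\mathbb{B}_d$ is the open Euclidean unit ball of $\mathbb{C}^d$ ($d \ge 1$), with boundary sphere $\partial\mathbb{B}_d$. A regular unitarily invariant space of holomorphic functions on $\mathbb{B}_d$ is a reproducing kernel Hilbert space $\mathcal{H}$ on $\mathbb{B}_d$ with kernel $K(z,w) = \sum_{n=0}^\infty a_n\langle z,w\rangle^n$, where $a_n > 0$ for all $n \ge 0$, $a_0 = 1$ and $\lim_{n\to\infty} a_n/a_{n+1} = 1$. It is a complete Pick space if $K$ does not vanish on $\mathbb{B}_d\times\mathbb{B}_d$ and the function $1 - \frac{1}{K}$ is positive semi-definite. $\operatorname{Mult}(\mathcal{H})$ is the multiplier algebra of $\mathcal{H}$ with the multiplication operator norm; it contains the polynomials. The $\mathcal{H}$-energy of a Borel probability measure $\mu$ on $\partial\mathbb{B}_d$ is $\mathcal{E}(\mu) = \sup_{0 \le r < 1} \int\int K(rz,rw)\, d\mu(w)\, d\mu(z) \in [0,\infty]$ (the double integrals are non-negative reals, increasing in $r$). For compact $F \subset \partial\mathbb{B}_d$,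 $\operatorname{cap}_{\mathcal{H}}(F) = \sup\{1/\mathcal{E}(\mu) : \mu$ a Borel probability measure supported on $F\}$ (with $1/\infty = 0$ and $\operatorname{cap}(\emptyset) = 0$); the inner capacity of arbitrary $E \subset \partial\mathbb{B}_d$ is $\operatorname{cap}_{\mathcal{H}}(E) = \sup\{\operatorname{cap}_{\mathcal{H}}(F) : F \subset E \text{ compact}\}$. A complex Borel measure $\mu$ on $\partial\mathbb{B}_d$ is $\operatorname{Mult}(\mathcal{H})$-Henkin if for every sequence $(p_n)$ of polynomials with $\sup_n \|p_n\|_{\operatorname{Mult}(\mathcal{H})} < \infty$ and $\lim_n p_n(z) = 0$ for all $z \in \mathbb{B}_d$, one has $\lim_n \int_{\partial\mathbb{B}_d} p_n\, d\mu = 0$. A complex Borel measure on $\partial\mathbb{B}_d$ is $\operatorname{Mult}(\mathcal{H})$-totally singular if it is singular with respect to every $\operatorname{Mult}(\mathcal{H})$-Henkin measure. A measure $\nu$ is concentrated on a Borel set $E$ if $|\nu|(\partial\mathbb{B}_d \setminus E) = 0$. *)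

theory Defs
  imports "HOL-Analysis.Analysis" "HOL-Probability.Probability_Measure"
begin

section \<open>Reproducing kernel Hilbert spaces\<close>

text \<open>
  A Hilbert space of complex functions on \<open>X\<close> is given by its set \<open>H\<close> of functions and its
  inner product \<open>ip\<close>, linear in the first argument. A function on \<open>X\<close> is represented by its
  extension by zero, so that distinct elements of \<open>H\<close> are distinct functions on \<open>X\<close>.
\<close>

definition hnorm :: "(('a \<Rightarrow> complex) \<Rightarrow> ('a \<Rightarrow> complex) \<Rightarrow> complex) \<Rightarrow> ('a \<Rightarrow> complex) \<Rightarrow> real"
  where "hnorm ip f = sqrt (Re (ip f f))"

locale function_hilbert_space =
  fixes X :: "'a set"
    and H :: "('a \<Rightarrow> complex) set"
    and ip :: "('a \<Rightarrow> complex) \<Rightarrow> ('a \<Rightarrow> complex) \<Rightarrow> complex"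
  assumes zero_outside: "f \<in> H \<Longrightarrow> x \<notin> X \<Longrightarrow> f x = 0"
    and zero_mem: "(\<lambda>x. 0) \<in> H"
    and add_mem: "f \<in> H \<Longrightarrow> g \<in> H \<Longrightarrow> (\<lambda>x. f x + g x) \<in> H"
    and scale_mem: "f \<in> H \<Longrightarrow> (\<lambda>x. c * f x) \<in> H"
    and ip_add: "f \<in> H \<Longrightarrow> g \<in> H \<Longrightarrow> h \<in> H \<Longrightarrow> ip (\<lambda>x. f x + g x) h = ip f h + ip g h"
    and ip_scale: "f \<in> H \<Longrightarrow> h \<in> H \<Longrightarrow> ip (\<lambda>x. c * f x) h = c * ip f h"
    and ip_cnj: "f \<in> H \<Longrightarrow> g \<in> H \<Longrightarrow> ip g f = cnj (ip f g)"
    and ip_pos: "f \<in> H \<Longrightarrow> f \<noteq> (\<lambda>x. 0) \<Longrightarrow> 0 < Re (ip f f)"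
    and complete:
      "(\<And>n::nat. F n \<in> H) \<Longrightarrow>
       (\<And>e. 0 < e \<Longrightarrow> \<exists>N. \<forall>m\<ge>N. \<forall>n\<ge>N. hnorm ip (\<lambda>x. F m x - F n x) < e) \<Longrightarrow>
       \<exists>f\<in>H. (\<lambda>n. hnorm ip (\<lambda>x. F n x - f x)) \<longlonglongrightarrow> 0"

definition kernel_section :: "'a set \<Rightarrow> ('a \<Rightarrow> 'a \<Rightarrow> complex) \<Rightarrow> 'a \<Rightarrow> 'a \<Rightarrow> complex"
  where "kernel_section X K w = (\<lambda>z. if z \<in> X then K z w else 0)"

locale rkhs = function_hilbert_space X H ip
  for X :: "'a set"
    and H :: "('a \<Rightarrow> complex) set"
    and ip :: "('a \<Rightarrow> complex) \<Rightarrow> ('a \<Rightarrow> complex) \<Rightarrow> complex" +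
  fixes K :: "'a \<Rightarrow> 'a \<Rightarrow> complex"
  assumes kernel_mem: "w \<in> X \<Longrightarrow> kernel_section X K w \<in> H"
    and reproducing: "f \<in> H \<Longrightarrow> w \<in> X \<Longrightarrow> ip f (kernel_section X K w) = f w"

definition Mult :: "('a \<Rightarrow> complex) set \<Rightarrow> ('a \<Rightarrow> complex) set"
  where "Mult H = {\<phi>. \<forall>f\<in>H. (\<lambda>z. \<phi> z * f z) \<in> H}"

text \<open>
  The operator norm of multiplication by \<open>\<phi>\<close> on \<open>H\<close>, with value \<open>\<infinity>\<close> for functions that are not
  multipliers. Only the values of \<open>\<phi>\<close> on \<open>X\<close> matter.
\<close>

definition mult_norm ::
  "('a \<Rightarrow> complex) set \<Rightarrow> (('a \<Rightarrow> complex) \<Rightarrow> ('a \<Rightarrow> complex) \<Rightarrow> complex) \<Rightarrow> ('a \<Rightarrow> complex) \<Rightarrow> ennreal"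
  where "mult_norm H ip \<phi> =
    (if \<phi> \<in> Mult H
     then SUP f\<in>{f \<in> H. hnorm ip f \<le> 1}. ennreal (hnorm ip (\<lambda>z. \<phi> z * f z))
     else \<infinity>)"

definition positive_semidefinite_on :: "'a set \<Rightarrow> ('a \<Rightarrow> 'a \<Rightarrow> complex) \<Rightarrow> bool"
  where "positive_semidefinite_on X k \<longleftrightarrow>
    (\<forall>F c. finite F \<longrightarrow> F \<subseteq> X \<longrightarrow>
       (let s = (\<Sum>z\<in>F. \<Sum>w\<in>F. c z * cnj (c w) * k z w) in Im s = 0 \<and> 0 \<le> Re s))"

definition complete_pick_kernel :: "'a set \<Rightarrow> ('a \<Rightarrow> 'a \<Rightarrow> complex) \<Rightarrow> bool"
  where "complete_pick_kernel X K \<longleftrightarrow>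
    (\<forall>z\<in>X. \<forall>w\<in>X. K z w \<noteq> 0) \<and> positive_semidefinite_on X (\<lambda>z w. 1 - 1 / K z w)"


section \<open>Unitarily invariant spaces on the ball\<close>

text \<open>The Euclidean unit ball of \<open>\<complex>\<^sup>d\<close> is \<open>ball 0 1\<close> in the type \<open>complex ^ 'd\<close>.\<close>

definition hermitian_inner :: "complex ^ 'd \<Rightarrow> complex ^ 'd \<Rightarrow> complex"
  where "hermitian_inner z w = (\<Sum>i\<in>UNIV. z $ i * cnj (w $ i))"

definition ui_kernel :: "(nat \<Rightarrow> real) \<Rightarrow> complex ^ 'd \<Rightarrow> complex ^ 'd \<Rightarrow> complex"
  where "ui_kernel a z w = (\<Sum>n. complex_of_real (a n) * hermitian_inner z w ^ n)"

definition holomorphic_several :: "(complex ^ 'd \<Rightarrow> complex) \<Rightarrow> (complex ^ 'd) set \<Rightarrow> bool"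
  where "holomorphic_several f U \<longleftrightarrow>
    (\<forall>z\<in>U. \<exists>D. (f has_derivative D) (at z) \<and> (\<forall>c v. D (c *s v) = c * D v))"

locale regular_unitarily_invariant_space =
  rkhs "ball (0 :: complex ^ 'd) 1" H ip "ui_kernel a"
  for H :: "(complex ^ 'd \<Rightarrow> complex) set"
    and ip :: "(complex ^ 'd \<Rightarrow> complex) \<Rightarrow> (complex ^ 'd \<Rightarrow> complex) \<Rightarrow> complex"
    and a :: "nat \<Rightarrow> real" +
  assumes holomorphic: "f \<in> H \<Longrightarrow> holomorphic_several f (ball 0 1)"
    and coeff_pos: "a n > 0"
    and coeff_0: "a 0 = 1"
    and coeff_ratio: "(\<lambda>n. a n / a (Suc n)) \<longlonglongrightarrow> 1"

definition polynomial_several :: "(complex ^ 'd \<Rightarrow> complex) \<Rightarrow> bool"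
  where "polynomial_several p \<longleftrightarrow>
    (\<exists>(I :: ('d \<Rightarrow> nat) set) c. finite I \<and>
       p = (\<lambda>z. \<Sum>\<alpha>\<in>I. c \<alpha> * (\<Prod>i\<in>UNIV. (z $ i) ^ \<alpha> i)))"


section \<open>Complex measures\<close>

text \<open>
  A complex measure on the measurable space \<open>M\<close> is a countably additive complex set function
  on \<open>sets M\<close>; its values on other sets, and the measure carried by \<open>M\<close>, play no role.
\<close>

definition complex_measure :: "'a measure \<Rightarrow> ('a set \<Rightarrow> complex) \<Rightarrow> bool"
  where "complex_measure M \<nu> \<longleftrightarrow>
    \<nu> {} = 0 \<and>
    (\<forall>A :: nat \<Rightarrow> 'a set. range A \<subseteq> sets M \<longrightarrow> disjoint_family A \<longrightarrow>
       (\<lambda>n. \<nu> (A n)) sums \<nu> (\<Union>n. A n))"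

definition total_variation :: "'a measure \<Rightarrow> ('a set \<Rightarrow> complex) \<Rightarrow> 'a set \<Rightarrow> ennreal"
  where "total_variation M \<nu> E =
    (SUP A\<in>{A :: nat \<Rightarrow> 'a set. range A \<subseteq> sets M \<and> disjoint_family A \<and> (\<Union>n. A n) = E}.
       \<Sum>n. ennreal (cmod (\<nu> (A n))))"

definition concentrated_on :: "'a measure \<Rightarrow> ('a set \<Rightarrow> complex) \<Rightarrow> 'a set \<Rightarrow> bool"
  where "concentrated_on M \<nu> E \<longleftrightarrow> E \<in> sets M \<and> total_variation M \<nu> (space M - E) = 0"

definition mutually_singular :: "'a measure \<Rightarrow> ('a set \<Rightarrow> complex) \<Rightarrow> ('a set \<Rightarrow> complex) \<Rightarrow> bool"
  where "mutually_singular M \<nu> \<mu> \<longleftrightarrow>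
    (\<exists>A\<in>sets M. concentrated_on M \<nu> A \<and> concentrated_on M \<mu> (space M - A))"

definition complex_measure_of :: "'a measure \<Rightarrow> 'a set \<Rightarrow> complex"
  where "complex_measure_of \<mu> A = complex_of_real (measure \<mu> A)"

text \<open>
  The positive part \<open>A \<mapsto> sup {\<sigma> B | B \<subseteq> A}\<close> of the Jordan decomposition of a finite signed
  measure \<open>\<sigma>\<close>; the negative part is the positive part of \<open>-\<sigma>\<close>.
\<close>

definition jordan_pos :: "'a measure \<Rightarrow> ('a set \<Rightarrow> real) \<Rightarrow> 'a measure"
  where "jordan_pos M \<sigma> =
    measure_of (space M) (sets M) (\<lambda>A. SUP B\<in>{B \<in> sets M. B \<subseteq> A}. ennreal (\<sigma> B))"

definition complex_measure_integral ::
  "'a measure \<Rightarrow> ('a set \<Rightarrow> complex) \<Rightarrow> ('a \<Rightarrow> complex) \<Rightarrow> complex"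
  where "complex_measure_integral M \<nu> f =
    ((\<integral>x. f x \<partial>jordan_pos M (\<lambda>A. Re (\<nu> A))) - (\<integral>x. f x \<partial>jordan_pos M (\<lambda>A. - Re (\<nu> A)))) +
    \<i> * ((\<integral>x. f x \<partial>jordan_pos M (\<lambda>A. Im (\<nu> A))) - (\<integral>x. f x \<partial>jordan_pos M (\<lambda>A. - Im (\<nu> A))))"

abbreviation sphere_borel :: "(complex ^ 'd) measure"
  where "sphere_borel \<equiv> restrict_space borel (sphere 0 1)"

definition sphere_prob :: "(complex ^ 'd) measure \<Rightarrow> bool"
  where "sphere_prob \<mu> \<longleftrightarrow> prob_space \<mu> \<and> sets \<mu> = sets sphere_borel"


section \<open>Energy, capacity, Henkin and totally singular measures\<close>

text \<open>
  \<open>Re\<close> only serves to turn the double integral, which is a non-negative real number, into an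
  extended non-negative real.
\<close>

definition energy :: "(nat \<Rightarrow> real) \<Rightarrow> (complex ^ 'd) measure \<Rightarrow> ennreal"
  where "energy a \<mu> =
    (SUP r\<in>{0..<1::real}. ennreal (Re (\<integral>z. (\<integral>w. ui_kernel a (r *\<^sub>R z) (r *\<^sub>R w) \<partial>\<mu>) \<partial>\<mu>)))"

text \<open>In \<open>ennreal\<close>, \<open>1 / \<infinity> = 0\<close> and the supremum of the empty set is \<open>0\<close>.\<close>

definition compact_capacity :: "(nat \<Rightarrow> real) \<Rightarrow> (complex ^ 'd) set \<Rightarrow> ennreal"
  where "compact_capacity a F =
    (SUP \<mu>\<in>{\<mu>. sphere_prob \<mu> \<and> emeasure \<mu> (sphere 0 1 - F) = 0}. 1 / energy a \<mu>)"

definition inner_capacity :: "(nat \<Rightarrow> real) \<Rightarrow> (complex ^ 'd) set \<Rightarrow> ennreal"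
  where "inner_capacity a E = (SUP F\<in>{F. compact F \<and> F \<subseteq> E}. compact_capacity a F)"

definition henkin ::
  "(complex ^ 'd \<Rightarrow> complex) set \<Rightarrow> ((complex ^ 'd \<Rightarrow> complex) \<Rightarrow> (complex ^ 'd \<Rightarrow> complex) \<Rightarrow> complex) \<Rightarrow>
   ((complex ^ 'd) set \<Rightarrow> complex) \<Rightarrow> bool"
  where "henkin H ip \<mu> \<longleftrightarrow>
    complex_measure sphere_borel \<mu> \<and>
    (\<forall>p :: nat \<Rightarrow> complex ^ 'd \<Rightarrow> complex.
       (\<forall>n. polynomial_several (p n)) \<longrightarrow>
       (SUP n. mult_norm H ip (p n)) < \<infinity> \<longrightarrow>
       (\<forall>z\<in>ball 0 1. (\<lambda>n. p n z) \<longlonglongrightarrow> 0) \<longrightarrow>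
       (\<lambda>n. complex_measure_integral sphere_borel \<mu> (p n)) \<longlonglongrightarrow> 0)"

definition totally_singular ::
  "(complex ^ 'd \<Rightarrow> complex) set \<Rightarrow> ((complex ^ 'd \<Rightarrow> complex) \<Rightarrow> (complex ^ 'd \<Rightarrow> complex) \<Rightarrow> complex) \<Rightarrow>
   ((complex ^ 'd) set \<Rightarrow> complex) \<Rightarrow> bool"
  where "totally_singular H ip \<nu> \<longleftrightarrow>
    complex_measure sphere_borel \<nu> \<and>
    (\<forall>\<mu>. henkin H ip \<mu> \<longrightarrow> mutually_singular sphere_borel \<nu> \<mu>)"

end

theory Submission imports Defs begin

text \<open>
  A measure of finite energy acts boundedly on the space \<open>H\<close>, and a sequence of polynomials that is
  bounded in the multiplier norm and tends to zero pointwise tends to zero weakly in \<open>H\<close>; hence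
  measures of finite energy are Henkin.

  Conversely, let \<open>\<sigma>\<close> be a positive measure such that no \<open>u \<sigma>\<close> is a probability measure of finite
  energy. Minimising the energy of \<open>u \<sigma>\<close> at level \<open>r < 1\<close> plus \<open>\<integral> u\<^sup>2 d\<sigma>\<close> yields minima \<open>I\<close> that tend to
  infinity as \<open>r\<close> tends to 1, since otherwise the minimisers would converge in \<open>L\<^sup>2(\<sigma>)\<close> to a density
  of finite energy. The first variation shows that the potential \<open>h\<close> of \<open>u \<sigma>\<close> satisfies \<open>Re h \<ge> I/4\<close>
  off a set of small \<open>\<sigma>\<close>-measure, while \<open>h / I\<close> has small norm.
  For \<open>\<sigma> = |\<nu>|\<close> this provides a carrier of \<open>\<nu>\<close> that is null for all measures of finite energy.
  For the restriction \<open>\<sigma>\<close> of a Henkin measure \<open>\<mu>\<close> to a compact set \<open>F\<close> of capacity zero, the complete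
  Pick property makes \<open>1 - 1 / (2 h)\<close> a contractive multiplier. Its powers, approximated by polynomials
  in the multiplier norm, tend to 0 in the ball and on the sphere off \<open>F\<close>, and to 1 almost everywhere on
  \<open>F\<close>, so that \<open>\<mu>(F) = 0\<close>.
\<close>

section \<open>Hilbert spaces of functions\<close>

text \<open>The Henkin property tests polynomials under a multiplier bound, so a set of capacity
  zero has to be peaked by polynomials. At a level \<open>r < 1\<close> the factor
  \<open>r ^ n\<close> beats the possible growth of \<open>a m / a (m + n)\<close>, which puts
  potentials into the norm closure of the polynomials; hence all constructions live below level 1
  and only their estimates are uniform in \<open>r\<close>. The square penalty makes near-minimisers
  Cauchy in the mean, and it adds just the term \<open>u\<close> to the first variation:
  \<open>Re h + u \<ge> I / 2\<close> off a small set, and Markov's inequality for \<open>u\<close>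
  turns I/2 into I/4. The Pick property enters through \<open>b = 1 - 1 / K\<close>. Contractivity
  of multiplication by b(., w) says that K(z,w) + cnj K(v,w) - 1, times K(z,v), is positive; this is
  affine in the section and therefore passes to potentials. It also bounds |K(x,y)| by a multiple of
  1/|x - y|^2, which keeps potentials bounded off the support. The 2 in 1 - 1 / (2 h) averages 1 - 1
  / h with 1: the former may have modulus 1 where h is finite, the average cannot, so its powers
  decay wherever h stays bounded.\<close>

context function_hilbert_space
begin

lemma diff_mem: assumes "f \<in> H" "g \<in> H" shows "(\<lambda>x. f x - g x) \<in> H"
proof -
  have "(\<lambda>x. f x + (-1) * g x) \<in> H" using assms by (intro add_mem scale_mem)
  then show ?thesis by simp
qed

lemma sum_mem: "finite I \<Longrightarrow> (\<And>i. i \<in> I \<Longrightarrow> f i \<in> H) \<Longrightarrow> (\<lambda>x. \<Sum>i\<in>I. f i x) \<in> H"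
  by (induction I rule: finite_induct) (auto intro: zero_mem add_mem)

lemma ip_zero_left: "h \<in> H \<Longrightarrow> ip (\<lambda>x. 0) h = 0"
  using ip_scale[OF zero_mem, of h 0] by simp

lemma ip_diff: assumes "f \<in> H" "g \<in> H" "h \<in> H"
  shows "ip (\<lambda>x. f x - g x) h = ip f h - ip g h"
proof -
  have "ip (\<lambda>x. f x + (-1) * g x) h = ip f h + (-1) * ip g h"
    using assms by (simp only: ip_add scale_mem ip_scale)
  then show ?thesis by simp
qed

lemma ip_sum: "finite I \<Longrightarrow> (\<And>i. i \<in> I \<Longrightarrow> f i \<in> H) \<Longrightarrow> h \<in> H \<Longrightarrow>
    ip (\<lambda>x. \<Sum>i\<in>I. f i x) h = (\<Sum>i\<in>I. ip (f i) h)"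
  by (induction I rule: finite_induct) (auto simp: ip_zero_left ip_add sum_mem)

lemma ip_self_real: "f \<in> H \<Longrightarrow> ip f f = complex_of_real (Re (ip f f))"
  using ip_cnj[of f f] by (auto simp: complex_eq_iff)

lemma ip_self_nonneg: "f \<in> H \<Longrightarrow> 0 \<le> Re (ip f f)"
  using ip_pos[of f] ip_zero_left[OF zero_mem] by (cases "f = (\<lambda>x. 0)") auto

lemma hnorm_nonneg: "f \<in> H \<Longrightarrow> 0 \<le> hnorm ip f"
  by (simp add: hnorm_def ip_self_nonneg)

lemma hnorm_sq: "f \<in> H \<Longrightarrow> (hnorm ip f)\<^sup>2 = Re (ip f f)"
  by (simp add: hnorm_def ip_self_nonneg)

text \<open>The one expansion of the norm from which scaling, Cauchy-Schwarz, the triangle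
  inequality and the parallelogram law below are read off.\<close>

lemma hnorm_sq_add_scale: assumes "f \<in> H" "g \<in> H"
  shows "(hnorm ip (\<lambda>x. f x + c * g x))\<^sup>2 =
    (hnorm ip f)\<^sup>2 + 2 * Re (cnj c * ip f g) + (cmod c)\<^sup>2 * (hnorm ip g)\<^sup>2"
proof -
  let ?g = "\<lambda>x. c * g x"
  have g: "?g \<in> H" and s: "(\<lambda>x. f x + ?g x) \<in> H" using assms by (auto intro: scale_mem add_mem)
  have r: "ip f (\<lambda>x. f x + ?g x) = ip f f + cnj c * ip f g"
    using assms g s ip_cnj[OF s assms(1)] ip_cnj[OF assms(2,1)] ip_cnj[OF assms(1) assms(1)]
    by (simp add: ip_add ip_scale)
  have r2: "ip g (\<lambda>x. f x + ?g x) = cnj (ip f g) + cnj c * ip g g"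
    using assms g s ip_cnj[OF s assms(2)] ip_cnj[OF assms(1,2)] ip_cnj[OF assms(2) assms(2)]
    by (simp add: ip_add ip_scale)
  have "ip (\<lambda>x. f x + ?g x) (\<lambda>x. f x + ?g x) =
      ip f f + cnj c * ip f g + cnj (cnj c * ip f g) + c * cnj c * ip g g"
    using assms g s r r2 by (simp add: ip_add ip_scale algebra_simps)
  then have "Re (ip (\<lambda>x. f x + ?g x) (\<lambda>x. f x + ?g x)) =
      Re (ip f f) + 2 * Re (cnj c * ip f g) + Re (c * cnj c * ip g g)"
    by simp
  also have "c * cnj c * ip g g = complex_of_real ((cmod c)\<^sup>2 * Re (ip g g))"
    using ip_self_real[OF assms(2)] by (metis complex_norm_square of_real_mult)
  finally show ?thesis using assms s by (simp add: hnorm_sq)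
qed

lemma hnorm_zero: "hnorm ip (\<lambda>x. 0) = 0"
  by (simp add: hnorm_def ip_zero_left zero_mem)

lemma hnorm_scale: assumes "f \<in> H" shows "hnorm ip (\<lambda>x. c * f x) = cmod c * hnorm ip f"
proof -
  have "(hnorm ip (\<lambda>x. c * f x))\<^sup>2 = (cmod c * hnorm ip f)\<^sup>2"
    using hnorm_sq_add_scale[OF zero_mem assms, of c] hnorm_zero ip_zero_left[OF assms]
    by (simp add: power_mult_distrib)
  then show ?thesis using hnorm_nonneg[OF assms] hnorm_nonneg[OF scale_mem[OF assms]]
    by (simp add: power2_eq_iff_nonneg)
qed

lemma Cauchy_Schwarz: assumes f: "f \<in> H" and g: "g \<in> H"
  shows "cmod (ip f g) \<le> hnorm ip f * hnorm ip g"
proof (cases "g = (\<lambda>x. 0)")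
  case True
  have "ip f g = 0" using ip_cnj[OF g f] ip_zero_left[OF f] True by simp
  then show ?thesis by (simp add: True hnorm_zero)
next
  case False
  have n: "0 < (hnorm ip g)\<^sup>2" using ip_pos[OF g False] by (simp add: hnorm_sq g)
  \<comment> \<open>The minimiser of the norm of \<open>f + c g\<close> over \<open>c\<close>;
    nonnegativity of the minimum is the inequality.\<close>
  define c where "c = - ip f g / complex_of_real ((hnorm ip g)\<^sup>2)"
  have "0 \<le> (hnorm ip f)\<^sup>2 + 2 * Re (cnj c * ip f g) + (cmod c)\<^sup>2 * (hnorm ip g)\<^sup>2"
    unfolding hnorm_sq_add_scale[OF f g, symmetric] by simp
  moreover have "Re (cnj c * ip f g) = - (cmod (ip f g))\<^sup>2 / (hnorm ip g)\<^sup>2"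
  proof -
    have "cnj c * ip f g = - complex_of_real ((cmod (ip f g))\<^sup>2 / (hnorm ip g)\<^sup>2)"
      unfolding c_def using complex_norm_square[of "ip f g"] by (simp add: mult.commute)
    then show ?thesis by simp
  qed
  moreover have "(cmod c)\<^sup>2 * (hnorm ip g)\<^sup>2 = (cmod (ip f g))\<^sup>2 / (hnorm ip g)\<^sup>2"
  proof -
    have "cmod c = cmod (ip f g) / (hnorm ip g)\<^sup>2" unfolding c_def by (simp add: norm_divide norm_power)
    then show ?thesis using n by (simp add: field_simps power2_eq_square)
  qed
  ultimately have "(cmod (ip f g))\<^sup>2 / (hnorm ip g)\<^sup>2 \<le> (hnorm ip f)\<^sup>2" by simp
  then have "(cmod (ip f g))\<^sup>2 \<le> (hnorm ip f * hnorm ip g)\<^sup>2"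
    using n by (simp add: field_simps power_mult_distrib)
  then show ?thesis using hnorm_nonneg f g by (meson mult_nonneg_nonneg power2_le_imp_le)
qed

lemma hnorm_triangle: assumes f: "f \<in> H" and g: "g \<in> H"
  shows "hnorm ip (\<lambda>x. f x + g x) \<le> hnorm ip f + hnorm ip g"
proof -
  have "(hnorm ip (\<lambda>x. f x + g x))\<^sup>2 = (hnorm ip f)\<^sup>2 + 2 * Re (ip f g) + (hnorm ip g)\<^sup>2"
    using hnorm_sq_add_scale[OF f g, of 1] by simp
  also have "\<dots> \<le> (hnorm ip f + hnorm ip g)\<^sup>2"
    using Cauchy_Schwarz[OF f g] complex_Re_le_cmod[of "ip f g"] by (simp add: power2_sum)
  finally show ?thesis using hnorm_nonneg f g by (meson add_nonneg_nonneg power2_le_imp_le)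
qed

end

section \<open>The Riesz lemma in a reproducing kernel Hilbert space\<close>

definition kernel_comb :: "'a set \<Rightarrow> ('a \<Rightarrow> 'a \<Rightarrow> complex) \<Rightarrow> 'a set \<Rightarrow> ('a \<Rightarrow> complex) \<Rightarrow> 'a \<Rightarrow> complex"
  where "kernel_comb X K F c = (\<lambda>z. \<Sum>w\<in>F. c w * kernel_section X K w z)"

text \<open>The coefficients \<open>d\<close> do not depend on \<open>\<phi>\<close>, so that kernel functions and the values of a
  functional on them can be combined simultaneously.\<close>

lemma finite_comb_add:
  fixes c c' :: "'a \<Rightarrow> complex"
  assumes "finite F" "finite F'"
  obtains d where "\<And>\<phi> :: 'a \<Rightarrow> complex.
    (\<Sum>w\<in>F \<union> F'. d w * \<phi> w) = (\<Sum>w\<in>F. c w * \<phi> w) + t * (\<Sum>w\<in>F'. c' w * \<phi> w)"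
proof
  fix \<phi> :: "'a \<Rightarrow> complex"
  let ?d = "\<lambda>w. (if w \<in> F then c w else 0) + t * (if w \<in> F' then c' w else 0)"
  have 1: "(\<Sum>w\<in>F. c w * \<phi> w) = (\<Sum>w\<in>F \<union> F'. if w \<in> F then c w * \<phi> w else 0)"
    using assms by (subst sum.inter_restrict[symmetric]) (auto intro!: sum.cong)
  have 2: "(\<Sum>w\<in>F'. c' w * \<phi> w) = (\<Sum>w\<in>F \<union> F'. if w \<in> F' then c' w * \<phi> w else 0)"
    using assms by (subst sum.inter_restrict[symmetric]) (auto intro!: sum.cong)
  show "(\<Sum>w\<in>F \<union> F'. ?d w * \<phi> w) = (\<Sum>w\<in>F. c w * \<phi> w) + t * (\<Sum>w\<in>F'. c' w * \<phi> w)"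
    unfolding 1 2 sum_distrib_left sum.distrib[symmetric]
    by (intro sum.cong) (auto simp: algebra_simps)
qed

context rkhs
begin

lemma kernel_comb_mem: "finite F \<Longrightarrow> F \<subseteq> X \<Longrightarrow> kernel_comb X K F c \<in> H"
  unfolding kernel_comb_def by (intro sum_mem scale_mem kernel_mem) auto

lemma ip_kernel_comb: assumes "finite F" "F \<subseteq> X" "f \<in> H"
  shows "ip f (kernel_comb X K F c) = (\<Sum>w\<in>F. cnj (c w) * f w)"
proof -
  have "ip (kernel_comb X K F c) f = (\<Sum>w\<in>F. c w * ip (kernel_section X K w) f)"
    unfolding kernel_comb_def using assms
    by (subst ip_sum) (auto intro!: scale_mem kernel_mem sum.cong ip_scale)
  also have "\<dots> = (\<Sum>w\<in>F. c w * cnj (f w))"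
    using assms by (intro sum.cong refl) (metis ip_cnj kernel_mem reproducing subset_eq)
  finally have "ip f (kernel_comb X K F c) = cnj (\<Sum>w\<in>F. c w * cnj (f w))"
    using ip_cnj[OF kernel_comb_mem assms(3)] assms by metis
  then show ?thesis by simp
qed

lemma hnorm_kernel_comb: assumes "finite F" "F \<subseteq> X"
  shows "(hnorm ip (kernel_comb X K F c))\<^sup>2 = Re (\<Sum>z\<in>F. \<Sum>w\<in>F. cnj (c z) * c w * K z w)"
proof -
  have "(hnorm ip (kernel_comb X K F c))\<^sup>2 = Re (\<Sum>z\<in>F. cnj (c z) * kernel_comb X K F c z)"
    using assms by (simp add: hnorm_sq kernel_comb_mem ip_kernel_comb)
  also have "(\<Sum>z\<in>F. cnj (c z) * kernel_comb X K F c z) = (\<Sum>z\<in>F. \<Sum>w\<in>F. cnj (c z) * c w * K z w)"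
    using assms(2) unfolding kernel_comb_def kernel_section_def sum_distrib_left
    by (intro sum.cong refl) (auto simp: mult.assoc)
  finally show ?thesis .
qed

lemma hnorm_kernel_section: "w \<in> X \<Longrightarrow> (hnorm ip (kernel_section X K w))\<^sup>2 = Re (K w w)"
  by (simp add: hnorm_sq kernel_mem reproducing) (simp add: kernel_section_def)

lemma norm_eval_le: "f \<in> H \<Longrightarrow> w \<in> X \<Longrightarrow> cmod (f w) \<le> hnorm ip f * hnorm ip (kernel_section X K w)"
  using Cauchy_Schwarz[OF _ kernel_mem] reproducing by metis

text \<open>The element representing the bounded functional \<open>\<Lambda>\<close>, \<open>\<Lambda> k\<^sub>w = cnj (g w)\<close>, on the span of
  the kernel functions is the limit of a minimising sequence for \<open>\<parallel>x\<parallel>\<^sup>2 - 2 Re \<Lambda> x\<close>.\<close>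

lemma riesz:
  assumes g0: "\<And>x. x \<notin> X \<Longrightarrow> g x = 0" and C: "0 \<le> C"
    and bd: "\<And>F c. finite F \<Longrightarrow> F \<subseteq> X \<Longrightarrow>
      cmod (\<Sum>w\<in>F. c w * cnj (g w)) \<le> C * hnorm ip (kernel_comb X K F c)"
  shows "g \<in> H \<and> hnorm ip g \<le> C \<and>
    (\<forall>e>0. \<exists>F c. finite F \<and> F \<subseteq> X \<and> hnorm ip (\<lambda>x. kernel_comb X K F c x - g x) < e)"
proof -
  define x where "x = (\<lambda>p :: 'a set \<times> ('a \<Rightarrow> complex). kernel_comb X K (fst p) (snd p))"
  define L where "L = (\<lambda>p :: 'a set \<times> ('a \<Rightarrow> complex). \<Sum>w\<in>fst p. snd p w * cnj (g w))"
  define D where "D = {p :: 'a set \<times> ('a \<Rightarrow> complex). finite (fst p) \<and> fst p \<subseteq> X}"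
  define J where "J = (\<lambda>p. (hnorm ip (x p))\<^sup>2 - 2 * Re (L p))"
  have xH: "x p \<in> H" if "p \<in> D" for p using that kernel_comb_mem by (auto simp: D_def x_def)
  have Lb: "cmod (L p) \<le> C * hnorm ip (x p)" if "p \<in> D" for p
    using that bd by (auto simp: D_def x_def L_def)
  have add: "\<exists>q\<in>D. x q = (\<lambda>z. x p z + t * x p' z) \<and> L q = L p + t * L p'"
    if "p \<in> D" "p' \<in> D" for p p' t
  proof -
    obtain d where d: "\<And>\<phi> :: 'a \<Rightarrow> complex. (\<Sum>w\<in>fst p \<union> fst p'. d w * \<phi> w) =
        (\<Sum>w\<in>fst p. snd p w * \<phi> w) + t * (\<Sum>w\<in>fst p'. snd p' w * \<phi> w)"
      using finite_comb_add[of "fst p" "fst p'"] \<open>p \<in> D\<close> \<open>p' \<in> D\<close> unfolding D_def by blast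
    show ?thesis
      using that d by (intro bexI[of _ "(fst p \<union> fst p', d)"]) (auto simp: x_def L_def D_def kernel_comb_def)
  qed
  \<comment> \<open>Completing the square against \<open>Lb\<close>; it makes the infimum
    \<open>I\<close> finite.\<close>
  have Jlow: "- C\<^sup>2 \<le> J p" if "p \<in> D" for p
  proof -
    have "Re (L p) \<le> C * hnorm ip (x p)" using Lb[OF that] complex_Re_le_cmod order_trans by blast
    moreover have "0 \<le> (hnorm ip (x p) - C)\<^sup>2" by simp
    ultimately show ?thesis unfolding J_def by (simp add: power2_eq_square algebra_simps)
  qed
  have Dne: "({}, \<lambda>_. 0) \<in> D" by (auto simp: D_def)
  define I where "I = Inf (J ` D)"
  have bdd: "bdd_below (J ` D)" using Jlow by (intro bdd_belowI[of _ "- C\<^sup>2"]) auto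
  have Ile: "I \<le> J p" if "p \<in> D" for p unfolding I_def using bdd that by (intro cINF_lower) auto
  have "\<exists>p\<in>D. J p < I + 1 / real (Suc n)" for n
    using cINF_less_iff[of D J "I + 1 / real (Suc n)"] bdd Dne unfolding I_def by auto
  then obtain P where PD: "\<And>n. P n \<in> D" and PJ: "\<And>n. J (P n) < I + 1 / real (Suc n)" by metis
  \<comment> \<open>Parallelogram law: the midpoint \<open>m\<close> of \<open>p\<close> and
    \<open>q\<close> is again a combination, so \<open>J m\<close> is at least \<open>I\<close>. The
    empty combination serves as the zero vector, so that \<open>add\<close> can halve
    \<open>s\<close>.\<close>
  have par: "(hnorm ip (\<lambda>z. x p z - x q z))\<^sup>2 \<le> 2 * J p + 2 * J q - 4 * I" if pq: "p \<in> D" "q \<in> D" for p q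
  proof -
    obtain s where s: "s \<in> D" "x s = (\<lambda>z. x p z + 1 * x q z)" "L s = L p + 1 * L q"
      using add[OF pq, of 1] by blast
    obtain m where m: "m \<in> D" "x m = (\<lambda>z. x ({}, \<lambda>_. 0) z + (1/2) * x s z)" "L m = L ({}, \<lambda>_. 0) + (1/2) * L s"
      using add[OF Dne s(1)] by blast
    have m': "x m = (\<lambda>z. (1/2) * x s z)" "L m = L s / 2"
      using m(2,3) by (auto simp: x_def L_def kernel_comb_def)
    have "(hnorm ip (x m))\<^sup>2 = (hnorm ip (x s))\<^sup>2 / 4"
      unfolding m' hnorm_scale[OF xH[OF s(1)], of "1/2"] by (simp add: power_mult_distrib power_divide)
    moreover have "(hnorm ip (x s))\<^sup>2 = (hnorm ip (x p))\<^sup>2 + 2 * Re (ip (x p) (x q)) + (hnorm ip (x q))\<^sup>2"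
      unfolding s(2) using hnorm_sq_add_scale[OF xH xH, of p q 1] pq by simp
    moreover have "(hnorm ip (\<lambda>z. x p z - x q z))\<^sup>2 =
        (hnorm ip (x p))\<^sup>2 - 2 * Re (ip (x p) (x q)) + (hnorm ip (x q))\<^sup>2"
      using hnorm_sq_add_scale[OF xH xH, of p q "-1"] pq by simp
    moreover have "I \<le> (hnorm ip (x m))\<^sup>2 - 2 * Re (L m)" using Ile[OF m(1)] by (simp add: J_def)
    moreover have "Re (L m) = (Re (L p) + Re (L q)) / 2" unfolding m'(2) s(3) by simp
    ultimately show ?thesis unfolding J_def by argo
  qed
  have Cau: "\<exists>N. \<forall>m\<ge>N. \<forall>n\<ge>N. hnorm ip (\<lambda>z. x (P m) z - x (P n) z) < e" if "0 < e" for e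
  proof -
    obtain N where N: "4 / e\<^sup>2 < real (Suc N)" using reals_Archimedean2 less_trans
      by (metis lessI of_nat_less_iff)
    show ?thesis
    proof (intro exI[of _ N] allI impI)
      fix m n assume mn: "N \<le> m" "N \<le> n"
      have "1 / real (Suc m) \<le> 1 / real (Suc N)" "1 / real (Suc n) \<le> 1 / real (Suc N)"
        using mn by (auto intro!: divide_left_mono)
      moreover have "4 / real (Suc N) < e\<^sup>2" using N that by (simp add: field_simps)
      ultimately have "(hnorm ip (\<lambda>z. x (P m) z - x (P n) z))\<^sup>2 < e\<^sup>2"
        using par[OF PD PD, of m n] PJ[of m] PJ[of n] by simp
      then show "hnorm ip (\<lambda>z. x (P m) z - x (P n) z) < e"
        using that by (meson less_eq_real_def power_less_imp_less_base)
    qed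
  qed
  obtain f where fH: "f \<in> H" and lim: "(\<lambda>n. hnorm ip (\<lambda>z. x (P n) z - f z)) \<longlonglongrightarrow> 0"
    using complete[OF xH[OF PD] Cau] by blast
  have diffH: "(\<lambda>z. x (P n) z - f z) \<in> H" for n by (intro diff_mem xH PD fH)
  have pt: "(\<lambda>n. x (P n) w) \<longlonglongrightarrow> f w" if "w \<in> X" for w
  proof -
    have "(\<lambda>n. hnorm ip (\<lambda>z. x (P n) z - f z) * hnorm ip (kernel_section X K w)) \<longlonglongrightarrow> 0"
      using tendsto_mult[OF lim tendsto_const] by simp
    then have "(\<lambda>n. x (P n) w - f w) \<longlonglongrightarrow> 0"
      by (rule Lim_null_comparison[rotated]) (intro always_eventually allI norm_eval_le[OF diffH that])
    then show ?thesis by (simp add: LIM_zero_iff)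
  qed
  \<comment> \<open>First variation: \<open>J\<close> is nearly minimal at \<open>P n\<close>, and
    adding \<open>t\<close> times the section at \<open>w\<close> changes it by this quadratic in
    \<open>t\<close>, so the quadratic is nonnegative in the limit.\<close>
  have var: "0 \<le> 2 * Re (cnj t * (f w - g w)) + (cmod t)\<^sup>2 * Re (K w w)" if w: "w \<in> X" for w t
  proof -
    have wD: "({w}, \<lambda>_. 1) \<in> D" using w by (auto simp: D_def)
    have xw: "x ({w}, \<lambda>_. 1) = kernel_section X K w" "L ({w}, \<lambda>_. 1) = cnj (g w)"
      by (auto simp: x_def L_def kernel_comb_def)
    have ge: "- (1 / real (Suc n)) \<le> 2 * Re (cnj t * (x (P n) w - g w)) + (cmod t)\<^sup>2 * Re (K w w)" for n
    proof -
      obtain q where q: "q \<in> D" "x q = (\<lambda>z. x (P n) z + t * kernel_section X K w z)" "L q = L (P n) + t * cnj (g w)"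
        using add[OF PD wD, of n t] xw by auto
      have "(hnorm ip (x q))\<^sup>2 = (hnorm ip (x (P n)))\<^sup>2 + 2 * Re (cnj t * x (P n) w) + (cmod t)\<^sup>2 * Re (K w w)"
        unfolding q(2) using hnorm_sq_add_scale[OF xH[OF PD] kernel_mem[OF w]]
        by (simp add: reproducing xH PD w hnorm_kernel_section)
      moreover have "Re (t * cnj (g w)) = Re (cnj t * g w)" by simp
      ultimately show ?thesis using Ile[OF q(1)] PJ[of n] q(3) by (simp add: J_def algebra_simps)
    qed
    have l1: "(\<lambda>n. - (1 / real (Suc n))) \<longlonglongrightarrow> 0"
      using LIMSEQ_inverse_real_of_nat by (simp add: inverse_eq_divide tendsto_minus_cancel_left[symmetric])
    have l2: "(\<lambda>n. 2 * Re (cnj t * (x (P n) w - g w)) + (cmod t)\<^sup>2 * Re (K w w)) \<longlonglongrightarrow>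
        2 * Re (cnj t * (f w - g w)) + (cmod t)\<^sup>2 * Re (K w w)"
      by (intro tendsto_intros pt w)
    show ?thesis by (rule LIMSEQ_le[OF l1 l2]) (use ge in auto)
  qed
  have "f w = g w" for w
  proof (cases "w \<in> X")
    case True
    define k where "k = Re (K w w)"
    have k: "0 \<le> k" unfolding k_def using hnorm_kernel_section[OF True] by (metis zero_le_power2)
    \<comment> \<open>A step of length \<open>s\<close> against \<open>f w - g w\<close>: since
      \<open>s * k < 2\<close>, the quadratic of \<open>var\<close> would be negative unless the
      difference vanishes.\<close>
    define s where "s = 1 / (k + 1)"
    have s: "0 < s" "s * k < 1" using k by (auto simp: s_def field_simps)
    let ?v = "f w - g w"
    have "0 \<le> 2 * Re (cnj (- of_real s * ?v) * ?v) + (cmod (- of_real s * ?v))\<^sup>2 * k"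
      using var[OF True] unfolding k_def by blast
    moreover have "Re (cnj (- of_real s * ?v) * ?v) = - s * (cmod ?v)\<^sup>2"
      unfolding cmod_power2 by (simp add: power2_eq_square algebra_simps)
    moreover have "(cmod (- of_real s * ?v))\<^sup>2 = s\<^sup>2 * (cmod ?v)\<^sup>2"
      using s by (simp add: norm_mult power_mult_distrib del: minus_diff_eq)
    ultimately have "0 \<le> (s * (cmod ?v)\<^sup>2) * (s * k - 2)" by (simp add: power2_eq_square algebra_simps)
    then have "s * (cmod ?v)\<^sup>2 \<le> 0" using s by (simp add: zero_le_mult_iff)
    then show ?thesis using s by (simp add: mult_le_0_iff)
  qed (use fH g0 zero_outside in simp)
  then have fg: "f = g" by auto
  have ipe: "ip (x p) f = L p" if "p \<in> D" for p
  proof -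
    have "ip f (x p) = (\<Sum>w\<in>fst p. cnj (snd p w) * g w)"
      using that fH fg unfolding x_def D_def by (simp add: ip_kernel_comb)
    then show ?thesis using ip_cnj[OF fH xH[OF that]] by (simp add: L_def)
  qed
  have nx: "(\<lambda>n. hnorm ip (x (P n))) \<longlonglongrightarrow> hnorm ip f"
  proof -
    have "\<bar>hnorm ip (x (P n)) - hnorm ip f\<bar> \<le> hnorm ip (\<lambda>z. x (P n) z - f z)" for n
    proof -
      have "hnorm ip (x (P n)) \<le> hnorm ip f + hnorm ip (\<lambda>z. x (P n) z - f z)"
        using hnorm_triangle[OF fH diffH, of n] by simp
      moreover have "hnorm ip f \<le> hnorm ip (x (P n)) + hnorm ip (\<lambda>z. -1 * (x (P n) z - f z))"
        using hnorm_triangle[OF xH[OF PD] scale_mem[OF diffH], of n "-1" n] by simp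
      ultimately show ?thesis using hnorm_scale[OF diffH, of "-1" n] by simp
    qed
    then have "(\<lambda>n. hnorm ip (x (P n)) - hnorm ip f) \<longlonglongrightarrow> 0"
      by (intro Lim_null_comparison[OF _ lim]) auto
    then show ?thesis by (simp add: LIM_zero_iff)
  qed
  \<comment> \<open>\<open>f\<close> represents the functional on every combination, so the bound
    \<open>C\<close> applies to \<open>ip (x (P n)) f\<close> and reaches \<open>ip f f\<close> in
    the limit.\<close>
  have "(hnorm ip f)\<^sup>2 \<le> C * hnorm ip f"
  proof (rule LIMSEQ_le)
    show "(\<lambda>n. C * hnorm ip (x (P n)) + hnorm ip (\<lambda>z. x (P n) z - f z) * hnorm ip f) \<longlonglongrightarrow> C * hnorm ip f"
      using tendsto_add[OF tendsto_mult[OF tendsto_const nx] tendsto_mult[OF lim tendsto_const]] by simp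
    have "(hnorm ip f)\<^sup>2 \<le> C * hnorm ip (x (P n)) + hnorm ip (\<lambda>z. x (P n) z - f z) * hnorm ip f" for n
    proof -
      have "Re (ip f f) = Re (ip (x (P n)) f) - Re (ip (\<lambda>z. x (P n) z - f z) f)"
        using ip_diff[OF xH[OF PD] fH fH] by simp
      moreover have "Re (ip (x (P n)) f) \<le> C * hnorm ip (x (P n))"
        using ipe[OF PD] Lb[OF PD] complex_Re_le_cmod order_trans by metis
      moreover have "- Re (ip (\<lambda>z. x (P n) z - f z) f) \<le> hnorm ip (\<lambda>z. x (P n) z - f z) * hnorm ip f"
        using Cauchy_Schwarz[OF diffH fH, of n] abs_Re_le_cmod[of "ip (\<lambda>z. x (P n) z - f z) f"] by linarith
      ultimately show ?thesis by (simp add: hnorm_sq fH)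
    qed
    then show "\<exists>N. \<forall>n\<ge>N. (hnorm ip f)\<^sup>2 \<le>
        C * hnorm ip (x (P n)) + hnorm ip (\<lambda>z. x (P n) z - f z) * hnorm ip f" by blast
  qed (rule tendsto_const)
  then have "hnorm ip f \<le> C"
    using hnorm_nonneg[OF fH] C by (cases "hnorm ip f = 0") (auto simp: power2_eq_square)
  moreover have "\<exists>F c. finite F \<and> F \<subseteq> X \<and> hnorm ip (\<lambda>x. kernel_comb X K F c x - g x) < e" if e: "0 < e" for e
  proof -
    obtain n where "hnorm ip (\<lambda>z. x (P n) z - f z) < e"
      using order_tendstoD(2)[OF lim e] by (auto simp: eventually_sequentially)
    then show ?thesis using PD[of n] fg unfolding x_def D_def by auto
  qed
  ultimately show ?thesis using fH fg by auto
qed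

text \<open>Apply \<open>riesz\<close> to the functional given by \<open>f\<close> itself: its
  representing element is \<open>f\<close>, and it arises as a limit of kernel combinations.\<close>

lemma kernel_comb_dense: assumes f: "f \<in> H" and "0 < e"
  obtains F c where "finite F" "F \<subseteq> X" "hnorm ip (\<lambda>x. kernel_comb X K F c x - f x) < e"
proof -
  have "cmod (\<Sum>w\<in>F. c w * cnj (f w)) \<le> hnorm ip f * hnorm ip (kernel_comb X K F c)"
    if F: "finite F" "F \<subseteq> X" for F c
  proof -
    have "cmod (\<Sum>w\<in>F. c w * cnj (f w)) = cmod (cnj (ip f (kernel_comb X K F c)))"
      using F f by (simp add: ip_kernel_comb)
    then show ?thesis using Cauchy_Schwarz[OF f kernel_comb_mem[OF F]] by (metis complex_mod_cnj)
  qed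
  from riesz[OF zero_outside[OF f] hnorm_nonneg[OF f] this] assms that show ?thesis by blast
qed

end

section \<open>Multipliers for the ball kernel and their approximation by polynomials\<close>

section \<open>Monomials indexed by words\<close>

text \<open>On words of length \<open>n\<close> this is the \<open>n\<close>-th tensor power of
  \<open>z\<close>. Indexing by words instead of multi-indices makes all coefficients in the
  expansion of \<open>hermitian_inner z w ^ n\<close> equal to 1.\<close>

definition mon :: "complex ^ 'd \<Rightarrow> 'd list \<Rightarrow> complex"
  where "mon z xs = prod_list (map (\<lambda>i. z $ i) xs)"

definition words :: "nat \<Rightarrow> 'd list set"
  where "words n = {xs. length xs = n}"

definition word_inner :: "nat \<Rightarrow> ('d list \<Rightarrow> complex) \<Rightarrow> ('d list \<Rightarrow> complex) \<Rightarrow> complex"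
  where "word_inner n x y = (\<Sum>xs\<in>words n. x xs * cnj (y xs))"

definition word_sq :: "nat \<Rightarrow> ('d list \<Rightarrow> complex) \<Rightarrow> real"
  where "word_sq n x = (\<Sum>xs\<in>words n. (cmod (x xs))\<^sup>2)"

lemma mon_append: "mon z (xs @ ys) = mon z xs * mon z ys"
  by (simp add: mon_def)

lemma finite_words [simp]: "finite (words n :: 'd::finite list set)"
  using finite_lists_length_eq[of "UNIV :: 'd set" n] by (simp add: words_def)

lemma words_0: "words 0 = {[]}"
  by (auto simp: words_def)

lemma sum_words_Suc:
  "(\<Sum>xs\<in>words (Suc n). f xs) = (\<Sum>i\<in>(UNIV :: 'd::finite set). \<Sum>xs\<in>words n. f (i # xs))"
proof -
  have "words (Suc n) = (\<lambda>(i :: 'd, xs). i # xs) ` (UNIV \<times> words n)"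
    by (auto simp: words_def image_def length_Suc_conv)
  moreover have "inj_on (\<lambda>(i :: 'd, xs). i # xs) (UNIV \<times> words n)" by (auto simp: inj_on_def)
  ultimately show ?thesis by (simp add: sum.reindex sum.cartesian_product case_prod_unfold)
qed

lemma sum_words_append:
  "(\<Sum>xs\<in>words (m + n). f xs) = (\<Sum>xs\<in>words m. \<Sum>ys\<in>(words n :: 'd::finite list set). f (xs @ ys))"
  by (induction m arbitrary: f) (simp_all add: words_0 sum_words_Suc)

lemma hermitian_inner_power:
  fixes z w :: "complex ^ 'd"
  shows "hermitian_inner z w ^ n = word_inner n (mon z) (mon w)"
proof (induction n)
  case (Suc n)
  have "hermitian_inner z w ^ Suc n =
      (\<Sum>i\<in>UNIV. z $ i * cnj (w $ i)) * (\<Sum>xs\<in>words n. mon z xs * cnj (mon w xs))"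
    using Suc by (simp add: hermitian_inner_def word_inner_def)
  also have "\<dots> = (\<Sum>i\<in>UNIV. \<Sum>xs\<in>words n. z $ i * cnj (w $ i) * (mon z xs * cnj (mon w xs)))"
    by (rule sum_product)
  also have "\<dots> = word_inner (Suc n) (mon z) (mon w)"
    unfolding word_inner_def sum_words_Suc by (intro sum.cong refl) (simp add: mon_def)
  finally show ?case .
qed (simp add: word_inner_def words_0 mon_def)

lemma word_sq_nonneg: "0 \<le> word_sq n x"
  by (simp add: word_sq_def sum_nonneg)

lemma word_inner_self: "word_inner n x x = complex_of_real (word_sq n x)"
  unfolding word_inner_def word_sq_def of_real_sum by (intro sum.cong refl) (simp only: complex_norm_square)

lemma cmod_word_inner_le: "cmod (word_inner n x y) \<le> sqrt (word_sq n x) * sqrt (word_sq n y)"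
proof -
  have "cmod (word_inner n x y) \<le> (\<Sum>xs\<in>words n. \<bar>cmod (x xs)\<bar> * \<bar>cmod (y xs)\<bar>)"
    unfolding word_inner_def by (rule order_trans[OF norm_sum]) (simp add: norm_mult)
  also have "\<dots> \<le> L2_set (\<lambda>xs. cmod (x xs)) (words n) * L2_set (\<lambda>xs. cmod (y xs)) (words n)"
    by (rule L2_set_mult_ineq)
  finally show ?thesis by (simp add: L2_set_def word_sq_def)
qed

lemma cmod_hermitian_inner_le: "cmod (hermitian_inner z w) \<le> norm z * norm w"
proof -
  have "cmod (hermitian_inner z w) \<le> (\<Sum>i\<in>UNIV. \<bar>cmod (z $ i)\<bar> * \<bar>cmod (w $ i)\<bar>)"
    unfolding hermitian_inner_def by (rule order_trans[OF norm_sum]) (simp add: norm_mult)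
  also have "\<dots> \<le> norm z * norm w" unfolding norm_vec_def by (rule L2_set_mult_ineq)
  finally show ?thesis .
qed

lemma hermitian_inner_self: "hermitian_inner z z = complex_of_real ((norm z)\<^sup>2)"
proof -
  have "hermitian_inner z z = complex_of_real (\<Sum>i\<in>UNIV. (cmod (z $ i))\<^sup>2)"
    unfolding hermitian_inner_def of_real_sum by (intro sum.cong refl) (simp only: complex_norm_square)
  then show ?thesis by (simp add: norm_vec_def L2_set_def sum_nonneg)
qed

lemma hermitian_inner_cnj: "hermitian_inner w z = cnj (hermitian_inner z w)"
  by (simp add: hermitian_inner_def mult.commute)

lemma hermitian_inner_scaleR:
  "hermitian_inner (r *\<^sub>R z) w = of_real r * hermitian_inner z w"
  "hermitian_inner z (r *\<^sub>R w) = of_real r * hermitian_inner z w"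
  by (simp_all add: hermitian_inner_def sum_distrib_left scaleR_conv_of_real[of r "_::complex"] mult_ac)

lemma hermitian_inner_diff_left: "hermitian_inner (x - y) z = hermitian_inner x z - hermitian_inner y z"
  by (simp add: hermitian_inner_def sum_subtractf algebra_simps)

lemma hermitian_inner_zero [simp]: "hermitian_inner 0 w = 0" "hermitian_inner z 0 = 0"
  by (simp_all add: hermitian_inner_def)

lemma word_sq_mon: "word_sq n (mon z) = (norm z) ^ (2 * n)"
proof -
  have "complex_of_real (word_sq n (mon z)) = complex_of_real ((norm z) ^ (2 * n))"
    by (simp add: word_inner_self[symmetric] hermitian_inner_power[symmetric] hermitian_inner_self power_mult)
  then show ?thesis using of_real_eq_iff by blast
qed

lemma mon_scaleR: "xs \<in> words n \<Longrightarrow> mon (r *\<^sub>R z) xs = of_real (r ^ n) * mon z xs"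
proof (induction xs arbitrary: n)
  case (Cons i xs)
  then obtain m where "n = Suc m" "xs \<in> words m" by (cases n) (auto simp: words_def)
  with Cons.IH show ?case by (simp add: mon_def) (simp add: scaleR_conv_of_real)
qed (simp add: mon_def words_def)

lemma continuous_on_mon: "continuous_on S (\<lambda>z. mon z xs)"
  unfolding mon_def by (induction xs) (auto intro!: continuous_intros)

section \<open>Polynomials\<close>

lemma polynomial_several_add:
  fixes p q :: "complex ^ 'd \<Rightarrow> complex"
  assumes "polynomial_several p" "polynomial_several q"
  shows "polynomial_several (\<lambda>z. p z + q z)"
proof -
  obtain I c where 1: "finite I" "p = (\<lambda>z. \<Sum>\<alpha>\<in>I. c \<alpha> * (\<Prod>i\<in>UNIV. (z $ i) ^ \<alpha> i))"
    using assms(1) unfolding polynomial_several_def by blast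
  obtain J e where 2: "finite J" "q = (\<lambda>z. \<Sum>\<alpha>\<in>J. e \<alpha> * (\<Prod>i\<in>UNIV. (z $ i) ^ \<alpha> i))"
    using assms(2) unfolding polynomial_several_def by blast
  obtain d where d: "\<And>\<phi> :: ('d \<Rightarrow> nat) \<Rightarrow> complex. (\<Sum>w\<in>I \<union> J. d w * \<phi> w) =
      (\<Sum>w\<in>I. c w * \<phi> w) + 1 * (\<Sum>w\<in>J. e w * \<phi> w)"
    using finite_comb_add[OF 1(1) 2(1)] by blast
  show ?thesis unfolding polynomial_several_def
    by (intro exI[of _ "I \<union> J"] exI[of _ d]) (simp add: 1 2 d)
qed

lemma polynomial_several_monomial:
  "polynomial_several (\<lambda>z :: complex ^ 'd. k * (\<Prod>i\<in>UNIV. (z $ i) ^ \<alpha> i))"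
  unfolding polynomial_several_def by (intro exI[of _ "{\<alpha>}"] exI[of _ "\<lambda>_. k"]) simp

lemma polynomial_several_const: "polynomial_several (\<lambda>z :: complex ^ 'd. k)"
  using polynomial_several_monomial[of k "\<lambda>_. 0"] by simp

lemma polynomial_several_coord: "polynomial_several (\<lambda>z :: complex ^ 'd. z $ j)"
proof -
  have "(\<Prod>i\<in>UNIV. (z $ i) ^ (if i = j then 1 else 0)) = z $ j" for z :: "complex ^ 'd"
    by (subst prod.cong[OF refl, of _ _ "\<lambda>i. if i = j then z $ i else 1"]) (auto simp: prod.delta)
  then show ?thesis using polynomial_several_monomial[of 1 "\<lambda>i. if i = j then 1 else 0"] by simp
qed

lemma polynomial_several_sum:
  "finite I \<Longrightarrow> (\<And>i. i \<in> I \<Longrightarrow> polynomial_several (p i)) \<Longrightarrow> polynomial_several (\<lambda>z. \<Sum>i\<in>I. p i z)"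
  by (induction I rule: finite_induct) (auto intro: polynomial_several_const polynomial_several_add)

lemma polynomial_several_mult:
  fixes p q :: "complex ^ 'd \<Rightarrow> complex"
  assumes "polynomial_several p" "polynomial_several q"
  shows "polynomial_several (\<lambda>z. p z * q z)"
proof -
  obtain I c where 1: "finite I" "p = (\<lambda>z. \<Sum>\<alpha>\<in>I. c \<alpha> * (\<Prod>i\<in>UNIV. (z $ i) ^ \<alpha> i))"
    using assms(1) unfolding polynomial_several_def by blast
  obtain J e where 2: "finite J" "q = (\<lambda>z. \<Sum>\<alpha>\<in>J. e \<alpha> * (\<Prod>i\<in>UNIV. (z $ i) ^ \<alpha> i))"
    using assms(2) unfolding polynomial_several_def by blast
  have "(\<lambda>z. p z * q z) = (\<lambda>z. \<Sum>\<alpha>\<in>I. \<Sum>\<beta>\<in>J. (c \<alpha> * e \<beta>) * (\<Prod>i\<in>UNIV. (z $ i) ^ (\<alpha> i + \<beta> i)))"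
    unfolding 1 2 sum_product by (simp add: power_add prod.distrib mult_ac)
  moreover have "polynomial_several \<dots>"
    using 1(1) 2(1) by (intro polynomial_several_sum polynomial_several_monomial)
  ultimately show ?thesis by simp
qed

lemma polynomial_several_power:
  "polynomial_several p \<Longrightarrow> polynomial_several (\<lambda>z. p z ^ n)"
  by (induction n) (auto intro: polynomial_several_const polynomial_several_mult)

lemma polynomial_several_mon: "polynomial_several (\<lambda>z. mon z xs)"
  by (induction xs)
    (auto simp: mon_def intro: polynomial_several_const polynomial_several_mult polynomial_several_coord)

lemma continuous_on_polynomial_several: "polynomial_several p \<Longrightarrow> continuous_on S p"
  unfolding polynomial_several_def by (elim exE conjE, simp only:) (intro continuous_intros)

section \<open>Multiplication bounds for a kernel\<close>

definition kernel_form :: "('a \<Rightarrow> 'a \<Rightarrow> complex) \<Rightarrow> 'a set \<Rightarrow> ('a \<Rightarrow> complex) \<Rightarrow> ('a \<Rightarrow> complex) \<Rightarrow> complex"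
  where "kernel_form K F c d = (\<Sum>z\<in>F. \<Sum>w\<in>F. c z * cnj (d w) * K z w)"

abbreviation kernel_sq :: "('a \<Rightarrow> 'a \<Rightarrow> complex) \<Rightarrow> 'a set \<Rightarrow> ('a \<Rightarrow> complex) \<Rightarrow> real"
  where "kernel_sq K F c \<equiv> Re (kernel_form K F c c)"

text \<open>\<open>mult_bound K B C \<phi>\<close> says that \<open>(C\<^sup>2 - \<phi>(z) cnj (\<phi>(w))) K(z,w)\<close> is positive
  semi-definite on \<open>B\<close>.\<close>

definition mult_bound :: "('a \<Rightarrow> 'a \<Rightarrow> complex) \<Rightarrow> 'a set \<Rightarrow> real \<Rightarrow> ('a \<Rightarrow> complex) \<Rightarrow> bool"
  where "mult_bound K B C \<phi> \<longleftrightarrow> (\<forall>F c. finite F \<longrightarrow> F \<subseteq> B \<longrightarrow>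
    kernel_sq K F (\<lambda>z. c z * \<phi> z) \<le> C\<^sup>2 * kernel_sq K F c)"

text \<open>Instantiated for the reproducing kernel \<open>K\<close> and again for
  \<open>1 - 1 / K\<close>.\<close>

locale psd_kernel =
  fixes K :: "'a \<Rightarrow> 'a \<Rightarrow> complex" and B :: "'a set"
  assumes hermitian: "z \<in> B \<Longrightarrow> w \<in> B \<Longrightarrow> K w z = cnj (K z w)"
    and psd: "finite F \<Longrightarrow> F \<subseteq> B \<Longrightarrow> 0 \<le> kernel_sq K F c"
begin

lemma kernel_form_cnj: "F \<subseteq> B \<Longrightarrow> kernel_form K F d c = cnj (kernel_form K F c d)"
proof -
  assume F: "F \<subseteq> B"
  have "cnj (kernel_form K F c d) = (\<Sum>w\<in>F. \<Sum>z\<in>F. cnj (c z) * d w * cnj (K z w))"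
    unfolding kernel_form_def cnj_sum by (subst sum.swap) simp
  also have "\<dots> = kernel_form K F d c"
    unfolding kernel_form_def using F
    by (intro sum.cong refl) (simp only: hermitian[symmetric] subset_iff mult.commute[of "d _"])
  finally show ?thesis by simp
qed

lemma kernel_form_add_left:
  "kernel_form K F (\<lambda>z. c z + t * d z) e = kernel_form K F c e + t * kernel_form K F d e"
  by (simp add: kernel_form_def sum.distrib sum_distrib_left algebra_simps)

lemma kernel_sq_add: assumes "F \<subseteq> B"
  shows "kernel_sq K F (\<lambda>z. c z + of_real t * d z) =
    kernel_sq K F c + 2 * t * Re (kernel_form K F c d) + t\<^sup>2 * kernel_sq K F d"
proof -
  let ?e = "\<lambda>z. c z + of_real t * d z"
  have "kernel_form K F ?e ?e = kernel_form K F c ?e + of_real t * kernel_form K F d ?e"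
    by (rule kernel_form_add_left)
  moreover have "kernel_form K F c ?e = cnj (kernel_form K F c c + of_real t * kernel_form K F d c)"
    using kernel_form_cnj[OF assms, of c ?e] kernel_form_add_left[of F c "of_real t" d c] by simp
  moreover have "kernel_form K F d ?e = cnj (kernel_form K F c d + of_real t * kernel_form K F d d)"
    using kernel_form_cnj[OF assms, of d ?e] kernel_form_add_left[of F c "of_real t" d d] by simp
  moreover have "kernel_form K F d c = cnj (kernel_form K F c d)" by (rule kernel_form_cnj[OF assms])
  ultimately show ?thesis by (simp add: power2_eq_square algebra_simps)
qed

lemma mult_boundD: "mult_bound K B C \<phi> \<Longrightarrow> finite F \<Longrightarrow> F \<subseteq> B \<Longrightarrow>
    kernel_sq K F (\<lambda>z. c z * \<phi> z) \<le> C\<^sup>2 * kernel_sq K F c"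
  by (simp add: mult_bound_def)

lemma kernel_sq_cong: "(\<And>z. z \<in> F \<Longrightarrow> c z = d z) \<Longrightarrow> kernel_sq K F c = kernel_sq K F d"
  unfolding kernel_form_def by (intro arg_cong[of _ _ Re] sum.cong refl) simp

lemma mult_bound_cong:
  assumes "mult_bound K B C \<phi>" "\<And>z. z \<in> B \<Longrightarrow> \<phi> z = \<psi> z" shows "mult_bound K B C \<psi>"
  unfolding mult_bound_def
proof (intro allI impI)
  fix F c assume F: "finite F" "F \<subseteq> B"
  have "kernel_sq K F (\<lambda>z. c z * \<psi> z) = kernel_sq K F (\<lambda>z. c z * \<phi> z)"
    using F(2) assms(2) by (intro kernel_sq_cong) auto
  then show "kernel_sq K F (\<lambda>z. c z * \<psi> z) \<le> C\<^sup>2 * kernel_sq K F c"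
    using mult_boundD[OF assms(1) F] by simp
qed

lemma mult_bound_mono: assumes "mult_bound K B C \<phi>" "0 \<le> C" "C \<le> C'" shows "mult_bound K B C' \<phi>"
  unfolding mult_bound_def
proof (intro allI impI)
  fix F c assume F: "finite F" "F \<subseteq> B"
  have "kernel_sq K F (\<lambda>z. c z * \<phi> z) \<le> C\<^sup>2 * kernel_sq K F c" by (rule mult_boundD[OF assms(1) F])
  also have "\<dots> \<le> C'\<^sup>2 * kernel_sq K F c"
    using assms psd[OF F] by (intro mult_right_mono power_mono)
  finally show "kernel_sq K F (\<lambda>z. c z * \<phi> z) \<le> C'\<^sup>2 * kernel_sq K F c" .
qed

lemma mult_bound_const: "mult_bound K B (cmod k) (\<lambda>_. k)"
  unfolding mult_bound_def
proof (intro allI impI)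
  fix F c
  have "kernel_form K F (\<lambda>z. c z * k) (\<lambda>z. c z * k) = k * cnj k * kernel_form K F c c"
    unfolding kernel_form_def sum_distrib_left by (intro sum.cong refl) simp
  then have "kernel_sq K F (\<lambda>z. c z * k) = (cmod k)\<^sup>2 * kernel_sq K F c"
    unfolding complex_norm_square[symmetric] by simp
  then show "kernel_sq K F (\<lambda>z. c z * k) \<le> (cmod k)\<^sup>2 * kernel_sq K F c" by simp
qed

lemma mult_bound_mult:
  assumes "mult_bound K B C \<phi>" "mult_bound K B C' \<psi>" shows "mult_bound K B (C * C') (\<lambda>z. \<phi> z * \<psi> z)"
  unfolding mult_bound_def
proof (intro allI impI)
  fix F c assume F: "finite F" "F \<subseteq> B"
  have "kernel_sq K F (\<lambda>z. c z * (\<phi> z * \<psi> z)) \<le> C'\<^sup>2 * kernel_sq K F (\<lambda>z. c z * \<phi> z)"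
    using mult_boundD[OF assms(2) F, of "\<lambda>z. c z * \<phi> z"] by (simp add: mult.assoc)
  also have "\<dots> \<le> C'\<^sup>2 * (C\<^sup>2 * kernel_sq K F c)"
    by (intro mult_left_mono mult_boundD[OF assms(1) F]) simp
  finally show "kernel_sq K F (\<lambda>z. c z * (\<phi> z * \<psi> z)) \<le> (C * C')\<^sup>2 * kernel_sq K F c"
    by (simp add: power_mult_distrib mult_ac)
qed

lemma mult_bound_power: "mult_bound K B C \<phi> \<Longrightarrow> mult_bound K B (C ^ n) (\<lambda>z. \<phi> z ^ n)"
proof (induction n)
  case 0 show ?case using mult_bound_const[of 1] by simp
qed (auto intro: mult_bound_mult)

lemma mult_bound_add:
  assumes \<phi>: "mult_bound K B C \<phi>" and \<psi>: "mult_bound K B C' \<psi>" and C: "0 < C" "0 < C'"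
  shows "mult_bound K B (C + C') (\<lambda>z. \<phi> z + \<psi> z)"
  unfolding mult_bound_def
proof (intro allI impI)
  fix F c assume F: "finite F" "F \<subseteq> B"
  let ?u = "\<lambda>z. c z * \<phi> z" and ?v = "\<lambda>z. c z * \<psi> z"
  define R where "R = Re (kernel_form K F ?u ?v)"
  define N where "N = kernel_sq K F c"
  \<comment> \<open>The weight that equalises the two terms in the weighted arithmetic-geometric
    bound for the cross term \<open>R\<close>.\<close>
  define s where "s = C / C'"
  have s: "0 < s" using C by (simp add: s_def)
  have "0 \<le> kernel_sq K F (\<lambda>z. ?u z + of_real (- s) * ?v z)" by (rule psd[OF F])
  then have "2 * s * R \<le> kernel_sq K F ?u + s\<^sup>2 * kernel_sq K F ?v"
    unfolding kernel_sq_add[OF F(2)] R_def by simp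
  also have "\<dots> \<le> C\<^sup>2 * N + s\<^sup>2 * (C'\<^sup>2 * N)"
    unfolding N_def by (intro add_mono mult_left_mono mult_boundD[OF \<phi> F] mult_boundD[OF \<psi> F]) simp
  also have "\<dots> = 2 * s * (C * C' * N)" using C by (simp add: s_def field_simps power2_eq_square)
  finally have R: "R \<le> C * C' * N" using s by simp
  have "kernel_sq K F (\<lambda>z. c z * (\<phi> z + \<psi> z)) = kernel_sq K F ?u + 2 * R + kernel_sq K F ?v"
    using kernel_sq_add[OF F(2), of ?u 1 ?v] by (simp add: R_def distrib_left)
  also have "\<dots> \<le> C\<^sup>2 * N + 2 * (C * C' * N) + C'\<^sup>2 * N"
    unfolding N_def using R mult_boundD[OF \<phi> F] mult_boundD[OF \<psi> F]
    by (intro add_mono) (auto simp: N_def)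
  finally show "kernel_sq K F (\<lambda>z. c z * (\<phi> z + \<psi> z)) \<le> (C + C')\<^sup>2 * kernel_sq K F c"
    by (simp add: N_def power2_eq_square algebra_simps)
qed

text \<open>Each inequality involves finitely many points, so pointwise convergence on
  \<open>B\<close> is enough.\<close>

lemma mult_bound_limit:
  assumes "\<And>n. mult_bound K B C (\<phi> n)" "\<And>z. z \<in> B \<Longrightarrow> (\<lambda>n. \<phi> n z) \<longlonglongrightarrow> \<psi> z"
  shows "mult_bound K B C \<psi>"
  unfolding mult_bound_def
proof (intro allI impI)
  fix F c assume F: "finite F" "F \<subseteq> B"
  have "(\<lambda>n. kernel_sq K F (\<lambda>z. c z * \<phi> n z)) \<longlonglongrightarrow> kernel_sq K F (\<lambda>z. c z * \<psi> z)"
    unfolding kernel_form_def using F(2) by (intro tendsto_intros assms(2)) auto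
  then show "kernel_sq K F (\<lambda>z. c z * \<psi> z) \<le> C\<^sup>2 * kernel_sq K F c"
    by (rule LIMSEQ_le_const2) (use mult_boundD[OF assms(1) F] in blast)
qed

lemma mult_bound_eval:
  assumes "mult_bound K B C \<phi>" "0 \<le> C" "z \<in> B" "0 < Re (K z z)"
  shows "cmod (\<phi> z) \<le> C"
proof -
  have "Re (\<phi> z * cnj (\<phi> z) * K z z) \<le> C\<^sup>2 * Re (K z z)"
    using mult_boundD[OF assms(1), of "{z}" "\<lambda>_. 1"] assms(3) by (simp add: kernel_form_def)
  also have "\<phi> z * cnj (\<phi> z) * K z z = of_real ((cmod (\<phi> z))\<^sup>2) * K z z"
    by (simp only: complex_norm_square)
  finally have "(cmod (\<phi> z))\<^sup>2 \<le> C\<^sup>2" using assms(4) by simp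
  then show ?thesis using assms(2) by (rule power2_le_imp_le)
qed

end

section \<open>The kernel on the ball\<close>

locale ball_kernel =
  fixes a :: "nat \<Rightarrow> real" and B :: "(complex ^ 'd) set"
  assumes B_eq: "B = ball 0 1"
    and a_pos: "a n > 0"
    and a_0: "a 0 = 1"
    and a_ratio: "(\<lambda>n. a n / a (Suc n)) \<longlonglongrightarrow> 1"
begin

abbreviation K :: "complex ^ 'd \<Rightarrow> complex ^ 'd \<Rightarrow> complex" where "K \<equiv> ui_kernel a"

text \<open>The ratio condition makes \<open>a m * \<theta> ^ m\<close> eventually increasing; the
  constant absorbs the finitely many indices before that. Taking \<open>\<theta>\<close> close to 1
  gives subexponential control of the loss in a shift of degree by \<open>n\<close>.\<close>

lemma a_growth:
  assumes \<theta>: "1 < \<theta>"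
  obtains C where "0 < C" "\<And>m n. a m \<le> C * \<theta> ^ n * a (m + n)"
proof -
  have "\<forall>\<^sub>F n in sequentially. a n / a (Suc n) < \<theta>" using order_tendstoD(2)[OF a_ratio \<theta>] .
  then obtain M where M: "\<And>n. M \<le> n \<Longrightarrow> a n / a (Suc n) < \<theta>" by (auto simp: eventually_sequentially)
  define b where "b m = a m * \<theta> ^ m" for m
  have bpos: "0 < b m" for m using a_pos \<theta> by (simp add: b_def)
  have bSuc: "b m \<le> b (Suc m)" if "M \<le> m" for m
  proof -
    have "a m \<le> \<theta> * a (Suc m)" using M[OF that] a_pos[of "Suc m"] by (simp add: field_simps)
    then show ?thesis using \<theta> by (simp add: b_def mult_ac)
  qed
  have bmono: "b m \<le> b (m + n)" if "M \<le> m" for m n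
    by (induction n) (use that bSuc in \<open>auto intro: order_trans\<close>)
  define P where "P = Max (b ` {..M})"
  define p where "p = Min (b ` {..M})"
  have P: "b m \<le> P" if "m \<le> M" for m unfolding P_def using that by (intro Max_ge) auto
  have p: "p \<le> b m" if "m \<le> M" for m unfolding p_def using that by (intro Min_le) auto
  have p0: "0 < p" unfolding p_def using bpos by (subst Min_gr_iff) auto
  have pP: "p \<le> P" using p[of 0] P[of 0] by simp
  have key: "b m \<le> P / p * b (m + n)" for m n
  proof (cases "M \<le> m")
    case True
    have "b m \<le> 1 * b (m + n)" using bmono[OF True] by simp
    also have "\<dots> \<le> P / p * b (m + n)" using pP p0 bpos by (intro mult_right_mono) (auto simp: less_imp_le)
    finally show ?thesis .
  next
    case False
    have "p \<le> b (m + n)"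
      using p[of "m + n"] p[of M] bmono[of M "m + n - M"] by (cases "m + n \<le> M") auto
    then have "P / p * p \<le> P / p * b (m + n)" using pP p0 by (intro mult_left_mono) auto
    then show ?thesis using P[of m] False p0 by simp
  qed
  show ?thesis
  proof
    show "0 < P / p" using p0 pP by simp
    show "a m \<le> P / p * \<theta> ^ n * a (m + n)" for m n
    proof -
      have "a m * \<theta> ^ m \<le> (P / p * \<theta> ^ n * a (m + n)) * \<theta> ^ m"
        using key[of m n] by (simp add: b_def power_add mult_ac)
      then show ?thesis using \<theta> by (meson mult_right_le_imp_le zero_less_power less_trans zero_less_one)
    qed
  qed
qed

lemma a_ratio': "(\<lambda>n. a (Suc n) / a n) \<longlonglongrightarrow> 1"
  using tendsto_inverse[OF a_ratio] by simp

lemma summable_a: assumes "0 \<le> x" "x < 1" shows "summable (\<lambda>n. a n * x ^ n)"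
proof -
  define \<theta> where "\<theta> = 2 / (1 + x)"
  have t: "1 < \<theta>" "\<theta> * x < 1" using assms by (auto simp: \<theta>_def field_simps)
  have "\<forall>\<^sub>F n in sequentially. a (Suc n) / a n < \<theta>" using order_tendstoD(2)[OF a_ratio' t(1)] .
  then obtain N where N: "\<And>n. N \<le> n \<Longrightarrow> a (Suc n) / a n < \<theta>" by (auto simp: eventually_sequentially)
  show ?thesis
  proof (rule summable_ratio_test[OF t(2)])
    fix n assume n: "N \<le> n"
    have "a (Suc n) \<le> \<theta> * a n" using N[OF n] a_pos[of n] by (simp add: field_simps)
    then have "a (Suc n) * x ^ Suc n \<le> \<theta> * a n * x ^ Suc n" using assms by (intro mult_right_mono) auto
    then show "norm (a (Suc n) * x ^ Suc n) \<le> \<theta> * x * norm (a n * x ^ n)"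
      using assms a_pos by (simp add: abs_mult less_imp_le mult_ac)
  qed
qed

text \<open>The kernel on the diagonal as a function of the squared norm; as the coefficients are
  positive, it also dominates the modulus of \<open>K\<close>.\<close>

definition kval :: "real \<Rightarrow> real" where "kval x = (\<Sum>n. a n * x ^ n)"

lemma kval_ge_1: "0 \<le> x \<Longrightarrow> x < 1 \<Longrightarrow> 1 \<le> kval x"
  using sum_le_suminf[OF summable_a, of x "{0}"] a_pos by (simp add: kval_def a_0 less_imp_le)

lemma summable_K_norm:
  assumes "\<And>n. cmod (x n) \<le> \<rho> ^ n" "0 \<le> \<rho>" "\<rho> < 1"
  shows "summable (\<lambda>n. cmod (of_real (a n) * x n))" "cmod (\<Sum>n. of_real (a n) * x n) \<le> kval \<rho>"
proof -
  have le: "cmod (of_real (a n) * x n) \<le> a n * \<rho> ^ n" for n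
    using assms(1)[of n] a_pos[of n] by (simp add: norm_mult less_imp_le mult_left_mono)
  show s: "summable (\<lambda>n. cmod (of_real (a n) * x n))"
    by (rule summable_comparison_test'[OF summable_a[OF assms(2,3)], of 0]) (use le in simp)
  show "cmod (\<Sum>n. of_real (a n) * x n) \<le> kval \<rho>"
    unfolding kval_def by (rule order_trans[OF summable_norm[OF s] suminf_le[OF le s summable_a[OF assms(2,3)]]])
qed

lemma K_sums:
  assumes "cmod (hermitian_inner z w) < 1"
  shows "(\<lambda>n. of_real (a n) * hermitian_inner z w ^ n) sums K z w"
  unfolding ui_kernel_def
  by (intro summable_sums summable_norm_cancel[OF summable_K_norm(1)[of _ "cmod (hermitian_inner z w)"]])
     (use assms in \<open>auto simp: norm_power\<close>)

lemma cmod_K_le: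
  assumes "cmod (hermitian_inner z w) \<le> \<rho>" "\<rho> < 1"
  shows "cmod (K z w) \<le> kval \<rho>"
  unfolding ui_kernel_def using assms norm_ge_zero[of "hermitian_inner z w"]
  by (intro summable_K_norm(2)) (auto simp: norm_power intro: power_mono order_trans[OF norm_ge_zero])

lemma inner_lt_1: "z \<in> B \<Longrightarrow> w \<in> B \<Longrightarrow> cmod (hermitian_inner z w) < 1"
  using cmod_hermitian_inner_le[of z w] mult_strict_mono'[of "norm z" 1 "norm w" 1]
  by (auto simp: B_eq intro: le_less_trans)

lemma K_hermitian: assumes "cmod (hermitian_inner z w) < 1" shows "K w z = cnj (K z w)"
proof -
  have "(\<lambda>n. cnj (of_real (a n) * hermitian_inner z w ^ n)) sums cnj (K z w)"
    using K_sums[OF assms] by (simp only: sums_cnj)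
  moreover have "(\<lambda>n. of_real (a n) * hermitian_inner w z ^ n) sums K w z"
    using assms hermitian_inner_cnj[of w z] by (intro K_sums) simp
  ultimately show ?thesis using hermitian_inner_cnj[of w z] sums_unique2 by fastforce
qed

text \<open>On words of length \<open>n\<close>: the sum of c(z) times the \<open>n\<close>-th
  tensor power of \<open>z\<close>. The kernel form is the sum over \<open>n\<close> of
  \<open>a n\<close> times the inner products of these vectors.\<close>

definition comb :: "(complex ^ 'd) set \<Rightarrow> (complex ^ 'd \<Rightarrow> complex) \<Rightarrow> 'd list \<Rightarrow> complex"
  where "comb F c xs = (\<Sum>z\<in>F. c z * mon z xs)"

lemma word_inner_comb:
  "word_inner n (comb F c) (comb F d) = (\<Sum>z\<in>F. \<Sum>w\<in>F. c z * cnj (d w) * hermitian_inner z w ^ n)"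
proof -
  have "word_inner n (comb F c) (comb F d) =
      (\<Sum>xs\<in>words n. \<Sum>z\<in>F. \<Sum>w\<in>F. c z * cnj (d w) * (mon z xs * cnj (mon w xs)))"
    unfolding word_inner_def comb_def cnj_sum sum_product by (simp add: mult_ac)
  also have "\<dots> = (\<Sum>z\<in>F. \<Sum>w\<in>F. \<Sum>xs\<in>words n. c z * cnj (d w) * (mon z xs * cnj (mon w xs)))"
    by (subst sum.swap) (intro sum.cong refl sum.swap)
  finally show ?thesis by (simp add: hermitian_inner_power word_inner_def sum_distrib_left)
qed

lemma kernel_form_sums:
  assumes "finite F" "F \<subseteq> B"
  shows "(\<lambda>n. of_real (a n) * word_inner n (comb F c) (comb F d)) sums kernel_form K F c d"
proof -
  have "(\<lambda>n. \<Sum>z\<in>F. \<Sum>w\<in>F. c z * cnj (d w) * (of_real (a n) * hermitian_inner z w ^ n)) sums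
      kernel_form K F c d"
    unfolding kernel_form_def using assms by (intro sums_sum sums_mult K_sums inner_lt_1) auto
  then show ?thesis by (simp add: word_inner_comb sum_distrib_left mult_ac)
qed

lemma kernel_sq_sums:
  assumes "finite F" "F \<subseteq> B"
  shows "(\<lambda>n. a n * word_sq n (comb F c)) sums kernel_sq K F c"
  using sums_Re[OF kernel_form_sums[OF assms, of c c]] by (simp add: word_inner_self)

sublocale psd_kernel K B
proof
  show "K w z = cnj (K z w)" if "z \<in> B" "w \<in> B" for z w using K_hermitian inner_lt_1 that by blast
  show "0 \<le> kernel_sq K F c" if "finite F" "F \<subseteq> B" for F c
    by (rule sums_le[OF _ sums_zero kernel_sq_sums[OF that]])
       (use a_pos word_sq_nonneg in \<open>auto intro!: mult_nonneg_nonneg simp: less_imp_le\<close>)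
qed

lemma K_self: assumes "z \<in> B" shows "1 \<le> Re (K z z)" "Im (K z z) = 0"
proof -
  have n: "0 \<le> (norm z)\<^sup>2" "(norm z)\<^sup>2 < 1" using assms by (auto simp: B_eq power_less_one_iff abs_square_less_1)
  have "K z z = of_real (kval ((norm z)\<^sup>2))"
    unfolding ui_kernel_def kval_def hermitian_inner_self
    unfolding suminf_of_real[OF summable_a[OF n]] by simp
  then show "1 \<le> Re (K z z)" "Im (K z z) = 0" using kval_ge_1[OF n] by auto
qed

text \<open>The Cauchy--Schwarz inequality over the prefix \<open>ys\<close> of the word \<open>ys @ xs\<close>.\<close>

lemma word_sq_comb_mult:
  assumes y: "word_sq n y \<le> 1"
  shows "word_sq m (comb F (\<lambda>z. c z * word_inner n (mon z) y)) \<le> word_sq (n + m) (comb F c)"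
proof -
  have "word_sq m (comb F (\<lambda>z. c z * word_inner n (mon z) y)) \<le>
      (\<Sum>xs\<in>words m. \<Sum>ys\<in>words n. (cmod (comb F c (ys @ xs)))\<^sup>2)"
    unfolding word_sq_def
  proof (rule sum_mono)
    fix xs :: "'d list"
    let ?g = "\<lambda>ys. comb F c (ys @ xs)"
    have "comb F (\<lambda>z. c z * word_inner n (mon z) y) xs = word_inner n ?g y"
      unfolding comb_def word_inner_def sum_distrib_left sum_distrib_right mon_append
      by (subst sum.swap) (simp add: mult_ac)
    then have "cmod (comb F (\<lambda>z. c z * word_inner n (mon z) y) xs) \<le> sqrt (word_sq n ?g) * sqrt (word_sq n y)"
      using cmod_word_inner_le by metis
    also have "\<dots> \<le> sqrt (word_sq n ?g) * 1" using y word_sq_nonneg by (intro mult_left_mono) auto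
    finally have "cmod (comb F (\<lambda>z. c z * word_inner n (mon z) y) xs) \<le> sqrt (word_sq n ?g)" by simp
    then have "(cmod (comb F (\<lambda>z. c z * word_inner n (mon z) y) xs))\<^sup>2 \<le> (sqrt (word_sq n ?g))\<^sup>2"
      by (intro power_mono) auto
    then show "(cmod (comb F (\<lambda>z. c z * word_inner n (mon z) y) xs))\<^sup>2 \<le> (\<Sum>ys\<in>words n. (cmod (?g ys))\<^sup>2)"
      by (simp add: word_sq_nonneg) (simp add: word_sq_def)
  qed
  also have "\<dots> = word_sq (n + m) (comb F c)"
    unfolding word_sq_def sum_words_append by (rule sum.swap)
  finally show ?thesis .
qed

text \<open>Multiplication by a form of degree \<open>n\<close> contracts degree
  \<open>n + m\<close> into degree \<open>m\<close> at no cost, by \<open>word_sq_comb_mult\<close>.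
  Only the weights change, from \<open>a (m + n)\<close> to \<open>a m\<close>, and \<open>C\<close>
  pays for that.\<close>

lemma mult_bound_homogeneous:
  assumes y: "word_sq n y \<le> 1" and C: "0 \<le> C" "\<And>m. a m \<le> C * a (m + n)"
  shows "mult_bound K B (sqrt C) (\<lambda>z. word_inner n (mon z) y)"
  unfolding mult_bound_def
proof (intro allI impI)
  fix F :: "(complex ^ 'd) set" and c assume F: "finite F" "F \<subseteq> B"
  let ?e = "\<lambda>z. c z * word_inner n (mon z) y"
  note S = kernel_sq_sums[OF F, of c]
  have tail: "(\<lambda>m. a (m + n) * word_sq (m + n) (comb F c)) sums
      (kernel_sq K F c - (\<Sum>i<n. a i * word_sq i (comb F c)))"
    using sums_iff_shift[of "\<lambda>i. a i * word_sq i (comb F c)" n] S by simp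
  have "kernel_sq K F ?e \<le> C * (kernel_sq K F c - (\<Sum>i<n. a i * word_sq i (comb F c)))"
  proof (rule sums_le[OF _ kernel_sq_sums[OF F] sums_mult[OF tail]])
    fix m
    have "a m * word_sq m (comb F ?e) \<le> a m * word_sq (m + n) (comb F c)"
      using word_sq_comb_mult[OF y, of m F c] a_pos[of m] by (simp add: add.commute)
    also have "\<dots> \<le> C * a (m + n) * word_sq (m + n) (comb F c)"
      by (intro mult_right_mono C word_sq_nonneg)
    finally show "a m * word_sq m (comb F ?e) \<le> C * (a (m + n) * word_sq (m + n) (comb F c))"
      by (simp add: mult.assoc)
  qed
  also have "\<dots> \<le> C * kernel_sq K F c"
    using C(1) a_pos word_sq_nonneg by (intro mult_left_mono) (auto intro!: sum_nonneg mult_nonneg_nonneg simp: less_imp_le)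
  finally show "kernel_sq K F ?e \<le> (sqrt C)\<^sup>2 * kernel_sq K F c" using C(1) by simp
qed

text \<open>\<open>mult_bound_add\<close> asks for positive constants, so the induction starts from
  \<open>\<epsilon>\<close> instead of 0.\<close>

lemma mult_bound_sum:
  assumes "finite I" "\<And>i. i \<in> I \<Longrightarrow> mult_bound K B (C i) (\<phi> i)" "\<And>i. i \<in> I \<Longrightarrow> 0 < C i" "0 < \<epsilon>"
  shows "mult_bound K B (\<epsilon> + (\<Sum>i\<in>I. C i)) (\<lambda>z. \<Sum>i\<in>I. \<phi> i z)"
  using assms(1-3)
proof (induction I rule: finite_induct)
  case empty
  show ?case using mult_bound_mono[OF mult_bound_const[of 0], of \<epsilon>] assms(4) by simp
next
  case (insert i I)
  have "mult_bound K B (C i + (\<epsilon> + (\<Sum>i\<in>I. C i))) (\<lambda>z. \<phi> i z + (\<Sum>i\<in>I. \<phi> i z))"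
    using insert assms(4) by (intro mult_bound_add add_pos_nonneg sum_nonneg) (auto intro: less_imp_le)
  then show ?case using insert.hyps by (simp add: add_ac)
qed

section \<open>Approximation by polynomials in the multiplier norm\<close>

text \<open>The closure of the polynomials in the multiplier norm, expressed on the kernel side. A
  bound for \<open>\<phi>\<close> is included for use in products.\<close>

definition approximable :: "(complex ^ 'd \<Rightarrow> complex) \<Rightarrow> bool"
  where "approximable \<phi> \<longleftrightarrow> (\<exists>C>0. mult_bound K B C \<phi>) \<and>
    (\<forall>\<epsilon>>0. \<exists>p. polynomial_several p \<and> mult_bound K B \<epsilon> (\<lambda>z. \<phi> z - p z))"

lemma approximable_const: "approximable (\<lambda>_. k)"
  unfolding approximable_def
proof (intro conjI allI impI)
  show "\<exists>C>0. mult_bound K B C (\<lambda>_. k)"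
    by (intro exI[of _ "cmod k + 1"] conjI mult_bound_mono[OF mult_bound_const]) (auto intro: add_nonneg_pos)
  show "\<exists>p. polynomial_several p \<and> mult_bound K B \<epsilon> (\<lambda>z. k - p z)" if "0 < \<epsilon>" for \<epsilon>
    using mult_bound_mono[OF mult_bound_const[of 0], of \<epsilon>] that polynomial_several_const[of k]
    by (intro exI[of _ "\<lambda>_. k"]) simp
qed

lemma approximable_add: assumes "approximable \<phi>" "approximable \<psi>" shows "approximable (\<lambda>z. \<phi> z + \<psi> z)"
  unfolding approximable_def
proof (intro conjI allI impI)
  show "\<exists>C>0. mult_bound K B C (\<lambda>z. \<phi> z + \<psi> z)"
    using assms mult_bound_add add_pos_pos unfolding approximable_def by metis
  fix \<epsilon> :: real assume \<epsilon>: "0 < \<epsilon>"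
  obtain p where p: "polynomial_several p" "mult_bound K B (\<epsilon>/2) (\<lambda>z. \<phi> z - p z)"
    using assms(1) \<epsilon> unfolding approximable_def by (meson half_gt_zero)
  obtain q where q: "polynomial_several q" "mult_bound K B (\<epsilon>/2) (\<lambda>z. \<psi> z - q z)"
    using assms(2) \<epsilon> unfolding approximable_def by (meson half_gt_zero)
  have "mult_bound K B (\<epsilon>/2 + \<epsilon>/2) (\<lambda>z. (\<phi> z - p z) + (\<psi> z - q z))"
    using \<epsilon> by (intro mult_bound_add p q) auto
  then show "\<exists>p. polynomial_several p \<and> mult_bound K B \<epsilon> (\<lambda>z. \<phi> z + \<psi> z - p z)"
    using polynomial_several_add[OF p(1) q(1)] by (intro exI[of _ "\<lambda>z. p z + q z"]) (simp add: algebra_simps)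
qed

lemma approximable_mult: assumes "approximable \<phi>" "approximable \<psi>" shows "approximable (\<lambda>z. \<phi> z * \<psi> z)"
  unfolding approximable_def
proof (intro conjI allI impI)
  obtain C D where C: "0 < C" "mult_bound K B C \<phi>" and D: "0 < D" "mult_bound K B D \<psi>"
    using assms unfolding approximable_def by metis
  show "\<exists>C>0. mult_bound K B C (\<lambda>z. \<phi> z * \<psi> z)" using mult_bound_mult C D by (metis mult_pos_pos)
  fix \<epsilon> :: real assume \<epsilon>: "0 < \<epsilon>"
  \<comment> \<open>The product is approximated by \<open>p z * q z\<close>: the first error is
    multiplied by the bound \<open>D\<close> of \<open>\<psi>\<close>, the second by the bound
    \<open>C + \<delta>\<close> of \<open>p\<close>, whence the two tolerances.\<close>
  define \<delta> where "\<delta> = \<epsilon> / (2 * D)"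
  have \<delta>: "0 < \<delta>" "\<delta> * D = \<epsilon> / 2" using \<epsilon> D by (auto simp: \<delta>_def)
  obtain p where p: "polynomial_several p" "mult_bound K B \<delta> (\<lambda>z. \<phi> z - p z)"
    using assms(1) \<delta> unfolding approximable_def by meson
  define \<eta> where "\<eta> = \<epsilon> / (2 * (C + \<delta>))"
  have \<eta>: "0 < \<eta>" "(C + \<delta>) * \<eta> = \<epsilon> / 2"
    using \<epsilon> C \<delta>(1) by (auto simp: \<eta>_def field_simps)
  obtain q where q: "polynomial_several q" "mult_bound K B \<eta> (\<lambda>z. \<psi> z - q z)"
    using assms(2) \<eta> unfolding approximable_def by meson
  have "mult_bound K B (C + cmod (-1) * \<delta>) (\<lambda>z. \<phi> z + (-1) * (\<phi> z - p z))"
    using C \<delta> by (intro mult_bound_add mult_bound_mult mult_bound_const p) auto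
  then have "mult_bound K B (C + \<delta>) p" by simp
  then have "mult_bound K B (\<delta> * D + (C + \<delta>) * \<eta>) (\<lambda>z. (\<phi> z - p z) * \<psi> z + p z * (\<psi> z - q z))"
    using C D \<delta> \<eta> by (intro mult_bound_add mult_bound_mult p q) auto
  then show "\<exists>p. polynomial_several p \<and> mult_bound K B \<epsilon> (\<lambda>z. \<phi> z * \<psi> z - p z)"
    unfolding \<delta> \<eta> using polynomial_several_mult[OF p(1) q(1)]
    by (intro exI[of _ "\<lambda>z. p z * q z"]) (simp add: algebra_simps)
qed

lemma approximable_power: "approximable \<phi> \<Longrightarrow> approximable (\<lambda>z. \<phi> z ^ n)"
  by (induction n) (auto intro: approximable_const approximable_mult)

lemma approximable_sum:
  "finite I \<Longrightarrow> (\<And>i. i \<in> I \<Longrightarrow> approximable (\<phi> i)) \<Longrightarrow> approximable (\<lambda>z. \<Sum>i\<in>I. \<phi> i z)"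
  by (induction I rule: finite_induct) (auto intro: approximable_const approximable_add)

lemma approximable_limit:
  assumes "\<And>\<epsilon>. 0 < \<epsilon> \<Longrightarrow> \<exists>\<psi>. approximable \<psi> \<and> mult_bound K B \<epsilon> (\<lambda>z. \<phi> z - \<psi> z)"
  shows "approximable \<phi>"
  unfolding approximable_def
proof (intro conjI allI impI)
  obtain \<psi> where "approximable \<psi>" and 1: "mult_bound K B 1 (\<lambda>z. \<phi> z - \<psi> z)" using assms[of 1] by auto
  then obtain C where C: "0 < C" "mult_bound K B C \<psi>" unfolding approximable_def by auto
  have "mult_bound K B (1 + C) (\<lambda>z. (\<phi> z - \<psi> z) + \<psi> z)" using C 1 by (intro mult_bound_add) auto
  then show "\<exists>C>0. mult_bound K B C \<phi>" using C by (intro exI[of _ "1 + C"]) auto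
  fix \<epsilon> :: real assume \<epsilon>: "0 < \<epsilon>"
  obtain \<psi> where "approximable \<psi>" and 2: "mult_bound K B (\<epsilon>/2) (\<lambda>z. \<phi> z - \<psi> z)" using assms[of "\<epsilon>/2"] \<epsilon> by auto
  then obtain p where p: "polynomial_several p" "mult_bound K B (\<epsilon>/2) (\<lambda>z. \<psi> z - p z)"
    using \<epsilon> unfolding approximable_def by (meson half_gt_zero)
  have "mult_bound K B (\<epsilon>/2 + \<epsilon>/2) (\<lambda>z. (\<phi> z - \<psi> z) + (\<psi> z - p z))"
    using \<epsilon> by (intro mult_bound_add 2 p) auto
  then show "\<exists>p. polynomial_several p \<and> mult_bound K B \<epsilon> (\<lambda>z. \<phi> z - p z)" using p by auto
qed

section \<open>Potentials and their reciprocals\<close>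

text \<open>If \<open>y\<close> is the family of moments of a measure \<open>\<mu>\<close> on the sphere, \<open>potential r y\<close> is
  \<open>z \<mapsto> \<integral> K (z, r w) d\<mu>(w)\<close>.\<close>

definition potential :: "real \<Rightarrow> ('d list \<Rightarrow> complex) \<Rightarrow> complex ^ 'd \<Rightarrow> complex"
  where "potential r y z = (\<Sum>n. of_real (a n) * (of_real (r ^ n) * word_inner n (mon z) y))"

lemma potential_sums:
  assumes y: "\<And>n. word_sq n y \<le> 1" and r: "0 \<le> r" "r < 1" and z: "norm z \<le> 1"
  shows "(\<lambda>n. of_real (a n) * (of_real (r ^ n) * word_inner n (mon z) y)) sums potential r y z"
    and "cmod (of_real (r ^ n) * word_inner n (mon z) y) \<le> (r * norm z) ^ n"
    and "cmod (potential r y z) \<le> kval (r * norm z)"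
proof -
  have le: "cmod (of_real (r ^ n) * word_inner n (mon z) y) \<le> (r * norm z) ^ n" for n
  proof -
    have "cmod (word_inner n (mon z) y) \<le> sqrt (word_sq n (mon z)) * sqrt (word_sq n y)"
      by (rule cmod_word_inner_le)
    also have "\<dots> \<le> norm z ^ n * 1"
    proof (rule mult_mono)
      show "sqrt (word_sq n (mon z)) \<le> norm z ^ n"
        by (simp add: word_sq_mon power_mult[of _ n 2] mult.commute[of 2 n])
    qed (use y word_sq_nonneg in auto)
    finally show ?thesis using r by (simp add: norm_mult norm_power power_mult_distrib mult_left_mono)
  qed
  have rz: "0 \<le> r * norm z" "r * norm z < 1"
    using r z mult_left_mono[of "norm z" 1 r] by auto
  show "cmod (of_real (r ^ n) * word_inner n (mon z) y) \<le> (r * norm z) ^ n" by (rule le)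
  show "(\<lambda>n. of_real (a n) * (of_real (r ^ n) * word_inner n (mon z) y)) sums potential r y z"
    unfolding potential_def
    by (intro summable_sums summable_norm_cancel[OF summable_K_norm(1)[of _ "r * norm z"]] le rz)
  show "cmod (potential r y z) \<le> kval (r * norm z)"
    unfolding potential_def by (intro summable_K_norm(2) le rz)
qed

lemma potential_scaleR:
  "potential r y (s *\<^sub>R z) = potential (r * s) y z"
proof -
  have "word_inner n (mon (s *\<^sub>R z)) y = of_real (s ^ n) * word_inner n (mon z) y" for n
    unfolding word_inner_def sum_distrib_left by (intro sum.cong refl) (simp add: mon_scaleR mult_ac)
  then show ?thesis by (simp add: potential_def power_mult_distrib mult_ac)
qed

text \<open>The term of degree \<open>n\<close> carries \<open>a n * r ^ n\<close> and a multiplier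
  bound \<open>sqrt (C * (1 / r) ^ n)\<close>. Growth at rate \<open>1 / r\<close> thus consumes
  only half of the exponent, and \<open>a n * sqrt r ^ n\<close> is still summable.\<close>

lemma approximable_potential:
  assumes y: "\<And>n. word_sq n y \<le> 1" and r: "0 < r" "r < 1"
  shows "approximable (potential r y)"
proof -
  obtain C where C: "0 < C" "\<And>m n. a m \<le> C * (1 / r) ^ n * a (m + n)"
    using a_growth[of "1 / r"] r by auto
  define g where "g n z = of_real (a n) * (of_real (r ^ n) * word_inner n (mon z) y)" for n z
  define E where "E n = sqrt C * (a n * sqrt r ^ n)" for n
  have E0: "0 < E n" for n using C a_pos r by (simp add: E_def)
  have Es: "summable E" unfolding E_def using r by (intro summable_mult summable_a) auto
  have gE: "mult_bound K B (E n) (g n)" for n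
  proof -
    have "mult_bound K B (cmod (of_real (a n * r ^ n)) * sqrt (C * (1/r) ^ n))
        (\<lambda>z. of_real (a n * r ^ n) * word_inner n (mon z) y)"
      using C(1) r y C(2)
      by (intro mult_bound_mult mult_bound_const mult_bound_homogeneous) (auto simp: less_imp_le)
    also have "cmod (of_real (a n * r ^ n)) * sqrt (C * (1/r) ^ n) = E n"
    proof -
      have "r ^ n * sqrt ((1/r) ^ n) = (r * sqrt (1/r)) ^ n" using r by (simp add: real_sqrt_power power_mult_distrib)
      also have "r * sqrt (1/r) = sqrt r" using r by (simp add: real_sqrt_divide field_simps)
      finally show ?thesis using a_pos[of n] r by (simp add: E_def real_sqrt_mult norm_mult norm_power mult_ac)
    qed
    finally show ?thesis by (simp add: g_def[abs_def] mult.assoc)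
  qed
  show ?thesis
  proof (rule approximable_limit)
    fix \<epsilon> :: real assume \<epsilon>: "0 < \<epsilon>"
    obtain N where N: "\<And>n. N \<le> n \<Longrightarrow> norm (\<Sum>i. E (i + n)) < \<epsilon> / 2"
      using suminf_exist_split[OF _ Es, of "\<epsilon>/2"] \<epsilon> by auto
    have "mult_bound K B \<epsilon> (\<lambda>z. potential r y z - (\<Sum>n<N. g n z))"
    proof (rule mult_bound_limit)
      fix M
      have "mult_bound K B (\<epsilon>/2 + (\<Sum>n<M. E (n + N))) (\<lambda>z. \<Sum>n<M. g (n + N) z)"
        using \<epsilon> by (intro mult_bound_sum gE E0) auto
      moreover have "(\<Sum>n<M. E (n + N)) \<le> (\<Sum>n. E (n + N))"
        using Es E0 by (intro sum_le_suminf) (auto simp: less_imp_le summable_iff_shift)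
      ultimately show "mult_bound K B \<epsilon> (\<lambda>z. \<Sum>n<M. g (n + N) z)"
        using N[of N] \<epsilon> E0 by (elim mult_bound_mono) (auto intro!: add_nonneg_nonneg sum_nonneg less_imp_le[OF E0])
    next
      fix z assume "z \<in> B"
      then have "(\<lambda>n. g n z) sums potential r y z"
        unfolding g_def using y r by (intro potential_sums) (auto simp: B_eq)
      then show "(\<lambda>M. \<Sum>n<M. g (n + N) z) \<longlonglongrightarrow> potential r y z - (\<Sum>n<N. g n z)"
        unfolding sums_def[symmetric] by (subst sums_iff_shift) simp
    qed
    moreover have "approximable (\<lambda>z. \<Sum>n<N. g n z)"
    proof -
      have gp: "polynomial_several (g n)" for n
        unfolding g_def[abs_def] word_inner_def
        by (intro polynomial_several_sum polynomial_several_mult polynomial_several_const polynomial_several_mon) auto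
      have "approximable (g n)" for n
        unfolding approximable_def
      proof (intro conjI allI impI)
        show "\<exists>C>0. mult_bound K B C (g n)" using gE E0 by blast
        show "\<exists>p. polynomial_several p \<and> mult_bound K B \<epsilon> (\<lambda>z. g n z - p z)" if "0 < \<epsilon>" for \<epsilon>
          using mult_bound_mono[OF mult_bound_const[of 0], of \<epsilon>] that
          by (intro exI[of _ "g n"]) (simp add: gp)
      qed
      then show ?thesis by (intro approximable_sum) auto
    qed
    ultimately show "\<exists>\<psi>. approximable \<psi> \<and> mult_bound K B \<epsilon> (\<lambda>z. potential r y z - \<psi> z)" by blast
  qed
qed

text \<open>The hypothesis says that \<open>(h(z) + cnj (h(w)) - 1) K(z,w)\<close> is positive semi-definite.\<close>

context
  fixes h :: "complex ^ 'd \<Rightarrow> complex"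
  assumes h: "\<And>F c. finite F \<Longrightarrow> F \<subseteq> B \<Longrightarrow>
    kernel_sq K F c \<le> 2 * Re (kernel_form K F (\<lambda>z. c z * h z) c)"
begin

lemma Re_ge_half: assumes "z \<in> B" shows "1 / 2 \<le> Re (h z)"
proof -
  have "Re (K z z) \<le> 2 * Re (h z * K z z)"
    using h[of "{z}" "\<lambda>_. 1"] assms by (simp add: kernel_form_def)
  then have "1 * Re (K z z) \<le> (2 * Re (h z)) * Re (K z z)" using K_self[OF assms] by simp
  then show ?thesis using K_self[OF assms] by simp
qed

text \<open>After the substitution \<open>c = d h\<close> the claim compares \<open>h - 1\<close>
  with \<open>h\<close>; the difference of the two squares is exactly what the hypothesis on
  \<open>h\<close> controls.\<close>

lemma mult_bound_one_minus_reciprocal: "mult_bound K B 1 (\<lambda>z. 1 - 1 / h z)"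
  unfolding mult_bound_def
proof (intro allI impI)
  fix F c assume F: "finite F" "F \<subseteq> B"
  define d where "d z = c z / h z" for z
  have nz: "h z \<noteq> 0" if "z \<in> F" for z using Re_ge_half[of z] that F(2) by auto
  have "kernel_sq K F (\<lambda>z. c z * (1 - 1 / h z)) = kernel_sq K F (\<lambda>z. d z * h z + of_real (-1) * d z)"
    using nz by (intro kernel_sq_cong) (auto simp: d_def field_simps)
  also have "\<dots> \<le> kernel_sq K F (\<lambda>z. d z * h z)"
    using h[OF F, of d] by (subst kernel_sq_add[OF F(2)]) simp
  also have "\<dots> = kernel_sq K F c" using nz by (intro kernel_sq_cong) (auto simp: d_def)
  finally show "kernel_sq K F (\<lambda>z. c z * (1 - 1 / h z)) \<le> 1\<^sup>2 * kernel_sq K F c" by simp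
qed

text \<open>\<open>1 - 1 / h\<close> has modulus 1 wherever \<open>Re h = 1 / 2\<close>. Its average
  with 1 is still a contraction, and its modulus is below 1 at every point of the ball.\<close>

lemma mult_bound_contraction: "mult_bound K B 1 (\<lambda>z. 1 - 1 / (2 * h z))"
proof -
  have "mult_bound K B (cmod (1/2) * (1 + 1)) (\<lambda>z. (1/2) * ((1 - 1 / h z) + 1))"
    using mult_bound_const[of 1]
    by (intro mult_bound_mult mult_bound_const mult_bound_add mult_bound_one_minus_reciprocal) auto
  then show ?thesis by (simp add: diff_divide_distrib mult.commute)
qed

text \<open>Neumann series in \<open>g = 1 - h / T\<close>. The hypothesis bounds the real part of
  \<open>h\<close> below as a form, which makes \<open>g\<close> a strict contraction; the remainder
  is \<open>g ^ J / h\<close>, and \<open>1 / h\<close> is a multiplier of norm at most 2.\<close>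

lemma approximable_reciprocal: assumes "approximable h" shows "approximable (\<lambda>z. 1 / h z)"
proof -
  obtain C where C: "0 < C" "mult_bound K B C h" using assms unfolding approximable_def by blast
  \<comment> \<open>Expanding the square of \<open>1 - h / T\<close> gives the bound
    \<open>1 - 1 / T + C^2 / T^2\<close> for its squared norm. It is below 1 once
    \<open>T > C^2\<close>, and \<open>T \<ge> 1\<close> keeps it nonnegative.\<close>
  define T where "T = 2 * C\<^sup>2 + 2"
  have T: "0 < T" "1 \<le> T" unfolding T_def using zero_le_power2[of C] by linarith+
  define \<kappa> where "\<kappa> = sqrt (1 - 1 / T + C\<^sup>2 / T\<^sup>2)"
  have "C\<^sup>2 / T\<^sup>2 < 1 / T" using T zero_le_power2[of C] by (simp add: field_simps power2_eq_square[of T]) (unfold T_def, linarith)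
  moreover have "1 / T \<le> 1" using T by simp
  ultimately have \<kappa>: "0 \<le> \<kappa>" "\<kappa> < 1" "\<kappa>\<^sup>2 = 1 - 1 / T + C\<^sup>2 / T\<^sup>2" by (auto simp: \<kappa>_def)
  define g where "g z = 1 - h z / of_real T" for z
  have nz: "h z \<noteq> 0" if "z \<in> B" for z using Re_ge_half[of z] that by auto
  have gb: "mult_bound K B \<kappa> g"
    unfolding mult_bound_def
  proof (intro allI impI)
    fix F c assume F: "finite F" "F \<subseteq> B"
    let ?N = "kernel_sq K F c" and ?R = "Re (kernel_form K F (\<lambda>z. c z * h z) c)"
    have "kernel_sq K F (\<lambda>z. c z * g z) = kernel_sq K F (\<lambda>z. c z + of_real (- (1 / T)) * (c z * h z))"
      by (intro kernel_sq_cong) (simp add: g_def algebra_simps)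
    also have "\<dots> = ?N - 2 / T * ?R + (1 / T)\<^sup>2 * kernel_sq K F (\<lambda>z. c z * h z)"
      using kernel_form_cnj[OF F(2), of c "\<lambda>z. c z * h z"] by (subst kernel_sq_add[OF F(2)]) simp
    also have "\<dots> \<le> ?N - 1 / T * ?N + (1 / T)\<^sup>2 * (C\<^sup>2 * ?N)"
      using mult_boundD[OF C(2) F, of c] h[OF F, of c] T
      by (intro add_mono diff_mono mult_left_mono) (auto simp: field_simps)
    also have "\<dots> = \<kappa>\<^sup>2 * ?N" by (simp add: \<kappa> algebra_simps power_divide)
    finally show "kernel_sq K F (\<lambda>z. c z * g z) \<le> \<kappa>\<^sup>2 * ?N" .
  qed
  have inv: "mult_bound K B 2 (\<lambda>z. 1 / h z)"
  proof -
    have "mult_bound K B (1 + cmod (-1) * 1) (\<lambda>z. 1 + (-1) * (1 - 1 / h z))"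
      using mult_bound_const[of 1]
      by (intro mult_bound_mult mult_bound_const mult_bound_add mult_bound_one_minus_reciprocal) auto
    then show ?thesis by simp
  qed
  have ga: "approximable g"
  proof -
    have "approximable (\<lambda>z. 1 + (- 1 / of_real T) * h z)"
      by (intro approximable_add approximable_mult approximable_const assms)
    then show ?thesis by (simp add: g_def[abs_def])
  qed
  show ?thesis
  proof (rule approximable_limit)
    fix \<epsilon> :: real assume \<epsilon>: "0 < \<epsilon>"
    have "(\<lambda>J. 2 * \<kappa> ^ J) \<longlonglongrightarrow> 2 * 0" using \<kappa> by (intro tendsto_intros LIMSEQ_realpow_zero) auto
    then obtain J where J: "2 * \<kappa> ^ J < \<epsilon>"
      using \<epsilon> by (metis (mono_tags) eventually_sequentially le_refl mult_zero_right order_tendstoD(2))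
    let ?S = "\<lambda>z. of_real (1 / T) * (\<Sum>j<J. g z ^ j)"
    have "mult_bound K B (2 * \<kappa> ^ J) (\<lambda>z. 1 / h z * g z ^ J)" by (intro mult_bound_mult inv mult_bound_power gb)
    then have "mult_bound K B \<epsilon> (\<lambda>z. 1 / h z * g z ^ J)" using J \<kappa> by (elim mult_bound_mono) auto
    then have "mult_bound K B \<epsilon> (\<lambda>z. 1 / h z - ?S z)"
    proof (rule mult_bound_cong)
      fix z assume z: "z \<in> B"
      have "(1 - g z) * (\<Sum>j<J. g z ^ j) = 1 - g z ^ J" by (rule one_diff_power_eq[symmetric])
      moreover have "1 - g z = h z / of_real T" by (simp add: g_def)
      ultimately have "h z * ?S z = 1 - g z ^ J" by simp
      then have "?S z = (1 - g z ^ J) / h z" using nz[OF z] by (simp add: field_simps)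
      then show "1 / h z * g z ^ J = 1 / h z - ?S z" by (simp add: diff_divide_distrib)
    qed
    moreover have "approximable ?S"
      by (intro approximable_mult approximable_const approximable_sum approximable_power ga) auto
    ultimately show "\<exists>\<psi>. approximable \<psi> \<and> mult_bound K B \<epsilon> (\<lambda>z. 1 / h z - \<psi> z)" by blast
  qed
qed

text \<open>Rescaling an approximant by \<open>1 / (1 + \<delta>)\<close> restores the bound 1
  exactly, which matters because high powers of \<open>q\<close> are formed later. The rescaling
  costs another \<open>\<delta>\<close> pointwise, hence half of \<open>\<epsilon>\<close> for each
  error.\<close>

lemma contraction_approximation: assumes "approximable h" "0 < \<epsilon>"
  obtains q where "polynomial_several q" "mult_bound K B 1 q"
    "\<And>z. z \<in> B \<Longrightarrow> cmod (1 - 1 / (2 * h z) - q z) \<le> \<epsilon>"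
proof -
  define \<delta> where "\<delta> = \<epsilon> / 2"
  have \<delta>: "0 < \<delta>" using assms(2) by (simp add: \<delta>_def)
  have "approximable (\<lambda>z. 1 + (- 1 / 2) * (1 / h z))"
    by (intro approximable_add approximable_mult approximable_const approximable_reciprocal assms)
  then have "approximable (\<lambda>z. 1 - 1 / (2 * h z))" by simp
  then obtain p where p: "polynomial_several p" "mult_bound K B \<delta> (\<lambda>z. 1 - 1 / (2 * h z) - p z)"
    using \<delta> unfolding approximable_def by meson
  have "mult_bound K B (1 + cmod (-1) * \<delta>) (\<lambda>z. (1 - 1 / (2 * h z)) + (-1) * (1 - 1 / (2 * h z) - p z))"
    using \<delta> by (intro mult_bound_add mult_bound_mult mult_bound_const mult_bound_contraction p) auto
  then have pb: "mult_bound K B (1 + \<delta>) p" by simp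
  define q where "q z = of_real (1 / (1 + \<delta>)) * p z" for z
  have n: "cmod (of_real (1 / (1 + \<delta>))) * (1 + \<delta>) = 1" using \<delta> by (simp only: norm_of_real) simp
  have "mult_bound K B 1 q"
    using mult_bound_mult[OF mult_bound_const[of "of_real (1 / (1 + \<delta>))"] pb]
    unfolding n q_def[abs_def] .
  moreover have "polynomial_several q"
    unfolding q_def[abs_def] by (intro polynomial_several_mult polynomial_several_const p)
  moreover have "cmod (1 - 1 / (2 * h z) - q z) \<le> \<epsilon>" if z: "z \<in> B" for z
  proof -
    have "cmod (1 - 1 / (2 * h z) - p z) \<le> \<delta>"
      using mult_bound_eval[OF p(2) _ z] K_self(1)[OF z] \<delta> by simp
    moreover have "cmod (p z - q z) \<le> \<delta>"
    proof -
      have "cmod (p z) \<le> 1 + \<delta>" using mult_bound_eval[OF pb _ z] K_self(1)[OF z] \<delta> by simp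
      moreover have "p z - q z = of_real (\<delta> / (1 + \<delta>)) * p z"
      proof -
        have r: "\<delta> / (1 + \<delta>) = 1 - 1 / (1 + \<delta>)" using \<delta> by (simp add: field_simps)
        show ?thesis unfolding r of_real_diff q_def by (simp only: left_diff_distrib of_real_1 mult_1)
      qed
      moreover have "cmod (of_real (\<delta> / (1 + \<delta>))) = \<delta> / (1 + \<delta>)" using \<delta> by (simp only: norm_of_real) simp
      ultimately have "cmod (p z - q z) \<le> \<delta> / (1 + \<delta>) * (1 + \<delta>)"
        using \<delta> by (simp only: norm_mult) (intro mult_left_mono, auto)
      then show ?thesis using \<delta> by simp
    qed
    moreover have "cmod (1 - 1 / (2 * h z) - q z) \<le> cmod (1 - 1 / (2 * h z) - p z) + cmod (p z - q z)"
      by (rule norm_diff_triangle_le[OF order_refl order_refl])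
    ultimately show ?thesis by (simp add: \<delta>_def)
  qed
  ultimately show ?thesis using that by blast
qed

end

end

section \<open>Complete Pick kernels\<close>

locale pick_ball = ball_kernel a B for a :: "nat \<Rightarrow> real" and B :: "(complex ^ 'd) set" +
  assumes pick: "complete_pick_kernel B (ui_kernel a)"
begin

abbreviation b :: "complex ^ 'd \<Rightarrow> complex ^ 'd \<Rightarrow> complex" where "b z w \<equiv> 1 - 1 / K z w"

lemma K_nonzero: "z \<in> B \<Longrightarrow> w \<in> B \<Longrightarrow> K z w \<noteq> 0"
  using pick by (auto simp: complete_pick_kernel_def)

interpretation pick: psd_kernel b B
proof
  show "b w z = cnj (b z w)" if "z \<in> B" "w \<in> B" for z w
    using hermitian[OF that] by simp
  show "0 \<le> kernel_sq b F c" if "finite F" "F \<subseteq> B" for F c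
    using pick that unfolding complete_pick_kernel_def positive_semidefinite_on_def Let_def kernel_form_def
    by blast
qed

lemma b_self: assumes "w \<in> B" shows "Re (b w w) \<le> 1"
proof -
  have "K w w = of_real (Re (K w w))" using K_self(2)[OF assms] by (simp add: complex_eq_iff)
  then have "1 / K w w = of_real (1 / Re (K w w))" by (metis of_real_1 of_real_divide)
  then have "Re (1 / K w w) = 1 / Re (K w w)" by (metis Re_complex_of_real)
  then show ?thesis using K_self(1)[OF assms] by simp
qed

text \<open>Cauchy-Schwarz in the space of the kernel \<open>b\<close>, where the section at
  \<open>w\<close> has norm at most 1. It comes from testing positivity on \<open>insert w F\<close>
  with \<open>S\<close> subtracted from the coefficient at \<open>w\<close>.\<close>

lemma pick_Cauchy_Schwarz:
  assumes F: "finite F" "F \<subseteq> B" and w: "w \<in> B"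
  shows "(cmod (\<Sum>z\<in>F. c z * b z w))\<^sup>2 \<le> kernel_sq b F c"
proof -
  define S where "S = (\<Sum>z\<in>F. c z * b z w)"
  let ?G = "insert w F"
  \<comment> \<open>\<open>w\<close> may belong to \<open>F\<close>, so both vectors are extended by
    zero to \<open>insert w F\<close> and added there.\<close>
  define d where "d z = (if z \<in> F then c z else 0)" for z
  define e where "e z = (if z = w then - S else 0)" for z
  have G: "finite ?G" "?G \<subseteq> B" using F w by auto
  have res: "(\<Sum>z\<in>?G. if z \<in> F then f z else 0) = sum f F" for f :: "complex ^ 'd \<Rightarrow> complex"
    using F by (subst sum.inter_restrict[symmetric]) (auto intro!: sum.cong)
  have dd: "kernel_form b ?G d d = kernel_form b F c c"
  proof -
    have "kernel_form b ?G d d =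
        (\<Sum>z\<in>?G. if z \<in> F then (\<Sum>v\<in>?G. if v \<in> F then c z * cnj (c v) * b z v else 0) else 0)"
      unfolding kernel_form_def d_def by (intro sum.cong refl) (auto intro!: sum.cong simp: if_distrib cong: if_cong)
    then show ?thesis unfolding res kernel_form_def .
  qed
  have de: "kernel_form b ?G d e = - (S * cnj S)"
  proof -
    have "kernel_form b ?G d e = (\<Sum>z\<in>?G. if z \<in> F then - cnj S * (c z * b z w) else 0)"
      unfolding kernel_form_def
    proof (intro sum.cong refl)
      fix z assume "z \<in> ?G"
      have "(\<Sum>v\<in>?G. d z * cnj (e v) * b z v) = (\<Sum>v\<in>?G. if v = w then d z * cnj (- S) * b z w else 0)"
        by (intro sum.cong refl) (simp add: e_def)
      also have "\<dots> = d z * cnj (- S) * b z w" using F(1) by (subst sum.delta) auto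
      finally show "(\<Sum>v\<in>?G. d z * cnj (e v) * b z v) = (if z \<in> F then - cnj S * (c z * b z w) else 0)"
        by (simp add: d_def mult_ac)
    qed
    then show ?thesis unfolding res sum_distrib_left[symmetric] S_def[symmetric] by (simp add: mult.commute)
  qed
  have ee: "kernel_form b ?G e e = S * cnj S * b w w"
  proof -
    have "kernel_form b ?G e e = (\<Sum>z\<in>?G. \<Sum>v\<in>?G. if v = w then (if z = w then S * cnj S * b w w else 0) else 0)"
      unfolding kernel_form_def by (intro sum.cong refl) (simp add: e_def)
    then show ?thesis using F(1) by (simp add: sum.delta)
  qed
  have SS: "S * cnj S = of_real ((cmod S)\<^sup>2)" by (simp only: complex_norm_square)
  have "0 \<le> kernel_sq b ?G (\<lambda>z. d z + of_real 1 * e z)" by (rule pick.psd[OF G])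
  also have "\<dots> = kernel_sq b F c - 2 * (cmod S)\<^sup>2 + (cmod S)\<^sup>2 * Re (b w w)"
    unfolding pick.kernel_sq_add[OF G(2)] dd de ee SS by simp
  also have "\<dots> \<le> kernel_sq b F c - 2 * (cmod S)\<^sup>2 + (cmod S)\<^sup>2 * 1"
    using b_self[OF w] by (intro add_left_mono mult_left_mono) auto
  finally show ?thesis by (simp add: S_def)
qed

text \<open>Since \<open>K (1 - b) = 1\<close>, one has \<open>K(z,v) (1 - b(z,w) b(w,v)) = 1 + K(z,v) (b(z,v) - b(z,w) b(w,v))\<close>;
  the last factor is positive semi-definite, and multiplication by \<open>K\<close> preserves this because \<open>K\<close>
  is a positive combination of kernels of rank one.\<close>

lemma mult_bound_b: assumes w: "w \<in> B" shows "mult_bound K B 1 (\<lambda>z. b z w)"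
  unfolding mult_bound_def
proof (intro allI impI)
  fix F :: "(complex ^ 'd) set" and c assume F: "finite F" "F \<subseteq> B"
  let ?R = "\<lambda>z v. b z v - b z w * cnj (b v w)"
  have R: "0 \<le> Re (kernel_form ?R F d d)" for d
  proof -
    have "kernel_form ?R F d d = kernel_form b F d d - (\<Sum>z\<in>F. \<Sum>v\<in>F. (d z * b z w) * cnj (d v * b v w))"
      unfolding kernel_form_def sum_subtractf[symmetric] by (intro sum.cong refl) (simp add: algebra_simps)
    also have "(\<Sum>z\<in>F. \<Sum>v\<in>F. (d z * b z w) * cnj (d v * b v w)) =
        (\<Sum>z\<in>F. d z * b z w) * cnj (\<Sum>z\<in>F. d z * b z w)"
      unfolding cnj_sum by (rule sum_product[symmetric])
    also have "\<dots> = of_real ((cmod (\<Sum>z\<in>F. d z * b z w))\<^sup>2)" by (simp only: complex_norm_square)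
    finally show ?thesis using pick_Cauchy_Schwarz[OF F w, of d] by simp
  qed
  have "(\<lambda>n. \<Sum>z\<in>F. \<Sum>v\<in>F. (c z * cnj (c v) * ?R z v) * (of_real (a n) * hermitian_inner z v ^ n)) sums
      (\<Sum>z\<in>F. \<Sum>v\<in>F. (c z * cnj (c v) * ?R z v) * K z v)"
    using F by (intro sums_sum sums_mult K_sums inner_lt_1) auto
  then have s: "(\<lambda>n. Re (\<Sum>z\<in>F. \<Sum>v\<in>F. (c z * cnj (c v) * ?R z v) * (of_real (a n) * hermitian_inner z v ^ n))) sums
      Re (\<Sum>z\<in>F. \<Sum>v\<in>F. (c z * cnj (c v) * ?R z v) * K z v)"
    by (rule sums_Re)
  have "0 \<le> Re (\<Sum>z\<in>F. \<Sum>v\<in>F. (c z * cnj (c v) * ?R z v) * (of_real (a n) * hermitian_inner z v ^ n))" for n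
  proof -
    have "(\<Sum>z\<in>F. \<Sum>v\<in>F. (c z * cnj (c v) * ?R z v) * (of_real (a n) * hermitian_inner z v ^ n)) =
        (\<Sum>z\<in>F. \<Sum>v\<in>F. \<Sum>xs\<in>words n. of_real (a n) * ((c z * mon z xs) * cnj (c v * mon v xs) * ?R z v))"
      unfolding hermitian_inner_power word_inner_def sum_distrib_left by (intro sum.cong refl) (simp add: mult_ac)
    also have "\<dots> = (\<Sum>z\<in>F. \<Sum>xs\<in>words n. \<Sum>v\<in>F. of_real (a n) * ((c z * mon z xs) * cnj (c v * mon v xs) * ?R z v))"
      by (intro sum.cong refl sum.swap)
    also have "\<dots> = (\<Sum>xs\<in>words n. \<Sum>z\<in>F. \<Sum>v\<in>F. of_real (a n) * ((c z * mon z xs) * cnj (c v * mon v xs) * ?R z v))"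
      by (rule sum.swap)
    also have "\<dots> = (\<Sum>xs\<in>words n. of_real (a n) * kernel_form ?R F (\<lambda>z. c z * mon z xs) (\<lambda>z. c z * mon z xs))"
      by (simp add: kernel_form_def sum_distrib_left)
    finally show ?thesis using R a_pos[of n] by (auto intro!: sum_nonneg mult_nonneg_nonneg simp: less_imp_le)
  qed
  then have pos: "0 \<le> Re (\<Sum>z\<in>F. \<Sum>v\<in>F. (c z * cnj (c v) * ?R z v) * K z v)"
    by (rule sums_le[OF _ sums_zero s])
  have "kernel_form K F c c - kernel_form K F (\<lambda>z. c z * b z w) (\<lambda>z. c z * b z w) =
      (\<Sum>z\<in>F. \<Sum>v\<in>F. c z * cnj (c v)) + (\<Sum>z\<in>F. \<Sum>v\<in>F. (c z * cnj (c v) * ?R z v) * K z v)"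
    unfolding kernel_form_def sum_subtractf[symmetric] sum.distrib[symmetric]
  proof (intro sum.cong refl)
    fix z v assume "z \<in> F" "v \<in> F"
    then have "K z v \<noteq> 0" using K_nonzero F(2) by auto
    then have 1: "K z v * b z v = K z v - 1" by (simp add: field_simps)
    have "C * k - C * (u * v) * k = C + C * (x - u * v) * k" if "k * x = k - 1" for C k x u v :: complex
      using arg_cong[OF that, of "(*) C"] by (simp add: algebra_simps)
    from this[OF 1, of "c z * cnj (c v)" "b z w" "cnj (b v w)"]
    show "c z * cnj (c v) * K z v - c z * b z w * cnj (c v * b v w) * K z v =
        c z * cnj (c v) + (c z * cnj (c v) * ?R z v) * K z v"
      unfolding complex_cnj_mult by (simp only: mult.assoc mult.left_commute[of "b z w"])
  qed
  moreover have "(\<Sum>z\<in>F. \<Sum>v\<in>F. c z * cnj (c v)) = of_real ((cmod (\<Sum>z\<in>F. c z))\<^sup>2)"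
    unfolding complex_norm_square cnj_sum by (rule sum_product[symmetric])
  ultimately have "kernel_sq K F c - kernel_sq K F (\<lambda>z. c z * b z w) =
      (cmod (\<Sum>z\<in>F. c z))\<^sup>2 + Re (\<Sum>z\<in>F. \<Sum>v\<in>F. (c z * cnj (c v) * ?R z v) * K z v)"
    by (simp only: minus_complex.sel(1)[symmetric] plus_complex.sel(1) Re_complex_of_real)
  then have "0 \<le> kernel_sq K F c - kernel_sq K F (\<lambda>z. c z * b z w)"
    using pos by (simp only: add_nonneg_nonneg zero_le_power2)
  then show "kernel_sq K F (\<lambda>z. c z * b z w) \<le> 1\<^sup>2 * kernel_sq K F c" by simp
qed

text \<open>Since \<open>K z w * b z w = K z w - 1\<close>, contractivity of \<open>b\<close> on the
  vector \<open>c z * K z w\<close> bounds the square of that vector minus \<open>c\<close> by the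
  square of the vector; expanding leaves the claim. This is the condition on \<open>h\<close> under
  which reciprocals were treated, here for a kernel section.\<close>

lemma kernel_section_positive:
  assumes w: "w \<in> B" and F: "finite F" "F \<subseteq> B"
  shows "kernel_sq K F c \<le> 2 * Re (kernel_form K F (\<lambda>z. c z * K z w) c)"
proof -
  let ?d = "\<lambda>z. c z * K z w"
  have "kernel_sq K F (\<lambda>z. ?d z + of_real (-1) * c z) = kernel_sq K F (\<lambda>z. ?d z * b z w)"
    using K_nonzero[OF _ w] F(2) by (intro kernel_sq_cong) (auto simp: field_simps)
  also have "\<dots> \<le> kernel_sq K F ?d" using mult_boundD[OF mult_bound_b[OF w] F, of ?d] by simp
  finally show ?thesis unfolding kernel_sq_add[OF F(2)] by simp
qed

lemma Re_K_ge_half: "z \<in> B \<Longrightarrow> w \<in> B \<Longrightarrow> 1 / 2 \<le> Re (K z w)"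
  by (rule Re_ge_half[where h = "\<lambda>z. K z w"]) (auto intro: kernel_section_positive)

text \<open>\<open>pick_Cauchy_Schwarz\<close> with coefficients 1 at \<open>x\<close> and -1 at
  \<open>y\<close> bounds the difference of the values of \<open>b\<close> by b(x,x) + b(y,y) - 2 Re
  b(x,y), and both diagonal terms are at most 1.\<close>

lemma Re_reciprocal_K_ge:
  assumes "x \<in> B" "y \<in> B" "z \<in> B"
  shows "(cmod (1 / K x z - 1 / K y z))\<^sup>2 / 2 \<le> Re (1 / K x y)"
proof (cases "x = y")
  case True
  then show ?thesis using Re_K_ge_half[OF assms(1,2)] by (simp add: Re_divide cmod_power2[symmetric])
next
  case False
  let ?c = "\<lambda>v. if v = x then 1 else - 1 :: complex"
  have F: "finite {x, y}" "{x, y} \<subseteq> B" using assms by auto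
  have "(cmod (b x z - b y z))\<^sup>2 \<le> Re (b x x + b y y - b x y - b y x)"
    using pick_Cauchy_Schwarz[OF F assms(3), of ?c] False by (simp add: kernel_form_def algebra_simps)
  moreover have "Re (b y x) = Re (b x y)" using pick.hermitian[OF assms(1,2)] by (metis cnj.sel(1))
  ultimately have "(cmod (b x z - b y z))\<^sup>2 \<le> 2 * (1 - Re (b x y))"
    using b_self[OF assms(1)] b_self[OF assms(2)] by simp
  then show ?thesis by (simp add: norm_minus_commute)
qed

text \<open>Off the diagonal the kernel stays bounded up to the sphere: its modulus is at most a
  constant over |x - y|^2. This keeps potentials bounded away from the support of their
  measure.\<close>

lemma off_diagonal:
  obtains c where "0 < c" "\<And>x y. x \<in> B \<Longrightarrow> y \<in> B \<Longrightarrow> c * (norm (x - y))\<^sup>2 \<le> Re (1 / K x y)"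
proof -
  text \<open>Compare \<open>x\<close> and \<open>y\<close> by means of a point \<open>z\<close> of norm \<open>\<epsilon>\<close> in the direction of \<open>x - y\<close>.\<close>
  define S where "S = (\<Sum>n. a (n + 2) * real (n + 2) * (1/2) ^ n)"
  have smm: "summable (\<lambda>n. a (n + 2) * real (n + 2) * (1/2) ^ n)"
  proof -
    have "summable (\<lambda>n. diffs a n * (1/2) ^ n)"
    proof (rule termdiff_converges)
      show "norm (1/2 :: real) < 1" by simp
      show "summable (\<lambda>n. a n * x ^ n)" if "norm x < 1" for x
      proof (rule summable_comparison_test'[OF summable_a, of "\<bar>x\<bar>" 0])
        show "norm (a n * x ^ n) \<le> a n * \<bar>x\<bar> ^ n" for n using a_pos[of n] by (simp add: abs_mult power_abs)
      qed (use that in auto)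
    qed
    then have "summable (\<lambda>n. diffs a (Suc n) * (1/2) ^ Suc n)" by (subst summable_Suc_iff)
    then have "summable (\<lambda>n. 2 * (diffs a (Suc n) * (1/2) ^ Suc n))" by (rule summable_mult)
    then show ?thesis by (simp add: diffs_def mult_ac numeral_2_eq_2)
  qed
  have S0: "0 \<le> S" unfolding S_def using a_pos by (intro suminf_nonneg smm) (simp add: less_imp_le)
  \<comment> \<open>The terms of degree at least 2 in \<open>K x z - K y z\<close> add up to at most
    \<open>\<epsilon>^2 * \<delta> * S\<close>, and the linear term is
    \<open>a 1 * \<epsilon> * \<delta>\<close>; this \<open>\<epsilon>\<close> makes the tail at
    most half of it.\<close>
  define \<epsilon> where "\<epsilon> = min (1/2) (a 1 / (2 * (S + 1)))"
  have \<epsilon>: "0 < \<epsilon>" "\<epsilon> \<le> 1/2" "\<epsilon> < 1" "\<epsilon> * S \<le> a 1 / 2"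
  proof -
    show "\<epsilon> \<le> 1/2" unfolding \<epsilon>_def by (rule min.cobounded1)
    then show "0 < \<epsilon>" "\<epsilon> < 1" using S0 a_pos[of 1] by (auto simp: \<epsilon>_def)
    have "\<epsilon> * S \<le> a 1 / (2 * (S + 1)) * (S + 1)" using S0 a_pos[of 1] by (intro mult_mono) (auto simp: \<epsilon>_def)
    also have "\<dots> = a 1 / 2" using S0 by (simp add: field_simps)
    finally show "\<epsilon> * S \<le> a 1 / 2" .
  qed
  define M where "M = kval \<epsilon>"
  have M: "1 \<le> M" unfolding M_def using \<epsilon> by (intro kval_ge_1) auto
  define q where "q = a 1 * \<epsilon> / (2 * M\<^sup>2)"
  have q: "0 < q" using a_pos[of 1] \<epsilon> M by (simp add: q_def)
  have key: "q\<^sup>2 / 2 * (norm (x - y))\<^sup>2 \<le> Re (1 / K x y)" if x: "x \<in> B" and y: "y \<in> B" for x y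
  proof (cases "x = y")
    case True
    then show ?thesis using Re_K_ge_half[OF x y] by (simp add: Re_divide cmod_power2[symmetric])
  next
    case False
    define \<delta> where "\<delta> = norm (x - y)"
    have \<delta>: "0 < \<delta>" using False by (simp add: \<delta>_def)
    define u where "u = (1 / \<delta>) *\<^sub>R (x - y)"
    have u: "norm u = 1" using \<delta> by (simp add: u_def \<delta>_def)
    define z where "z = \<epsilon> *\<^sub>R u"
    have z: "z \<in> B" using u \<epsilon> by (simp add: z_def B_eq)
    define s t where "s = hermitian_inner x u" and "t = hermitian_inner y u"
    have st1: "cmod s \<le> 1" "cmod t \<le> 1"
      using cmod_hermitian_inner_le[of x u] cmod_hermitian_inner_le[of y u] u x y
      by (auto simp: s_def t_def B_eq)
    have st: "s - t = of_real \<delta>"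
    proof -
      have "s - t = of_real (1 / \<delta>) * of_real (\<delta>\<^sup>2)"
        unfolding s_def t_def u_def hermitian_inner_scaleR right_diff_distrib[symmetric]
          hermitian_inner_diff_left[symmetric] hermitian_inner_self \<delta>_def ..
      also have "\<dots> = of_real \<delta>" using \<delta> by (simp add: power2_eq_square)
      finally show ?thesis .
    qed
    have xz: "hermitian_inner x z = of_real \<epsilon> * s" "hermitian_inner y z = of_real \<epsilon> * t"
      by (simp_all add: z_def s_def t_def hermitian_inner_scaleR)
    define f where "f n = of_real (a n) * of_real (\<epsilon> ^ n) * (s ^ n - t ^ n)" for n
    have fs: "f sums (K x z - K y z)"
    proof -
      have "(\<lambda>n. of_real (a n) * hermitian_inner x z ^ n - of_real (a n) * hermitian_inner y z ^ n) sums
          (K x z - K y z)"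
        by (intro sums_diff K_sums inner_lt_1 x y z)
      then show ?thesis by (simp add: f_def[abs_def] xz power_mult_distrib algebra_simps)
    qed
    have fb: "cmod (f (n + 2)) \<le> \<epsilon>\<^sup>2 * \<delta> * (a (n + 2) * real (n + 2) * (1/2) ^ n)" for n
    proof -
      have "cmod (s ^ (n + 2) - t ^ (n + 2)) \<le> real (n + 2) * \<delta>"
        using norm_power_diff[of s t "n + 2"] st1 \<delta> unfolding st by simp
      moreover have "\<epsilon> ^ (n + 2) \<le> \<epsilon>\<^sup>2 * (1/2) ^ n"
        unfolding power_add mult.commute[of "\<epsilon> ^ n"] using \<epsilon> by (intro mult_left_mono power_mono) auto
      ultimately have "a (n + 2) * (\<epsilon> ^ (n + 2) * cmod (s ^ (n + 2) - t ^ (n + 2))) \<le>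
          a (n + 2) * ((\<epsilon>\<^sup>2 * (1/2) ^ n) * (real (n + 2) * \<delta>))"
        using a_pos[of "n + 2"] \<epsilon> by (intro mult_left_mono mult_mono) (auto simp: less_imp_le)
      moreover have "cmod (f (n + 2)) = a (n + 2) * (\<epsilon> ^ (n + 2) * cmod (s ^ (n + 2) - t ^ (n + 2)))"
        using a_pos[of "n + 2"] \<epsilon> unfolding f_def norm_mult norm_of_real by simp
      ultimately show ?thesis by (simp only: mult_ac)
    qed
    have sb: "summable (\<lambda>n. \<epsilon>\<^sup>2 * \<delta> * (a (n + 2) * real (n + 2) * (1/2) ^ n))" by (intro summable_mult smm)
    have sn: "summable (\<lambda>n. cmod (f (n + 2)))" by (rule summable_comparison_test'[OF sb, of 0]) (use fb in simp)
    have "cmod (\<Sum>n. f (n + 2)) \<le> (\<Sum>n. \<epsilon>\<^sup>2 * \<delta> * (a (n + 2) * real (n + 2) * (1/2) ^ n))"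
      by (rule order_trans[OF summable_norm[OF sn] suminf_le[OF fb sn sb]])
    also have "\<dots> = \<epsilon> * \<delta> * (\<epsilon> * S)"
      unfolding S_def suminf_mult[OF smm] by (simp add: power2_eq_square)
    also have "\<dots> \<le> \<epsilon> * \<delta> * (a 1 / 2)" using \<epsilon> \<delta> by (intro mult_left_mono) auto
    finally have tl: "cmod (\<Sum>n. f (n + 2)) \<le> \<epsilon> * \<delta> * (a 1 / 2)" .
    have "K x z - K y z = (\<Sum>n. f (n + 2)) + (\<Sum>i<2. f i)"
      using suminf_split_initial_segment[OF sums_summable[OF fs], of 2] sums_unique[OF fs] by simp
    also have "(\<Sum>i<2. f i) = of_real (a 1 * \<epsilon> * \<delta>)"
      by (simp add: f_def numeral_2_eq_2 st)
    finally have "cmod (of_real (a 1 * \<epsilon> * \<delta>)) \<le> cmod (K x z - K y z) + cmod (\<Sum>n. f (n + 2))"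
      by (metis add_diff_cancel_left' norm_triangle_ineq4)
    moreover have "cmod (of_real (a 1 * \<epsilon> * \<delta>)) = a 1 * \<epsilon> * \<delta>"
      using a_pos[of 1] \<epsilon> \<delta> by (simp only: norm_of_real) simp
    ultimately have lo: "a 1 * \<epsilon> * \<delta> / 2 \<le> cmod (K x z - K y z)" using tl by (simp add: mult_ac)
    have up: "cmod (K x z) \<le> M" "cmod (K y z) \<le> M"
      unfolding M_def using \<epsilon> st1 xz by (auto intro!: cmod_K_le simp: norm_mult)
    have nz: "K x z \<noteq> 0" "K y z \<noteq> 0" using K_nonzero x y z by auto
    have "1 / K x z - 1 / K y z = (K y z - K x z) / (K x z * K y z)" using nz by (simp add: field_simps)
    then have "cmod (1 / K x z - 1 / K y z) = cmod (K x z - K y z) / (cmod (K x z) * cmod (K y z))"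
      by (simp add: norm_divide norm_mult norm_minus_commute)
    also have "\<dots> \<ge> (a 1 * \<epsilon> * \<delta> / 2) / (M * M)"
      using lo up nz M a_pos[of 1] \<epsilon> \<delta> by (intro frac_le mult_mono) auto
    finally have "q * \<delta> \<le> cmod (1 / K x z - 1 / K y z)" by (simp add: q_def power2_eq_square)
    then have "(q * \<delta>)\<^sup>2 / 2 \<le> (cmod (1 / K x z - 1 / K y z))\<^sup>2 / 2"
      using q \<delta> by (intro divide_right_mono power_mono) auto
    also have "\<dots> \<le> Re (1 / K x y)" by (rule Re_reciprocal_K_ge[OF x y z])
    finally show ?thesis by (simp add: \<delta>_def power_mult_distrib)
  qed
  show ?thesis using q by (intro that[OF _ key]) auto
qed

end

section \<open>Measure theory: null sets and integrals of complex measures\<close>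

section \<open>Jordan decomposition of complex measures\<close>

definition signed_measure :: "'a measure \<Rightarrow> ('a set \<Rightarrow> real) \<Rightarrow> bool"
  where "signed_measure M \<sigma> \<longleftrightarrow> \<sigma> {} = 0 \<and>
    (\<forall>A :: nat \<Rightarrow> 'a set. range A \<subseteq> sets M \<longrightarrow> disjoint_family A \<longrightarrow> (\<lambda>n. \<sigma> (A n)) sums \<sigma> (\<Union>n. A n))"

lemma signed_measure_uminus: "signed_measure M \<sigma> \<Longrightarrow> signed_measure M (\<lambda>A. - \<sigma> A)"
  unfolding signed_measure_def by (auto intro: sums_minus)

lemma signed_measure_Re_Im:
  assumes "complex_measure M \<nu>"
  shows "signed_measure M (\<lambda>A. Re (\<nu> A))" "signed_measure M (\<lambda>A. Im (\<nu> A))"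
  using assms unfolding signed_measure_def complex_measure_def by (auto intro: sums_Re sums_Im)

lemma signed_measure_union:
  assumes "signed_measure M \<sigma>" "A \<in> sets M" "B \<in> sets M" "A \<inter> B = {}"
  shows "\<sigma> (A \<union> B) = \<sigma> A + \<sigma> B"
proof -
  have "(\<lambda>n. \<sigma> (binaryset A B n)) sums \<sigma> (\<Union>n. binaryset A B n)"
  proof -
    have "range (binaryset A B) \<subseteq> sets M" using assms(2,3) by (auto simp: range_binaryset_eq)
    moreover have "disjoint_family (binaryset A B)"
      using assms(4) by (auto simp: disjoint_family_on_def binaryset_def)
    ultimately show ?thesis using assms(1) unfolding signed_measure_def by blast
  qed
  moreover have "(\<lambda>n. \<sigma> (binaryset A B n)) sums (\<sigma> A + \<sigma> B)"
    using assms(1) by (intro binaryset_sums) (simp add: signed_measure_def)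
  ultimately show ?thesis unfolding UN_binaryset_eq by (rule sums_unique2)
qed

lemma signed_measure_diff:
  assumes "signed_measure M \<sigma>" "A \<in> sets M" "B \<in> sets M" "B \<subseteq> A"
  shows "\<sigma> (A - B) = \<sigma> A - \<sigma> B"
  using signed_measure_union[OF assms(1,3), of "A - B"] assms by (simp add: Un_absorb1)

text \<open>If \<open>\<sigma>\<close> is unbounded on the subsets of \<open>A\<close>, it is so on
  one of two complementary pieces, and the discarded piece can be given mass of modulus at least 1.
  Iterating yields disjoint sets whose masses do not tend to 0, against countable
  additivity.\<close>

lemma signed_measure_bounded:
  assumes \<sigma>: "signed_measure M \<sigma>"
  obtains C where "\<And>B. B \<in> sets M \<Longrightarrow> \<bar>\<sigma> B\<bar> \<le> C"
proof (rule ccontr)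
  assume "\<not> thesis"
  then have neg: "\<nexists>C. \<forall>B\<in>sets M. \<bar>\<sigma> B\<bar> \<le> C" using that by blast
  define unb where "unb A \<longleftrightarrow> A \<in> sets M \<and> (\<forall>c. \<exists>B\<in>sets M. B \<subseteq> A \<and> c < \<bar>\<sigma> B\<bar>)" for A
  have start: "unb (space M)"
    unfolding unb_def using neg by (meson not_le sets.sets_into_space sets.top)
  have step: "\<exists>A'. unb A' \<and> A' \<subseteq> A \<and> 1 \<le> \<bar>\<sigma> (A - A')\<bar>" if A: "unb A" for A
  proof -
    \<comment> \<open>The margin \<open>\<bar>\<sigma> A\<bar>\<close> forces both \<open>B\<close>
      and \<open>A - B\<close> to have mass of modulus above 1, whichever of them is
      discarded.\<close>
    obtain B where B: "B \<in> sets M" "B \<subseteq> A" "1 + \<bar>\<sigma> A\<bar> < \<bar>\<sigma> B\<bar>" using A unfolding unb_def by blast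
    have AM: "A \<in> sets M" using A by (simp add: unb_def)
    have diff: "\<sigma> (A - B) = \<sigma> A - \<sigma> B" by (rule signed_measure_diff[OF \<sigma> AM B(1,2)])
    have "unb B \<or> unb (A - B)"
    proof (rule ccontr)
      assume "\<not> ?thesis"
      then obtain c d where c: "\<And>D. D \<in> sets M \<Longrightarrow> D \<subseteq> B \<Longrightarrow> \<bar>\<sigma> D\<bar> \<le> c"
        and d: "\<And>D. D \<in> sets M \<Longrightarrow> D \<subseteq> A - B \<Longrightarrow> \<bar>\<sigma> D\<bar> \<le> d"
        using B(1) AM unfolding unb_def by (metis not_le sets.Diff)
      obtain D where D: "D \<in> sets M" "D \<subseteq> A" "c + d < \<bar>\<sigma> D\<bar>" using A unfolding unb_def by blast
      have "\<sigma> D = \<sigma> (D \<inter> B) + \<sigma> (D - B)"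
        using signed_measure_union[OF \<sigma>, of "D \<inter> B" "D - B"] D B by (simp add: Int_Diff_Un Int_Diff_disjoint)
      moreover have "\<bar>\<sigma> (D \<inter> B)\<bar> \<le> c" "\<bar>\<sigma> (D - B)\<bar> \<le> d" using D B by (auto intro!: c d)
      ultimately show False using D(3) by linarith
    qed
    then show ?thesis
    proof
      assume "unb B"
      then show ?thesis using B(2,3) diff by (intro exI[of _ B]) linarith
    next
      assume "unb (A - B)"
      moreover have "A - (A - B) = B" using B(2) by blast
      ultimately show ?thesis using B(3) by (intro exI[of _ "A - B"]) auto
    qed
  qed
  obtain A where A: "\<And>n. unb (A n)" "\<And>n. A (Suc n) \<subseteq> A n \<and> 1 \<le> \<bar>\<sigma> (A n - A (Suc n))\<bar>"
    using dependent_nat_choice[of "\<lambda>_. unb" "\<lambda>_ A A'. A' \<subseteq> A \<and> 1 \<le> \<bar>\<sigma> (A - A')\<bar>"] start step by metis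
  have dec: "A n \<subseteq> A m" if "m \<le> n" for m n using lift_Suc_antimono_le[of A, OF _ that] A(2) by blast
  define D where "D n = A n - A (Suc n)" for n
  have "disjoint_family D"
    unfolding disjoint_family_on_def
  proof (intro ballI impI)
    fix m n :: nat assume "m \<noteq> n"
    then show "D m \<inter> D n = {}"
      using dec[of "Suc m" n] dec[of "Suc n" m] by (cases "m < n") (auto simp: D_def Suc_le_eq)
  qed
  moreover have "range D \<subseteq> sets M" using A(1) by (auto simp: D_def unb_def)
  ultimately have "summable (\<lambda>n. \<sigma> (D n))" using \<sigma> sums_summable unfolding signed_measure_def by blast
  then have "(\<lambda>n. \<sigma> (D n)) \<longlonglongrightarrow> 0" by (rule summable_LIMSEQ_zero)
  then obtain n where "\<bar>\<sigma> (D n)\<bar> < 1"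
    using LIMSEQ_D[of "\<lambda>n. \<sigma> (D n)" 0 1] by auto
  then show False using A(2)[of n] by (simp add: D_def)
qed

lemma sets_jordan_pos [simp]: "sets (jordan_pos M \<sigma>) = sets M"
  and space_jordan_pos [simp]: "space (jordan_pos M \<sigma>) = space M"
  by (simp_all add: jordan_pos_def)

lemma ennreal_add_le: "ennreal (x + y) \<le> ennreal x + ennreal y"
proof (cases "0 \<le> x \<and> 0 \<le> y")
  case False
  then have "ennreal (x + y) \<le> ennreal x \<or> ennreal (x + y) \<le> ennreal y" by (auto intro!: ennreal_leI)
  then show ?thesis by (meson add_increasing add_increasing2 zero_le)
qed (auto simp: ennreal_plus)

lemma ennreal_sum_le: "ennreal (sum f I) \<le> (\<Sum>i\<in>I. ennreal (f i))"
  by (induction I rule: infinite_finite_induct) (auto intro: order_trans[OF ennreal_add_le] add_left_mono)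

context
  fixes M :: "'a measure" and \<sigma> :: "'a set \<Rightarrow> real"
  assumes \<sigma>: "signed_measure M \<sigma>"
begin

private abbreviation "P A \<equiv> (SUP B\<in>{B \<in> sets M. B \<subseteq> A}. ennreal (\<sigma> B))"

private lemma P_superadditive:
  assumes "A \<inter> A' = {}" shows "P A + P A' \<le> P (A \<union> A')"
proof -
  have ne: "{B \<in> sets M. B \<subseteq> A} \<noteq> {}" "{B \<in> sets M. B \<subseteq> A'} \<noteq> {}" by auto
  have "ennreal (\<sigma> B) + ennreal (\<sigma> B') \<le> P (A \<union> A')"
    if B: "B \<in> sets M" "B \<subseteq> A" and B': "B' \<in> sets M" "B' \<subseteq> A'" for B B'
  proof -
    \<comment> \<open>\<open>ennreal\<close> truncates negative values to 0, which the empty set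
      realises; so only nonnegative masses have to be added.\<close>
    define D where "D = (if 0 \<le> \<sigma> B then B else {})"
    define D' where "D' = (if 0 \<le> \<sigma> B' then B' else {})"
    have D: "D \<in> sets M" "D \<subseteq> A" "D' \<in> sets M" "D' \<subseteq> A'" using B B' by (auto simp: D_def D'_def)
    have "\<sigma> {} = 0" using \<sigma> by (simp add: signed_measure_def)
    then have s: "0 \<le> \<sigma> D" "0 \<le> \<sigma> D'" "ennreal (\<sigma> B) = ennreal (\<sigma> D)" "ennreal (\<sigma> B') = ennreal (\<sigma> D')"
      by (auto simp: D_def D'_def ennreal_neg)
    have "\<sigma> (D \<union> D') = \<sigma> D + \<sigma> D'" using D assms by (intro signed_measure_union[OF \<sigma>]) auto
    then have "ennreal (\<sigma> B) + ennreal (\<sigma> B') = ennreal (\<sigma> (D \<union> D'))" using s by (simp add: ennreal_plus)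
    also have "\<dots> \<le> P (A \<union> A')" using D by (intro SUP_upper) auto
    finally show ?thesis .
  qed
  then have "P A + ennreal (\<sigma> B') \<le> P (A \<union> A')" if "B' \<in> sets M" "B' \<subseteq> A'" for B'
    unfolding ennreal_SUP_add_left[OF ne(1), symmetric] using that by (intro SUP_least) auto
  then show ?thesis
    unfolding ennreal_SUP_add_right[OF ne(2)] by (intro SUP_least) auto
qed

text \<open>\<open>measure_of\<close> returns the given set function once it is countably additive.
  Superadditivity on disjoint pieces gives one inequality; cutting a competitor \<open>B\<close>
  along the pieces gives the other.\<close>

lemma emeasure_jordan_pos:
  assumes "A \<in> sets M" shows "emeasure (jordan_pos M \<sigma>) A = P A"
  unfolding jordan_pos_def
proof (rule emeasure_measure_of_sigma)
  show "sigma_algebra (space M) (sets M)" by (rule sets.sigma_algebra_axioms)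
  have 0: "\<sigma> {} = 0" using \<sigma> by (simp add: signed_measure_def)
  have "{B \<in> sets M. B \<subseteq> {}} = {{}}" by auto
  then show "positive (sets M) P" using 0 by (simp add: positive_def)
  show "countably_additive (sets M) P"
    unfolding countably_additive_def
  proof (intro allI impI)
    fix A :: "nat \<Rightarrow> 'a set" assume A: "range A \<subseteq> sets M" "disjoint_family A" "\<Union> (range A) \<in> sets M"
    have fin: "(\<Sum>i<n. P (A i)) \<le> P (\<Union>i<n. A i)" for n
    proof (induction n)
      case (Suc n)
      have "(\<Sum>i<Suc n. P (A i)) \<le> P (\<Union>i<n. A i) + P (A n)" using Suc by (simp add: add_right_mono)
      also have "\<dots> \<le> P ((\<Union>i<n. A i) \<union> A n)"
      proof (rule P_superadditive)
        have "A i \<inter> A n = {}" if "i < n" for i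
          using A(2) that unfolding disjoint_family_on_def by (metis UNIV_I less_irrefl)
        then show "(\<Union>i<n. A i) \<inter> A n = {}" by blast
      qed
      also have "(\<Union>i<n. A i) \<union> A n = (\<Union>i<Suc n. A i)" by (auto simp: less_Suc_eq)
      finally show ?case .
    qed simp
    have "(\<Sum>i. P (A i)) \<le> P (\<Union> (range A))"
      unfolding suminf_eq_SUP
    proof (rule SUP_least)
      fix n
      show "(\<Sum>i<n. P (A i)) \<le> P (\<Union> (range A))"
        by (rule order_trans[OF fin]) (intro SUP_subset_mono, auto)
    qed
    moreover have "P (\<Union> (range A)) \<le> (\<Sum>i. P (A i))"
    proof (rule SUP_least)
      fix B assume "B \<in> {B \<in> sets M. B \<subseteq> \<Union> (range A)}"
      then have B: "B \<in> sets M" "B \<subseteq> \<Union> (range A)" by auto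
      have "(\<lambda>n. \<sigma> (B \<inter> A n)) sums \<sigma> (\<Union>n. B \<inter> A n)"
      proof -
        have "range (\<lambda>n. B \<inter> A n) \<subseteq> sets M" using A(1) B(1) by auto
        moreover have "disjoint_family (\<lambda>n. B \<inter> A n)" using A(2) unfolding disjoint_family_on_def by blast
        ultimately show ?thesis using \<sigma> unfolding signed_measure_def by blast
      qed
      moreover have "(\<Union>n. B \<inter> A n) = B" using B by auto
      ultimately have "(\<lambda>n. ennreal (\<Sum>i<n. \<sigma> (B \<inter> A i))) \<longlonglongrightarrow> ennreal (\<sigma> B)"
        by (intro tendsto_ennrealI) (simp add: sums_def)
      moreover have "ennreal (\<Sum>i<n. \<sigma> (B \<inter> A i)) \<le> (\<Sum>i. P (A i))" for n
      proof -
        have "ennreal (\<Sum>i<n. \<sigma> (B \<inter> A i)) \<le> (\<Sum>i<n. P (A i))"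
          using A B by (intro order_trans[OF ennreal_sum_le] sum_mono SUP_upper) auto
        also have "\<dots> \<le> (\<Sum>i. P (A i))" by (intro sum_le_suminf) auto
        finally show ?thesis .
      qed
      ultimately show "ennreal (\<sigma> B) \<le> (\<Sum>i. P (A i))" by (intro LIMSEQ_le_const2) auto
    qed
    ultimately show "(\<Sum>i. P (A i)) = P (\<Union> (range A))" by (rule antisym)
  qed
qed (rule assms)

lemma finite_measure_jordan_pos: "finite_measure (jordan_pos M \<sigma>)"
proof
  obtain C where C: "\<And>B. B \<in> sets M \<Longrightarrow> \<bar>\<sigma> B\<bar> \<le> C" using signed_measure_bounded[OF \<sigma>] by blast
  have "emeasure (jordan_pos M \<sigma>) (space M) \<le> ennreal C"
    unfolding emeasure_jordan_pos[OF sets.top] using C by (intro SUP_least ennreal_leI) force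
  then show "emeasure (jordan_pos M \<sigma>) (space (jordan_pos M \<sigma>)) \<noteq> \<infinity>"
    by (auto simp: top_unique)
qed

end

text \<open>For \<open>B \<subseteq> A\<close>,
  \<open>\<sigma> B = \<sigma> A - \<sigma> (A - B)\<close>, and the last term is controlled by the
  negative part. Taking suprema for both signs gives two opposite inequalities.\<close>

lemma jordan_decomposition:
  assumes \<sigma>: "signed_measure M \<sigma>" and A: "A \<in> sets M"
  shows "\<sigma> A = measure (jordan_pos M \<sigma>) A - measure (jordan_pos M (\<lambda>A. - \<sigma> A)) A"
proof -
  note \<sigma>' = signed_measure_uminus[OF \<sigma>]
  interpret p: finite_measure "jordan_pos M \<sigma>" by (rule finite_measure_jordan_pos[OF \<sigma>])
  interpret n: finite_measure "jordan_pos M (\<lambda>A. - \<sigma> A)" by (rule finite_measure_jordan_pos[OF \<sigma>'])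
  have le: "measure (jordan_pos M \<tau>) A \<le> \<tau> A + measure (jordan_pos M (\<lambda>A. - \<tau> A)) A"
    if \<tau>: "signed_measure M \<tau>" for \<tau>
  proof -
    note \<tau>' = signed_measure_uminus[OF \<tau>]
    interpret p: finite_measure "jordan_pos M \<tau>" by (rule finite_measure_jordan_pos[OF \<tau>])
    interpret n: finite_measure "jordan_pos M (\<lambda>A. - \<tau> A)" by (rule finite_measure_jordan_pos[OF \<tau>'])
    have b: "\<tau> B \<le> \<tau> A + measure (jordan_pos M (\<lambda>A. - \<tau> A)) A" if B: "B \<in> sets M" "B \<subseteq> A" for B
    proof -
      have "ennreal (- \<tau> (A - B)) \<le> emeasure (jordan_pos M (\<lambda>A. - \<tau> A)) A"
        unfolding emeasure_jordan_pos[OF \<tau>' A] using A B by (intro SUP_upper) auto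
      then have "- \<tau> (A - B) \<le> measure (jordan_pos M (\<lambda>A. - \<tau> A)) A"
        unfolding n.emeasure_eq_measure by (simp add: ennreal_le_iff)
      then show ?thesis using signed_measure_diff[OF \<tau> A B] by simp
    qed
    have "\<tau> {} = 0" using \<tau> by (simp add: signed_measure_def)
    then have nn: "0 \<le> \<tau> A + measure (jordan_pos M (\<lambda>A. - \<tau> A)) A" using b[of "{}"] by simp
    have "emeasure (jordan_pos M \<tau>) A \<le> ennreal (\<tau> A + measure (jordan_pos M (\<lambda>A. - \<tau> A)) A)"
      unfolding emeasure_jordan_pos[OF \<tau> A] using b by (intro SUP_least ennreal_leI) auto
    then show ?thesis using nn unfolding p.emeasure_eq_measure by (simp add: ennreal_le_iff)
  qed
  show ?thesis using le[OF \<sigma>] le[OF \<sigma>'] by simp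
qed

text \<open>A finite positive measure with the same null sets as \<open>\<nu>\<close>; it lies between the total
  variation and twice the total variation.\<close>

definition variation :: "'a measure \<Rightarrow> ('a set \<Rightarrow> complex) \<Rightarrow> 'a measure"
  where "variation M \<nu> = measure_of (space M) (sets M) (\<lambda>A.
    emeasure (jordan_pos M (\<lambda>A. Re (\<nu> A))) A + emeasure (jordan_pos M (\<lambda>A. - Re (\<nu> A))) A +
    (emeasure (jordan_pos M (\<lambda>A. Im (\<nu> A))) A + emeasure (jordan_pos M (\<lambda>A. - Im (\<nu> A))) A))"

lemma sets_variation [simp]: "sets (variation M \<nu>) = sets M"
  and space_variation [simp]: "space (variation M \<nu>) = space M"
  by (simp_all add: variation_def)

lemma emeasure_variation:
  assumes "A \<in> sets M"
  shows "emeasure (variation M \<nu>) A =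
    emeasure (jordan_pos M (\<lambda>A. Re (\<nu> A))) A + emeasure (jordan_pos M (\<lambda>A. - Re (\<nu> A))) A +
    (emeasure (jordan_pos M (\<lambda>A. Im (\<nu> A))) A + emeasure (jordan_pos M (\<lambda>A. - Im (\<nu> A))) A)"
  unfolding variation_def
proof (rule emeasure_measure_of_sigma)
  let ?f = "\<lambda>A. emeasure (jordan_pos M (\<lambda>A. Re (\<nu> A))) A + emeasure (jordan_pos M (\<lambda>A. - Re (\<nu> A))) A +
    (emeasure (jordan_pos M (\<lambda>A. Im (\<nu> A))) A + emeasure (jordan_pos M (\<lambda>A. - Im (\<nu> A))) A)"
  show "sigma_algebra (space M) (sets M)" by (rule sets.sigma_algebra_axioms)
  show "positive (sets M) ?f" by (simp add: positive_def)
  show "countably_additive (sets M) ?f"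
    unfolding countably_additive_def
    by (intro allI impI) (simp add: suminf_add[symmetric] suminf_emeasure)
qed (rule assms)

context
  fixes M :: "'a measure" and \<nu> :: "'a set \<Rightarrow> complex"
  assumes \<nu>: "complex_measure M \<nu>"
begin

lemma signed_measures:
  "signed_measure M (\<lambda>A. Re (\<nu> A))" "signed_measure M (\<lambda>A. - Re (\<nu> A))"
  "signed_measure M (\<lambda>A. Im (\<nu> A))" "signed_measure M (\<lambda>A. - Im (\<nu> A))"
  using signed_measure_Re_Im[OF \<nu>] signed_measure_uminus by auto

lemma finite_measure_variation: "finite_measure (variation M \<nu>)"
proof
  have "emeasure (jordan_pos M \<sigma>) (space M) \<noteq> \<infinity>" if "signed_measure M \<sigma>" for \<sigma>
    using finite_measure.emeasure_finite[OF finite_measure_jordan_pos[OF that]] by simp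
  from this[OF signed_measures(1)] this[OF signed_measures(2)] this[OF signed_measures(3)] this[OF signed_measures(4)]
  show "emeasure (variation M \<nu>) (space (variation M \<nu>)) \<noteq> \<infinity>"
    by (simp add: emeasure_variation)
qed

lemma variation_eq_0_iff:
  assumes A: "A \<in> sets M"
  shows "emeasure (variation M \<nu>) A = 0 \<longleftrightarrow> (\<forall>B\<in>sets M. B \<subseteq> A \<longrightarrow> \<nu> B = 0)"
proof
  assume "emeasure (variation M \<nu>) A = 0"
  then have z: "emeasure (jordan_pos M (\<lambda>A. Re (\<nu> A))) A = 0" "emeasure (jordan_pos M (\<lambda>A. - Re (\<nu> A))) A = 0"
    "emeasure (jordan_pos M (\<lambda>A. Im (\<nu> A))) A = 0" "emeasure (jordan_pos M (\<lambda>A. - Im (\<nu> A))) A = 0"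
    using A by (auto simp: emeasure_variation)
  have le: "\<sigma> B \<le> 0" if "signed_measure M \<sigma>" "emeasure (jordan_pos M \<sigma>) A = 0" "B \<in> sets M" "B \<subseteq> A" for \<sigma> B
  proof -
    have "ennreal (\<sigma> B) \<le> emeasure (jordan_pos M \<sigma>) A"
      unfolding emeasure_jordan_pos[OF that(1) A] using that by (intro SUP_upper) auto
    then show ?thesis using that(2) by (simp add: ennreal_eq_0_iff)
  qed
  show "\<forall>B\<in>sets M. B \<subseteq> A \<longrightarrow> \<nu> B = 0"
    using le[OF signed_measures(1) z(1)] le[OF signed_measures(2) z(2)]
      le[OF signed_measures(3) z(3)] le[OF signed_measures(4) z(4)]
    by (auto simp: complex_eq_iff intro!: antisym)
next
  assume z: "\<forall>B\<in>sets M. B \<subseteq> A \<longrightarrow> \<nu> B = 0"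
  have "emeasure (jordan_pos M \<sigma>) A = 0"
    if "signed_measure M \<sigma>" "\<And>B. B \<in> sets M \<Longrightarrow> B \<subseteq> A \<Longrightarrow> \<sigma> B = 0" for \<sigma>
    unfolding emeasure_jordan_pos[OF that(1) A] using that(2) by (auto simp: SUP_eq_iff bot_ennreal intro!: antisym SUP_least)
  then show "emeasure (variation M \<nu>) A = 0"
    using z signed_measures by (simp add: emeasure_variation A)
qed

text \<open>Concentration and singularity see the total variation only through its null sets; this
  characterisation, shared with \<open>variation\<close>, lets the latter be used instead.\<close>

lemma total_variation_eq_0_iff:
  assumes A: "A \<in> sets M"
  shows "total_variation M \<nu> A = 0 \<longleftrightarrow> (\<forall>B\<in>sets M. B \<subseteq> A \<longrightarrow> \<nu> B = 0)"
proof
  assume tv: "total_variation M \<nu> A = 0"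
  show "\<forall>B\<in>sets M. B \<subseteq> A \<longrightarrow> \<nu> B = 0"
  proof (intro ballI impI)
    fix B assume B: "B \<in> sets M" "B \<subseteq> A"
    let ?D = "binaryset B (A - B)"
    have "(\<Sum>n. ennreal (cmod (\<nu> (?D n)))) \<le> total_variation M \<nu> A"
      unfolding total_variation_def using A B
      by (intro SUP_upper) (auto simp: range_binaryset_eq UN_binaryset_eq disjoint_family_on_def binaryset_def)
    then have "(\<Sum>n. ennreal (cmod (\<nu> (?D n)))) = 0" using tv by simp
    then have "ennreal (cmod (\<nu> (?D 0))) = 0" by (subst (asm) suminf_eq_zero_iff) auto
    then show "\<nu> B = 0" by (simp add: binaryset_def)
  qed
next
  assume z: "\<forall>B\<in>sets M. B \<subseteq> A \<longrightarrow> \<nu> B = 0"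
  have *: "(\<Sum>n. ennreal (cmod (\<nu> (D n)))) \<le> 0" if "range D \<subseteq> sets M" "(\<Union>n. D n) = A" for D :: "nat \<Rightarrow> 'a set"
  proof -
    have "\<nu> (D n) = 0" for n using z that by blast
    then show ?thesis by simp
  qed
  have "total_variation M \<nu> A \<le> 0"
    unfolding total_variation_def by (rule SUP_least, drule CollectD, elim conjE, rule *)
  then show "total_variation M \<nu> A = 0" by simp
qed

lemma concentrated_on_iff:
  "concentrated_on M \<nu> A \<longleftrightarrow> A \<in> sets M \<and> emeasure (variation M \<nu>) (space M - A) = 0"
proof (cases "A \<in> sets M")
  case True
  then have "space M - A \<in> sets M" by simp
  then show ?thesis
    using True by (simp only: concentrated_on_def total_variation_eq_0_iff variation_eq_0_iff)
qed (simp add: concentrated_on_def)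

lemma complex_measure_jordan:
  assumes A: "A \<in> sets M"
  shows "\<nu> A =
    (of_real (measure (jordan_pos M (\<lambda>A. Re (\<nu> A))) A) - of_real (measure (jordan_pos M (\<lambda>A. - Re (\<nu> A))) A)) +
    \<i> * (of_real (measure (jordan_pos M (\<lambda>A. Im (\<nu> A))) A) - of_real (measure (jordan_pos M (\<lambda>A. - Im (\<nu> A))) A))"
  by (subst complex_eq[of "\<nu> A"], subst jordan_decomposition[OF signed_measures(1) A],
      subst jordan_decomposition[OF signed_measures(3) A]) (simp only: of_real_diff)

end

lemma mutually_singular_iff:
  assumes \<nu>: "complex_measure M \<nu>" and \<mu>: "complex_measure M \<mu>"
  shows "mutually_singular M \<nu> \<mu> \<longleftrightarrow>
    (\<exists>A\<in>sets M. emeasure (variation M \<nu>) (space M - A) = 0 \<and> emeasure (variation M \<mu>) A = 0)"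
proof -
  have "space M - (space M - A) = A" if "A \<in> sets M" for A using sets.sets_into_space[OF that] by auto
  then show ?thesis
    unfolding mutually_singular_def concentrated_on_iff[OF \<nu>] concentrated_on_iff[OF \<mu>] by auto
qed

section \<open>Positive measures as complex measures\<close>

context
  fixes M \<mu> :: "'a measure"
  assumes fin: "finite_measure \<mu>" and sets: "sets \<mu> = sets M"
begin

interpretation finite_measure \<mu> by (rule fin)

lemma complex_measure_of: "complex_measure M (complex_measure_of \<mu>)"
  unfolding complex_measure_def complex_measure_of_def using sets
  by (auto intro!: sums_of_real finite_measure_UNION)

lemma jordan_pos_measure: "jordan_pos M (measure \<mu>) = \<mu>"
proof (rule measure_eqI)
  have s: "signed_measure M (measure \<mu>)"
    using signed_measure_Re_Im(1)[OF complex_measure_of] by (simp add: complex_measure_of_def)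
  fix A assume A: "A \<in> sets (jordan_pos M (measure \<mu>))"
  have "ennreal (measure \<mu> B) \<le> ennreal (measure \<mu> A)" if "B \<in> sets M" "B \<subseteq> A" for B
    using A that sets by (intro ennreal_leI finite_measure_mono) auto
  then show "emeasure (jordan_pos M (measure \<mu>)) A = emeasure \<mu> A"
    using A emeasure_jordan_pos[OF s, of A] unfolding emeasure_eq_measure
    by (auto intro!: antisym SUP_least SUP_upper2[of A])
qed (simp add: sets)

lemma jordan_pos_nonpos:
  assumes "signed_measure M \<sigma>" "\<And>A. \<sigma> A \<le> 0" shows "jordan_pos M \<sigma> = null_measure M"
proof (rule measure_eqI)
  fix A assume A: "A \<in> sets (jordan_pos M \<sigma>)"
  then have "emeasure (jordan_pos M \<sigma>) A \<le> 0"
    unfolding emeasure_jordan_pos[OF assms(1) A[unfolded sets_jordan_pos]]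
    by (intro SUP_least) (simp add: ennreal_neg assms(2))
  then show "emeasure (jordan_pos M \<sigma>) A = emeasure (null_measure M) A" by simp
qed simp

lemma jordan_pos_complex_measure_of:
  "jordan_pos M (\<lambda>A. Re (complex_measure_of \<mu> A)) = \<mu>"
  "jordan_pos M (\<lambda>A. - Re (complex_measure_of \<mu> A)) = null_measure M"
  "jordan_pos M (\<lambda>A. Im (complex_measure_of \<mu> A)) = null_measure M"
  "jordan_pos M (\<lambda>A. - Im (complex_measure_of \<mu> A)) = null_measure M"
  using jordan_pos_measure signed_measures[OF complex_measure_of]
  by (auto simp: complex_measure_of_def intro!: jordan_pos_nonpos)

lemma complex_measure_integral_of: "complex_measure_integral M (complex_measure_of \<mu>) f = (\<integral>x. f x \<partial>\<mu>)"
  unfolding complex_measure_integral_def jordan_pos_complex_measure_of by simp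

lemma variation_complex_measure_of: "variation M (complex_measure_of \<mu>) = \<mu>"
proof (rule measure_eqI)
  fix A assume "A \<in> sets (variation M (complex_measure_of \<mu>))"
  then show "emeasure (variation M (complex_measure_of \<mu>)) A = emeasure \<mu> A"
    by (simp add: emeasure_variation jordan_pos_complex_measure_of)
qed (simp add: sets)

end

section \<open>Energy of measures on the sphere through their moments\<close>

section \<open>Energy forms\<close>

text \<open>Recovers Cauchy-Schwarz from weighted arithmetic-geometric inequalities, which can be
  summed over degrees term by term. The optimal \<open>s\<close> is the ratio of the roots; when one
  of them is 0, a special \<open>s\<close> contradicts \<open>v > 0\<close>.\<close>

lemma le_sqrt_mult_sqrtI:
  fixes A B v :: real
  assumes "0 \<le> A" "0 \<le> B" "\<And>s. 0 < s \<Longrightarrow> 2 * v \<le> s * A + B / s"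
  shows "v \<le> sqrt A * sqrt B"
proof (cases "A = 0 \<or> B = 0")
  case True
  have "v \<le> 0"
  proof (rule ccontr)
    assume "\<not> v \<le> 0"
    then have v: "0 < v" by simp
    show False
    proof (cases "A = 0")
      case True
      then have "2 * v * (B + 1) \<le> B * v" using assms(3)[of "(B + 1) / v"] v assms(2) by (simp add: field_simps)
      moreover have "0 \<le> B * v" using v assms(2) by simp
      ultimately show False using v by (simp add: algebra_simps)
    next
      case False
      then have "B = 0" "0 < A" using True assms(1) by auto
      then show False using assms(3)[of "v / A"] v by simp
    qed
  qed
  then show ?thesis using assms(1,2) by (simp add: order_trans)
next
  case False
  then have p: "0 < sqrt A" "0 < sqrt B" using assms by auto
  have "2 * v \<le> sqrt B / sqrt A * A + B / (sqrt B / sqrt A)" using p by (intro assms(3)) simp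
  also have "sqrt B / sqrt A * A = sqrt A * sqrt B" using assms(1) p by (simp add: field_simps)
  also have "B / (sqrt B / sqrt A) = sqrt A * sqrt B" using assms(2) p by (simp add: field_simps)
  finally show ?thesis by simp
qed

lemma word_sq_add:
  "word_sq n (\<lambda>xs. x xs + of_real s * y xs) = word_sq n x + 2 * s * Re (word_inner n x y) + s\<^sup>2 * word_sq n y"
proof -
  have "(cmod (x xs + of_real s * y xs))\<^sup>2 =
      (cmod (x xs))\<^sup>2 + 2 * s * Re (x xs * cnj (y xs)) + s\<^sup>2 * (cmod (y xs))\<^sup>2" for xs
    unfolding cmod_power2 by (simp add: power2_eq_square algebra_simps)
  then show ?thesis
    unfolding word_sq_def word_inner_def Re_sum sum_distrib_left sum.distrib[symmetric]
    by (intro sum.cong refl)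
qed

context ball_kernel
begin

text \<open>For moment families this is the mutual energy, the double integral of
  \<open>K z (r *\<^sub>R w)\<close>; \<open>wsq\<close> is its quadratic form.\<close>

definition wform :: "real \<Rightarrow> ('d list \<Rightarrow> complex) \<Rightarrow> ('d list \<Rightarrow> complex) \<Rightarrow> complex"
  where "wform r x y = (\<Sum>n. of_real (a n) * (of_real (r ^ n) * word_inner n x y))"

definition wsq :: "real \<Rightarrow> ('d list \<Rightarrow> complex) \<Rightarrow> real"
  where "wsq r x = (\<Sum>n. a n * (r ^ n * word_sq n x))"

text \<open>Moments of integrable densities satisfy this, and it makes all energy series converge
  for \<open>r < 1\<close>.\<close>

definition wbounded :: "('d list \<Rightarrow> complex) \<Rightarrow> bool"
  where "wbounded x \<longleftrightarrow> (\<exists>C. \<forall>n. word_sq n x \<le> C)"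

lemma wsq_sums:
  assumes "wbounded x" "0 \<le> r" "r < 1"
  shows "(\<lambda>n. a n * (r ^ n * word_sq n x)) sums wsq r x"
proof -
  obtain C where C: "\<And>n. word_sq n x \<le> C" using assms(1) unfolding wbounded_def by blast
  have "summable (\<lambda>n. a n * (r ^ n * word_sq n x))"
  proof (rule summable_comparison_test')
    show "summable (\<lambda>n. (a n * r ^ n) * C)" using assms by (intro summable_mult2 summable_a)
    show "norm (a n * (r ^ n * word_sq n x)) \<le> (a n * r ^ n) * C" for n
      using C[of n] a_pos[of n] assms(2) word_sq_nonneg[of n x]
      by (simp add: abs_mult less_imp_le mult.assoc mult_left_mono)
  qed
  then show ?thesis unfolding wsq_def by (rule summable_sums)
qed

lemma wsq_nonneg: "wbounded x \<Longrightarrow> 0 \<le> r \<Longrightarrow> r < 1 \<Longrightarrow> 0 \<le> wsq r x"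
  using a_pos word_sq_nonneg
  by (intro sums_le[OF _ sums_zero wsq_sums]) (auto intro!: mult_nonneg_nonneg simp: less_imp_le)

lemma wsq_mono: assumes "wbounded x" "0 \<le> r" "r \<le> s" "s < 1" shows "wsq r x \<le> wsq s x"
  using assms a_pos word_sq_nonneg
  by (intro sums_le[OF _ wsq_sums wsq_sums])
    (auto intro!: mult_left_mono mult_right_mono power_mono simp: less_imp_le)

lemma wsq_le_kval: assumes "\<And>n. word_sq n x \<le> 1" "0 \<le> r" "r < 1" shows "wsq r x \<le> kval r"
proof -
  have x: "wbounded x" using assms(1) unfolding wbounded_def by blast
  have k: "(\<lambda>n. a n * r ^ n) sums kval r"
    unfolding kval_def using assms by (intro summable_sums summable_a)
  have "a n * (r ^ n * word_sq n x) \<le> a n * r ^ n" for n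
    using assms a_pos[of n] by (simp add: mult_left_le)
  then show ?thesis by (rule sums_le[OF _ wsq_sums[OF x assms(2,3)] k])
qed

lemma two_cmod_word_inner_le:
  assumes "0 < s" shows "2 * cmod (word_inner n x y) \<le> s * word_sq n x + word_sq n y / s"
proof -
  have "2 * cmod (word_inner n x y) \<le> 2 * (sqrt (s * word_sq n x) * sqrt (word_sq n y / s))"
    using cmod_word_inner_le[of n x y] assms by (simp add: real_sqrt_mult[symmetric])
  also have "\<dots> \<le> s * word_sq n x + word_sq n y / s"
    using sum_squares_bound[of "sqrt (s * word_sq n x)" "sqrt (word_sq n y / s)"] assms word_sq_nonneg[of n x]
      word_sq_nonneg[of n y] by simp
  finally show ?thesis .
qed

lemma wform_sums:
  assumes "wbounded x" "wbounded y" "0 \<le> r" "r < 1"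
  shows "(\<lambda>n. of_real (a n) * (of_real (r ^ n) * word_inner n x y)) sums wform r x y"
    and "summable (\<lambda>n. cmod (of_real (a n) * (of_real (r ^ n) * word_inner n x y)))"
    and "0 < s \<Longrightarrow> 2 * cmod (wform r x y) \<le> s * wsq r x + wsq r y / s"
proof -
  have le: "cmod (of_real (a n) * (of_real (r ^ n) * word_inner n x y)) \<le>
      (s * (a n * (r ^ n * word_sq n x)) + a n * (r ^ n * word_sq n y) / s) / 2" if "0 < s" for n s
  proof -
    have "cmod (of_real (a n) * (of_real (r ^ n) * word_inner n x y)) = (a n * r ^ n) * cmod (word_inner n x y)"
      using a_pos[of n] assms(3) by (simp add: norm_mult norm_power)
    also have "\<dots> \<le> (a n * r ^ n) * ((s * word_sq n x + word_sq n y / s) / 2)"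
      using two_cmod_word_inner_le[OF that, of n x y] a_pos[of n] assms(3)
      by (intro mult_left_mono) (auto simp: less_imp_le)
    finally show ?thesis by (simp add: algebra_simps add_divide_distrib)
  qed
  have S: "(\<lambda>n. (s * (a n * (r ^ n * word_sq n x)) + a n * (r ^ n * word_sq n y) / s) / 2) sums
      ((s * wsq r x + wsq r y / s) / 2)" for s
    using assms by (intro sums_divide sums_add sums_mult wsq_sums)
  show sm: "summable (\<lambda>n. cmod (of_real (a n) * (of_real (r ^ n) * word_inner n x y)))"
    by (rule summable_comparison_test'[OF sums_summable[OF S[of 1]], of 0]) (use le[of 1] in simp)
  show "(\<lambda>n. of_real (a n) * (of_real (r ^ n) * word_inner n x y)) sums wform r x y"
    unfolding wform_def by (rule summable_sums[OF summable_norm_cancel[OF sm]])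
  show "2 * cmod (wform r x y) \<le> s * wsq r x + wsq r y / s" if "0 < s"
  proof -
    have "cmod (wform r x y) \<le> (s * wsq r x + wsq r y / s) / 2"
      unfolding wform_def by (rule order_trans[OF summable_norm[OF sm] sums_le[OF le[OF that] summable_sums[OF sm] S]])
    then show ?thesis by simp
  qed
qed

lemma cmod_wform_le:
  assumes "wbounded x" "wbounded y" "0 \<le> r" "r < 1"
  shows "cmod (wform r x y) \<le> sqrt (wsq r x) * sqrt (wsq r y)"
  using assms by (intro le_sqrt_mult_sqrtI wsq_nonneg wform_sums(3))

lemma wbounded_add:
  assumes "wbounded x" "wbounded y" shows "wbounded (\<lambda>xs. x xs + of_real s * y xs)"
proof -
  obtain C D where C: "\<And>n. word_sq n x \<le> C" and D: "\<And>n. word_sq n y \<le> D"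
    using assms unfolding wbounded_def by blast
  have "word_sq n (\<lambda>xs. x xs + of_real s * y xs) \<le> 2 * C + 2 * s\<^sup>2 * D" for n
  proof -
    have "word_sq n (\<lambda>xs. x xs + of_real s * y xs) + word_sq n (\<lambda>xs. x xs + of_real (- s) * y xs) =
        2 * word_sq n x + 2 * s\<^sup>2 * word_sq n y"
      unfolding word_sq_add by simp
    moreover have "s\<^sup>2 * word_sq n y \<le> s\<^sup>2 * D" using D by (intro mult_left_mono) auto
    ultimately show ?thesis using C[of n] word_sq_nonneg[of n "\<lambda>xs. x xs + of_real (- s) * y xs"] by simp
  qed
  then show ?thesis unfolding wbounded_def by blast
qed

lemma wsq_add:
  assumes "wbounded x" "wbounded y" "0 \<le> r" "r < 1"
  shows "wsq r (\<lambda>xs. x xs + of_real s * y xs) = wsq r x + 2 * s * Re (wform r x y) + s\<^sup>2 * wsq r y"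
proof -
  have "(\<lambda>n. a n * (r ^ n * word_sq n x) + 2 * s * Re (of_real (a n) * (of_real (r ^ n) * word_inner n x y)) +
      s\<^sup>2 * (a n * (r ^ n * word_sq n y))) sums (wsq r x + 2 * s * Re (wform r x y) + s\<^sup>2 * wsq r y)"
    using assms by (intro sums_add sums_mult wsq_sums sums_Re wform_sums)
  moreover have "a n * (r ^ n * word_sq n x) + 2 * s * Re (of_real (a n) * (of_real (r ^ n) * word_inner n x y)) +
      s\<^sup>2 * (a n * (r ^ n * word_sq n y)) = a n * (r ^ n * word_sq n (\<lambda>xs. x xs + of_real s * y xs))" for n
    unfolding word_sq_add of_real_mult[symmetric] by (simp add: algebra_simps del: of_real_power)
  ultimately show ?thesis
    using wsq_sums[OF wbounded_add[OF assms(1,2)] assms(3,4), of s] sums_unique2 by simp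
qed

lemma wform_self: assumes "wbounded x" "0 \<le> r" "r < 1" shows "wform r x x = of_real (wsq r x)"
proof -
  have "(\<lambda>n. complex_of_real (a n * (r ^ n * word_sq n x))) sums of_real (wsq r x)"
    using assms by (intro sums_of_real wsq_sums)
  then show ?thesis using wform_sums(1)[OF assms(1,1,2,3)] sums_unique2 by (fastforce simp: word_inner_self)
qed

lemma wform_cnj: assumes "wbounded x" "wbounded y" "0 \<le> r" "r < 1" shows "wform r y x = cnj (wform r x y)"
proof -
  have "(\<lambda>n. cnj (of_real (a n) * (of_real (r ^ n) * word_inner n x y))) sums cnj (wform r x y)"
    using wform_sums(1)[OF assms] by (simp only: sums_cnj)
  moreover have "cnj (word_inner n x y) = word_inner n y x" for n
    by (simp add: word_inner_def mult.commute)
  ultimately show ?thesis using wform_sums(1)[OF assms(2,1,3,4)] sums_unique2 by fastforce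
qed

lemma potential_eq_wform: "potential r y z = wform r (mon z) y"
  by (simp add: potential_def wform_def)

lemma word_sq_mon_le: "norm z \<le> 1 \<Longrightarrow> word_sq n (mon z) \<le> 1"
  by (simp add: word_sq_mon power_le_one)

lemma wbounded_mon: "norm z \<le> 1 \<Longrightarrow> wbounded (mon z)"
  unfolding wbounded_def using word_sq_mon_le by blast

lemma K_eq_wform:
  assumes "norm z \<le> 1" "norm w \<le> 1" "0 \<le> r" "r < 1"
  shows "K z (r *\<^sub>R w) = wform r (mon z) (mon w)"
  unfolding ui_kernel_def wform_def
  by (simp add: hermitian_inner_scaleR power_mult_distrib hermitian_inner_power)

end

section \<open>Measures on the sphere\<close>

definition moment :: "(complex ^ 'd) measure \<Rightarrow> (complex ^ 'd \<Rightarrow> real) \<Rightarrow> 'd list \<Rightarrow> complex"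
  where "moment \<mu> u xs = (\<integral>w. mon w xs * of_real (u w) \<partial>\<mu>)"

locale sphere_measure = ball_kernel a B + finite_measure \<mu>
  for a :: "nat \<Rightarrow> real" and B :: "(complex ^ 'd) set" and \<mu> :: "(complex ^ 'd) measure" +
  assumes sets_eq: "sets \<mu> = sets sphere_borel"
begin

lemma space_eq: "space \<mu> = sphere 0 1"
  using sets_eq_imp_space_eq[OF sets_eq] by (simp add: space_restrict_space)

lemma measurable_continuous: "continuous_on UNIV f \<Longrightarrow> f \<in> borel_measurable \<mu>"
  for f :: "complex ^ 'd \<Rightarrow> 'b :: topological_space"
  using borel_measurable_continuous_onI measurable_restrict_space1
  by (metis measurable_cong_sets sets_eq)

lemma measurable_mon [measurable]: "(\<lambda>w. mon w xs) \<in> borel_measurable \<mu>"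
  by (intro measurable_continuous continuous_on_mon)

lemma measurable_word_inner [measurable]: "(\<lambda>w. word_inner n (mon w) y) \<in> borel_measurable \<mu>"
  unfolding word_inner_def by measurable

lemma measurable_potential [measurable]: "(\<lambda>w. potential r y w) \<in> borel_measurable \<mu>"
  unfolding potential_def by measurable

lemma cmod_mon_le: "norm z \<le> 1 \<Longrightarrow> cmod (mon z xs) \<le> 1"
  unfolding mon_def
proof (induction xs)
  case (Cons i xs)
  have "cmod (z $ i) \<le> 1" using Finite_Cartesian_Product.norm_nth_le[of z i] Cons.prems by simp
  then show ?case using Cons by (simp add: norm_mult mult_le_one)
qed simp

lemma integrable_bounded_mult:
  fixes f :: "complex ^ 'd \<Rightarrow> complex"
  assumes "f \<in> borel_measurable \<mu>" "\<And>w. norm w = 1 \<Longrightarrow> cmod (f w) \<le> C" "integrable \<mu> u"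
  shows "integrable \<mu> (\<lambda>w. f w * of_real (u w))"
proof (rule Bochner_Integration.integrable_bound)
  show "integrable \<mu> (\<lambda>w. C * u w)" using assms(3) by simp
  show "(\<lambda>w. f w * of_real (u w)) \<in> borel_measurable \<mu>" using assms(1,3) by measurable
  show "AE w in \<mu>. norm (f w * of_real (u w)) \<le> norm (C * u w)"
  proof (rule AE_I2)
    fix w assume "w \<in> space \<mu>"
    then have "cmod (f w) \<le> \<bar>C\<bar>" using assms(2)[of w] by (auto simp: space_eq)
    then show "norm (f w * of_real (u w)) \<le> norm (C * u w)" by (simp add: norm_mult abs_mult mult_right_mono)
  qed
qed

lemma integrable_mon: "integrable \<mu> u \<Longrightarrow> integrable \<mu> (\<lambda>w. mon w xs * of_real (u w))"
  by (rule integrable_bounded_mult[of _ 1]) (auto intro: cmod_mon_le)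

lemma word_inner_moment:
  assumes "integrable \<mu> u"
  shows "word_inner n (moment \<mu> u) y = (\<integral>w. word_inner n (mon w) y * of_real (u w) \<partial>\<mu>)"
proof -
  have "(\<integral>w. word_inner n (mon w) y * of_real (u w) \<partial>\<mu>) =
      (\<integral>w. (\<Sum>xs\<in>words n. cnj (y xs) * (mon w xs * of_real (u w))) \<partial>\<mu>)"
    unfolding word_inner_def sum_distrib_right by (simp add: mult_ac)
  also have "\<dots> = (\<Sum>xs\<in>words n. \<integral>w. cnj (y xs) * (mon w xs * of_real (u w)) \<partial>\<mu>)"
    using integrable_mon[OF assms] by (intro Bochner_Integration.integral_sum) simp
  also have "\<dots> = (\<Sum>xs\<in>words n. cnj (y xs) * moment \<mu> u xs)"
    unfolding moment_def by (simp only: integral_mult_right_zero)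
  finally show ?thesis by (simp add: word_inner_def mult.commute)
qed

lemma cmod_word_inner_mon_le: assumes "norm w = 1" shows "cmod (word_inner n (mon w) y) \<le> sqrt (word_sq n y)"
  using cmod_word_inner_le[of n "mon w" y] assms by (simp add: word_sq_mon)

lemma norm_integral_le:
  fixes f :: "complex ^ 'd \<Rightarrow> complex"
  assumes "f \<in> borel_measurable \<mu>" "\<And>w. norm w = 1 \<Longrightarrow> cmod (f w) \<le> C" "integrable \<mu> u"
  shows "cmod (\<integral>w. f w * of_real (u w) \<partial>\<mu>) \<le> C * (\<integral>w. \<bar>u w\<bar> \<partial>\<mu>)"
proof -
  have i: "integrable \<mu> (\<lambda>w. f w * of_real (u w))" by (rule integrable_bounded_mult[OF assms])
  have "cmod (\<integral>w. f w * of_real (u w) \<partial>\<mu>) \<le> (\<integral>w. cmod (f w * of_real (u w)) \<partial>\<mu>)"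
    by (rule integral_norm_bound)
  also have "\<dots> \<le> (\<integral>w. C * \<bar>u w\<bar> \<partial>\<mu>)"
    using i assms by (intro integral_mono integrable_norm) (auto simp: norm_mult space_eq intro!: mult_right_mono)
  finally show ?thesis by simp
qed

text \<open>Duality: pairing the moments with themselves turns the square into an integral of
  \<open>word_inner n (mon w) y\<close>, whose modulus is at most the norm of \<open>y\<close> since
  \<open>mon w\<close> has norm 1 on the sphere. One factor cancels.\<close>

lemma word_sq_moment_le:
  assumes u: "integrable \<mu> u" shows "word_sq n (moment \<mu> u) \<le> (\<integral>w. \<bar>u w\<bar> \<partial>\<mu>)\<^sup>2"
proof -
  let ?y = "moment \<mu> u"
  have "word_sq n ?y = cmod (word_inner n ?y ?y)" by (simp add: word_inner_self word_sq_nonneg)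
  also have "\<dots> \<le> sqrt (word_sq n ?y) * (\<integral>w. \<bar>u w\<bar> \<partial>\<mu>)"
    unfolding word_inner_moment[OF u] by (intro norm_integral_le cmod_word_inner_mon_le u) auto
  finally have "sqrt (word_sq n ?y) * sqrt (word_sq n ?y) \<le> sqrt (word_sq n ?y) * (\<integral>w. \<bar>u w\<bar> \<partial>\<mu>)"
    using word_sq_nonneg[of n ?y] by simp
  then have "sqrt (word_sq n ?y) \<le> (\<integral>w. \<bar>u w\<bar> \<partial>\<mu>)"
    using word_sq_nonneg[of n ?y]
    by (cases "word_sq n ?y = 0") (simp, metis less_eq_real_def mult_le_cancel_left_pos real_sqrt_gt_zero)
  then have "(sqrt (word_sq n ?y))\<^sup>2 \<le> (\<integral>w. \<bar>u w\<bar> \<partial>\<mu>)\<^sup>2"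
    using word_sq_nonneg[of n ?y] by (intro power_mono) auto
  then show ?thesis using word_sq_nonneg[of n ?y] by simp
qed

lemma wbounded_moment: "integrable \<mu> u \<Longrightarrow> wbounded (moment \<mu> u)"
  unfolding wbounded_def using word_sq_moment_le by blast

lemma moment_add:
  assumes "integrable \<mu> u" "integrable \<mu> v"
  shows "moment \<mu> (\<lambda>w. u w + s * v w) = (\<lambda>xs. moment \<mu> u xs + of_real s * moment \<mu> v xs)"
proof
  fix xs
  have "moment \<mu> (\<lambda>w. u w + s * v w) xs =
      (\<integral>w. mon w xs * of_real (u w) + of_real s * (mon w xs * of_real (v w)) \<partial>\<mu>)"
    unfolding moment_def by (simp add: algebra_simps)
  also have "\<dots> = moment \<mu> u xs + (\<integral>w. of_real s * (mon w xs * of_real (v w)) \<partial>\<mu>)"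
    unfolding moment_def using integrable_mon assms by (intro Bochner_Integration.integral_add) auto
  finally show "moment \<mu> (\<lambda>w. u w + s * v w) xs = moment \<mu> u xs + of_real s * moment \<mu> v xs"
    unfolding moment_def by (simp only: integral_mult_right_zero)
qed

text \<open>Series and integral are interchanged: the terms are dominated by
  \<open>a n * r ^ n\<close> times a constant, which is summable because
  \<open>r < 1\<close>.\<close>

lemma wform_moment:
  assumes u: "integrable \<mu> u" and y: "wbounded y" and r: "0 \<le> r" "r < 1"
  shows "(\<integral>w. wform r (mon w) y * of_real (u w) \<partial>\<mu>) = wform r (moment \<mu> u) y"
    and "integrable \<mu> (\<lambda>w. wform r (mon w) y * of_real (u w))"
proof -
  obtain C where C: "\<And>n. word_sq n y \<le> C" using y unfolding wbounded_def by blast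
  define f where "f n w = of_real (a n) * (of_real (r ^ n) * word_inner n (mon w) y) * of_real (u w)" for n w
  have b: "cmod (of_real (a n) * (of_real (r ^ n) * word_inner n (mon w) y)) \<le> a n * r ^ n * sqrt C"
    if w: "norm w = 1" for n w
  proof -
    have "cmod (word_inner n (mon w) y) \<le> sqrt C"
      using cmod_word_inner_mon_le[OF w] real_sqrt_le_mono[OF C[of n]] by (rule order_trans)
    then show ?thesis using a_pos[of n] r by (simp add: norm_mult norm_power mult.assoc mult_left_mono)
  qed
  have fi: "integrable \<mu> (f n)" for n
    unfolding f_def by (rule integrable_bounded_mult[OF _ b u]) auto
  have sums: "(\<lambda>n. f n w) sums (wform r (mon w) y * of_real (u w))" if "norm w = 1" for w
    unfolding f_def using that y r by (intro sums_mult2 wform_sums wbounded_mon) auto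
  have sn: "summable (\<lambda>n. norm (f n w))" if "norm w = 1" for w
    unfolding f_def norm_mult[of _ "of_real (u w)"] using that y r
    by (intro summable_mult2 wform_sums(2) wbounded_mon) auto
  have AEs: "AE w in \<mu>. summable (\<lambda>n. norm (f n w))" using sn by (intro AE_I2) (auto simp: space_eq)
  have si: "summable (\<lambda>n. \<integral>w. norm (f n w) \<partial>\<mu>)"
  proof (rule summable_comparison_test')
    show "summable (\<lambda>n. (a n * r ^ n) * (sqrt C * (\<integral>w. \<bar>u w\<bar> \<partial>\<mu>)))" using r by (intro summable_mult2 summable_a)
    fix n
    have "(\<integral>w. norm (f n w) \<partial>\<mu>) \<le> (\<integral>w. (a n * r ^ n * sqrt C) * \<bar>u w\<bar> \<partial>\<mu>)"
      using fi u b unfolding f_def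
      by (intro integral_mono integrable_norm) (auto simp: space_eq norm_mult[of _ "of_real _"] intro!: mult_right_mono)
    then show "norm (\<integral>w. norm (f n w) \<partial>\<mu>) \<le> (a n * r ^ n) * (sqrt C * (\<integral>w. \<bar>u w\<bar> \<partial>\<mu>))"
      by (simp add: mult.assoc)
  qed
  have eq: "(\<Sum>n. f n w) = wform r (mon w) y * of_real (u w)" if "w \<in> space \<mu>" for w
    using sums_unique[OF sums] that by (simp add: space_eq)
  have "(\<integral>w. wform r (mon w) y * of_real (u w) \<partial>\<mu>) = (\<integral>w. (\<Sum>n. f n w) \<partial>\<mu>)"
    by (rule Bochner_Integration.integral_cong) (simp_all add: eq)
  also have "\<dots> = (\<Sum>n. \<integral>w. f n w \<partial>\<mu>)" by (rule integral_suminf[OF fi AEs si])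
  also have "\<dots> = wform r (moment \<mu> u) y"
    unfolding wform_def f_def word_inner_moment[OF u] mult.assoc by (simp only: integral_mult_right_zero)
  finally show "(\<integral>w. wform r (mon w) y * of_real (u w) \<partial>\<mu>) = wform r (moment \<mu> u) y" .
  have "integrable \<mu> (\<lambda>w. \<Sum>n. f n w)" by (rule integrable_suminf[OF fi AEs si])
  then show "integrable \<mu> (\<lambda>w. wform r (mon w) y * of_real (u w))"
    by (subst (asm) Bochner_Integration.integrable_cong[OF refl eq])
qed

lemma potential_eq_integral:
  assumes u: "integrable \<mu> u" and r: "0 \<le> r" "r < 1" and z: "norm z \<le> 1"
  shows "potential r (moment \<mu> u) z = (\<integral>w. K z (r *\<^sub>R w) * of_real (u w) \<partial>\<mu>)"
    and "integrable \<mu> (\<lambda>w. K z (r *\<^sub>R w) * of_real (u w))"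
proof -
  note wb = wbounded_mon[OF z]
  have K: "K z (r *\<^sub>R w) * of_real (u w) = cnj (wform r (mon w) (mon z) * of_real (u w))" if "w \<in> space \<mu>" for w
    using wform_cnj[OF _ wb r, of "mon w"] wbounded_mon[of w] K_eq_wform[OF z _ r, of w] that by (simp add: space_eq)
  have "(\<integral>w. K z (r *\<^sub>R w) * of_real (u w) \<partial>\<mu>) = (\<integral>w. cnj (wform r (mon w) (mon z) * of_real (u w)) \<partial>\<mu>)"
    by (rule Bochner_Integration.integral_cong[OF refl K])
  also have "\<dots> = cnj (wform r (moment \<mu> u) (mon z))" by (simp only: Bochner_Integration.integral_cnj wform_moment(1)[OF u wb r])
  also have "\<dots> = potential r (moment \<mu> u) z"
    using wform_cnj[OF wbounded_moment[OF u] wb r] by (simp add: potential_eq_wform)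
  finally show "potential r (moment \<mu> u) z = (\<integral>w. K z (r *\<^sub>R w) * of_real (u w) \<partial>\<mu>)" ..
  have "integrable \<mu> (\<lambda>w. cnj (wform r (mon w) (mon z) * of_real (u w)))"
    using wform_moment(2)[OF u wb r] by (simp only: integrable_cnj)
  then show "integrable \<mu> (\<lambda>w. K z (r *\<^sub>R w) * of_real (u w))"
    by (subst (asm) Bochner_Integration.integrable_cong[OF refl K[symmetric]])
qed

text \<open>Scaling both arguments by \<open>r\<close> puts the factor \<open>r^2\<close> on the
  hermitian product, so the energy at radius \<open>r\<close> is the form at level
  \<open>r^2\<close>.\<close>

lemma energy_eq: "energy a \<mu> = (SUP r\<in>{0..<1}. ennreal (wsq (r\<^sup>2) (moment \<mu> (\<lambda>_. 1))))"
  unfolding energy_def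
proof (intro SUP_cong refl)
  fix r :: real assume r: "r \<in> {0..<1}"
  then have r2: "0 \<le> r\<^sup>2" "r\<^sup>2 < 1" by (auto simp: power_less_one_iff abs_square_less_1)
  have one: "integrable \<mu> (\<lambda>_. 1 :: real)" by simp
  have "ui_kernel a (r *\<^sub>R z) (r *\<^sub>R w) = K z (r\<^sup>2 *\<^sub>R w)" for z w
    by (simp add: ui_kernel_def hermitian_inner_scaleR power2_eq_square mult.assoc)
  then have "(\<integral>z. (\<integral>w. ui_kernel a (r *\<^sub>R z) (r *\<^sub>R w) \<partial>\<mu>) \<partial>\<mu>) = (\<integral>z. potential (r\<^sup>2) (moment \<mu> (\<lambda>_. 1)) z \<partial>\<mu>)"
    using potential_eq_integral(1)[OF one r2] by (intro Bochner_Integration.integral_cong refl) (simp add: space_eq)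
  also have "\<dots> = wform (r\<^sup>2) (moment \<mu> (\<lambda>_. 1)) (moment \<mu> (\<lambda>_. 1))"
    using wform_moment(1)[OF one wbounded_moment[OF one] r2] by (simp add: potential_eq_wform)
  also have "\<dots> = of_real (wsq (r\<^sup>2) (moment \<mu> (\<lambda>_. 1)))" by (rule wform_self[OF wbounded_moment[OF one] r2])
  finally show "ennreal (Re (\<integral>z. (\<integral>w. ui_kernel a (r *\<^sub>R z) (r *\<^sub>R w) \<partial>\<mu>) \<partial>\<mu>)) =
      ennreal (wsq (r\<^sup>2) (moment \<mu> (\<lambda>_. 1)))" by simp
qed

lemma finite_energy_iff:
  "energy a \<mu> < \<infinity> \<longleftrightarrow> (\<exists>C. \<forall>t\<ge>0. t < 1 \<longrightarrow> wsq t (moment \<mu> (\<lambda>_. 1)) \<le> C)"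
proof
  assume "energy a \<mu> < \<infinity>"
  then obtain C where C: "energy a \<mu> = ennreal C" "0 \<le> C" by (cases "energy a \<mu>") auto
  have "wsq t (moment \<mu> (\<lambda>_. 1)) \<le> C" if t: "0 \<le> t" "t < 1" for t
  proof -
    have "ennreal (wsq ((sqrt t)\<^sup>2) (moment \<mu> (\<lambda>_. 1))) \<le> energy a \<mu>"
      unfolding energy_eq using t by (intro SUP_upper) auto
    then show ?thesis using C t by (simp add: ennreal_le_iff)
  qed
  then show "\<exists>C. \<forall>t\<ge>0. t < 1 \<longrightarrow> wsq t (moment \<mu> (\<lambda>_. 1)) \<le> C" by blast
next
  assume "\<exists>C. \<forall>t\<ge>0. t < 1 \<longrightarrow> wsq t (moment \<mu> (\<lambda>_. 1)) \<le> C"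
  then obtain C where C: "\<And>t. 0 \<le> t \<Longrightarrow> t < 1 \<Longrightarrow> wsq t (moment \<mu> (\<lambda>_. 1)) \<le> C" by blast
  have "energy a \<mu> \<le> ennreal C"
    unfolding energy_eq by (intro SUP_least ennreal_leI C) (auto simp: power_less_one_iff abs_square_less_1)
  then show "energy a \<mu> < \<infinity>" by (simp add: order_le_less_trans)
qed

end

section \<open>Variational construction of densities with large potential\<close>

section \<open>Minimising the energy\<close>

context sphere_measure
begin

text \<open>Boundedness makes products and squares integrable, and nonnegativity is asked at every
  point. The infimum over this class may fail to be attained; near-minimisers are used
  throughout.\<close>

definition densities :: "(complex ^ 'd \<Rightarrow> real) set"
  where "densities = {u. u \<in> borel_measurable \<mu> \<and> (\<forall>w. 0 \<le> u w) \<and> (\<exists>C. \<forall>w. u w \<le> C) \<and> (\<integral>w. u w \<partial>\<mu>) = 1}"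

text \<open>The square term makes \<open>penalised r\<close> uniformly convex in \<open>L\<^sup>2\<close>, and its minimisers are
  densities with respect to \<open>\<mu>\<close>.\<close>

definition penalised :: "real \<Rightarrow> (complex ^ 'd \<Rightarrow> real) \<Rightarrow> real"
  where "penalised r u = wsq r (moment \<mu> u) + (\<integral>w. (u w)\<^sup>2 \<partial>\<mu>)"

definition bounded_fun :: "(complex ^ 'd \<Rightarrow> real) \<Rightarrow> bool"
  where "bounded_fun u \<longleftrightarrow> u \<in> borel_measurable \<mu> \<and> (\<exists>C. \<forall>w. \<bar>u w\<bar> \<le> C)"

lemma bounded_fun_integrable: "bounded_fun u \<Longrightarrow> integrable \<mu> u"
  unfolding bounded_fun_def by (elim conjE exE) (auto intro!: integrable_const_bound AE_I2)

lemma bounded_fun_mult: assumes "bounded_fun u" "bounded_fun v" shows "bounded_fun (\<lambda>w. u w * v w)"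
proof -
  obtain C D where "\<And>w. \<bar>u w\<bar> \<le> C" "\<And>w. \<bar>v w\<bar> \<le> D" using assms unfolding bounded_fun_def by blast
  then have "\<bar>u w * v w\<bar> \<le> C * D" for w
    unfolding abs_mult by (intro mult_mono) (auto intro: order_trans[OF abs_ge_zero])
  then show ?thesis using assms unfolding bounded_fun_def by auto
qed

lemma bounded_fun_add: assumes "bounded_fun u" "bounded_fun v" shows "bounded_fun (\<lambda>w. u w + s * v w)"
proof -
  obtain C D where CD: "\<And>w. \<bar>u w\<bar> \<le> C" "\<And>w. \<bar>v w\<bar> \<le> D" using assms unfolding bounded_fun_def by blast
  have "\<bar>u w + s * v w\<bar> \<le> C + \<bar>s\<bar> * D" for w
    using CD(1)[of w] mult_left_mono[OF CD(2)[of w], of "\<bar>s\<bar>"] abs_triangle_ineq[of "u w" "s * v w"]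
    by (simp add: abs_mult)
  then show ?thesis using assms unfolding bounded_fun_def by auto
qed

lemma bounded_fun_scale: assumes "bounded_fun u" shows "bounded_fun (\<lambda>w. s * u w)"
proof -
  have "bounded_fun (\<lambda>w. 0)" unfolding bounded_fun_def by auto
  from bounded_fun_add[OF this assms, of s] show ?thesis by simp
qed

lemma densities_bounded: "u \<in> densities \<Longrightarrow> bounded_fun u"
  unfolding densities_def bounded_fun_def by auto

lemma densities_integrable: "u \<in> densities \<Longrightarrow> integrable \<mu> u"
  using densities_bounded bounded_fun_integrable by blast

lemma word_sq_moment_le_1:
  assumes "integrable \<mu> u" "\<And>w. 0 \<le> u w" "(\<integral>w. u w \<partial>\<mu>) = 1" shows "word_sq n (moment \<mu> u) \<le> 1"
  using word_sq_moment_le[OF assms(1), of n] assms(2,3) by simp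

lemma penalised_add:
  assumes u: "bounded_fun u" and v: "bounded_fun v" and r: "0 \<le> r" "r < 1"
  shows "penalised r (\<lambda>w. u w + s * v w) = penalised r u +
    2 * s * (Re (wform r (moment \<mu> u) (moment \<mu> v)) + (\<integral>w. u w * v w \<partial>\<mu>)) + s\<^sup>2 * penalised r v"
proof -
  note iu = bounded_fun_integrable[OF u] and iv = bounded_fun_integrable[OF v]
  note i = bounded_fun_integrable[OF bounded_fun_mult[OF u u]] bounded_fun_integrable[OF bounded_fun_mult[OF u v]]
    bounded_fun_integrable[OF bounded_fun_mult[OF v v]]
  have "(\<integral>w. (u w + s * v w)\<^sup>2 \<partial>\<mu>) = (\<integral>w. u w * u w + (2 * s * (u w * v w) + s\<^sup>2 * (v w * v w)) \<partial>\<mu>)"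
    by (intro Bochner_Integration.integral_cong refl) (simp add: power2_eq_square algebra_simps)
  also have "\<dots> = (\<integral>w. u w * u w \<partial>\<mu>) + (2 * s * (\<integral>w. u w * v w \<partial>\<mu>) + s\<^sup>2 * (\<integral>w. v w * v w \<partial>\<mu>))"
    using i by simp
  finally have sq: "(\<integral>w. (u w + s * v w)\<^sup>2 \<partial>\<mu>) =
      (\<integral>w. (u w)\<^sup>2 \<partial>\<mu>) + 2 * s * (\<integral>w. u w * v w \<partial>\<mu>) + s\<^sup>2 * (\<integral>w. (v w)\<^sup>2 \<partial>\<mu>)"
    by (simp add: power2_eq_square)
  show ?thesis
    unfolding penalised_def sq moment_add[OF iu iv]
      wsq_add[OF wbounded_moment[OF iu] wbounded_moment[OF iv] r] by (simp add: algebra_simps)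
qed

lemma penalised_nonneg: "integrable \<mu> u \<Longrightarrow> 0 \<le> r \<Longrightarrow> r < 1 \<Longrightarrow> 0 \<le> penalised r u"
  unfolding penalised_def by (intro add_nonneg_nonneg wsq_nonneg wbounded_moment) auto

lemma penalised_mono: "integrable \<mu> u \<Longrightarrow> 0 \<le> r \<Longrightarrow> r \<le> s \<Longrightarrow> s < 1 \<Longrightarrow> penalised r u \<le> penalised s u"
  unfolding penalised_def by (intro add_right_mono wsq_mono wbounded_moment)

lemma densities_convex:
  assumes "u \<in> densities" "v \<in> densities" "0 \<le> t" "t \<le> 1"
  shows "(\<lambda>w. (1 - t) * u w + t * v w) \<in> densities"
proof -
  have "bounded_fun (\<lambda>w. (1 - t) * u w + t * v w)"
    using assms by (intro bounded_fun_add bounded_fun_scale densities_bounded)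
  then obtain C where "\<And>w. \<bar>(1 - t) * u w + t * v w\<bar> \<le> C"
    and m: "(\<lambda>w. (1 - t) * u w + t * v w) \<in> borel_measurable \<mu>" unfolding bounded_fun_def by blast
  then have "\<exists>C. \<forall>w. (1 - t) * u w + t * v w \<le> C" by (meson abs_le_D1)
  moreover have "(\<integral>w. (1 - t) * u w + t * v w \<partial>\<mu>) = (1 - t) * (\<integral>w. u w \<partial>\<mu>) + t * (\<integral>w. v w \<partial>\<mu>)"
    using assms densities_integrable by simp
  ultimately show ?thesis using assms m unfolding densities_def by auto
qed

text \<open>Parallelogram law: near-minimisers are close in \<open>L\<^sup>2\<close>.\<close>

lemma penalised_parallelogram:
  assumes u: "u \<in> densities" and v: "v \<in> densities" and r: "0 \<le> r" "r < 1"
    and I: "\<And>x. x \<in> densities \<Longrightarrow> I \<le> penalised r x"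
  shows "(\<integral>w. (u w - v w)\<^sup>2 \<partial>\<mu>) \<le> 2 * penalised r u + 2 * penalised r v - 4 * I"
proof -
  note bu = densities_bounded[OF u] and bv = densities_bounded[OF v]
  let ?m = "\<lambda>w. (1 - 1/2) * u w + (1/2) * v w"
  define c where "c = Re (wform r (moment \<mu> u) (moment \<mu> v)) + (\<integral>w. u w * v w \<partial>\<mu>)"
  have z: "bounded_fun (\<lambda>w. 0)" unfolding bounded_fun_def by auto
  have m0: "moment \<mu> (\<lambda>w. 0) = (\<lambda>xs. 0)" by (simp add: moment_def fun_eq_iff)
  have 0: "penalised r (\<lambda>w. 0) = 0" by (simp add: penalised_def m0 wsq_def word_sq_def)
  have sc: "penalised r (\<lambda>w. s * x w) = s\<^sup>2 * penalised r x" if "bounded_fun x" for x s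
    using penalised_add[OF z that r, of s] by (simp add: 0 m0 wform_def word_inner_def)
  have "(\<lambda>w. 1/2 * (u w + 1 * v w)) = ?m" by (auto simp: field_simps)
  then have "penalised r ?m = (1/2)\<^sup>2 * penalised r (\<lambda>w. u w + 1 * v w)"
    using sc[OF bounded_fun_add[OF bu bv, of 1], of "1/2"] by simp
  then have "4 * penalised r ?m = penalised r u + 2 * c + penalised r v"
    using penalised_add[OF bu bv r, of 1] by (simp add: power2_eq_square c_def)
  moreover have "I \<le> penalised r ?m" by (intro I densities_convex u v) auto
  moreover have "penalised r (\<lambda>w. u w + (-1) * v w) = penalised r u - 2 * c + penalised r v"
    unfolding penalised_add[OF bu bv r] c_def by simp
  moreover have "(\<integral>w. (u w - v w)\<^sup>2 \<partial>\<mu>) \<le> penalised r (\<lambda>w. u w + (-1) * v w)"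
    unfolding penalised_def using bounded_fun_integrable[OF bounded_fun_add[OF bu bv, of "-1"]] r
    by (simp add: wsq_nonneg wbounded_moment)
  ultimately show ?thesis by linarith
qed

text \<open>A subsequence converges almost everywhere, and Fatou's lemma turns the Cauchy condition
  into convergence in the mean.\<close>

lemma L1_limit:
  fixes u :: "nat \<Rightarrow> complex ^ 'd \<Rightarrow> real"
  assumes u: "\<And>n. integrable \<mu> (u n)" "\<And>n w. 0 \<le> u n w"
    and cau: "\<And>e. 0 < e \<Longrightarrow> \<exists>N. \<forall>i\<ge>N. \<forall>j\<ge>N. (\<integral>w. \<bar>u i w - u j w\<bar> \<partial>\<mu>) < e"
  obtains k v where "strict_mono (k :: nat \<Rightarrow> nat)" "integrable \<mu> v" "\<And>w. 0 \<le> v w"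
    "(\<lambda>i. \<integral>w. \<bar>u (k i) w - v w\<bar> \<partial>\<mu>) \<longlonglongrightarrow> 0"
proof -
  obtain k where k: "strict_mono k" and AEC: "AE w in \<mu>. Cauchy (\<lambda>i. u (k i) w)"
    using cauchy_L1_AE_cauchy_subseq[of \<mu> u] u(1) cau by (auto simp: real_norm_def)
  \<comment> \<open>\<open>lim\<close> is unspecified where the subsequence diverges; the maximum
    with 0 keeps \<open>v\<close> nonnegative at every point and changes nothing where it
    converges.\<close>
  define v where "v w = max 0 (lim (\<lambda>i. u (k i) w))" for w
  have um [measurable]: "u n \<in> borel_measurable \<mu>" for n using u(1) by auto
  have vm [measurable]: "v \<in> borel_measurable \<mu>" unfolding v_def by measurable
  have AEl: "AE w in \<mu>. (\<lambda>i. u (k i) w) \<longlonglongrightarrow> v w"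
    using AEC
  proof eventually_elim
    case (elim w)
    then have l: "(\<lambda>i. u (k i) w) \<longlonglongrightarrow> lim (\<lambda>i. u (k i) w)"
      using Cauchy_convergent convergent_LIMSEQ_iff by blast
    then have "0 \<le> lim (\<lambda>i. u (k i) w)" by (rule LIMSEQ_le_const) (use u(2) in auto)
    then show ?case using l by (simp add: v_def)
  qed
  have close: "(\<integral>\<^sup>+w. ennreal \<bar>u (k i) w - v w\<bar> \<partial>\<mu>) \<le> ennreal e"
    if N: "\<And>i j. N \<le> i \<Longrightarrow> N \<le> j \<Longrightarrow> (\<integral>w. \<bar>u i w - u j w\<bar> \<partial>\<mu>) < e" and i: "N \<le> i" for N e i
  proof -
    have ki: "n \<le> k n" for n using k by (rule strict_mono_imp_increasing)
    have "(\<integral>\<^sup>+w. ennreal \<bar>u (k i) w - v w\<bar> \<partial>\<mu>) =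
        (\<integral>\<^sup>+w. liminf (\<lambda>j. ennreal \<bar>u (k i) w - u (k j) w\<bar>) \<partial>\<mu>)"
    proof (rule nn_integral_cong_AE)
      show "AE w in \<mu>. ennreal \<bar>u (k i) w - v w\<bar> = liminf (\<lambda>j. ennreal \<bar>u (k i) w - u (k j) w\<bar>)"
        using AEl
      proof eventually_elim
        case (elim w)
        have "(\<lambda>j. ennreal \<bar>u (k i) w - u (k j) w\<bar>) \<longlonglongrightarrow> ennreal \<bar>u (k i) w - v w\<bar>"
          by (intro tendsto_ennrealI tendsto_intros elim)
        then show ?case by (rule lim_imp_Liminf[symmetric, rotated]) simp
      qed
    qed
    also have "\<dots> \<le> liminf (\<lambda>j. \<integral>\<^sup>+w. ennreal \<bar>u (k i) w - u (k j) w\<bar> \<partial>\<mu>)"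
      by (rule nn_integral_liminf) measurable
    also have "\<dots> \<le> limsup (\<lambda>j. \<integral>\<^sup>+w. ennreal \<bar>u (k i) w - u (k j) w\<bar> \<partial>\<mu>)"
      by (rule Liminf_le_Limsup) simp
    also have "\<dots> \<le> ennreal e"
    proof (rule Limsup_bounded, unfold eventually_sequentially, intro exI[of _ N] allI impI)
      fix j assume j: "N \<le> j"
      have "(\<integral>\<^sup>+w. ennreal \<bar>u (k i) w - u (k j) w\<bar> \<partial>\<mu>) = ennreal (\<integral>w. \<bar>u (k i) w - u (k j) w\<bar> \<partial>\<mu>)"
        using u(1) by (intro nn_integral_eq_integral) auto
      also have "\<dots> \<le> ennreal e"
        using N[of "k i" "k j"] i j ki order_trans by (intro ennreal_leI less_imp_le) blast
      finally show "(\<integral>\<^sup>+w. ennreal \<bar>u (k i) w - u (k j) w\<bar> \<partial>\<mu>) \<le> ennreal e" .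
    qed
    finally show ?thesis .
  qed
  have vi: "integrable \<mu> v"
  proof -
    obtain N where N: "\<And>i j. N \<le> i \<Longrightarrow> N \<le> j \<Longrightarrow> (\<integral>w. \<bar>u i w - u j w\<bar> \<partial>\<mu>) < 1" using cau[of 1] by auto
    have "integrable \<mu> (\<lambda>w. u (k N) w - v w)"
    proof (rule integrableI_bounded)
      have "(\<integral>\<^sup>+w. ennreal (norm (u (k N) w - v w)) \<partial>\<mu>) \<le> ennreal 1"
        using close[OF N, of N] by simp
      then show "(\<integral>\<^sup>+w. ennreal (norm (u (k N) w - v w)) \<partial>\<mu>) < \<infinity>"
        by (rule order_le_less_trans) simp
    qed measurable
    then have "integrable \<mu> (\<lambda>w. u (k N) w - (u (k N) w - v w))"
      by (rule Bochner_Integration.integrable_diff[OF u(1)])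
    moreover have "(\<lambda>w. u (k N) w - (u (k N) w - v w)) = v" by auto
    ultimately show ?thesis by (simp only:)
  qed
  have lim: "(\<lambda>i. \<integral>w. \<bar>u (k i) w - v w\<bar> \<partial>\<mu>) \<longlonglongrightarrow> 0"
  proof (rule LIMSEQ_I)
    fix e :: real assume e: "0 < e"
    obtain N where N: "\<And>i j. N \<le> i \<Longrightarrow> N \<le> j \<Longrightarrow> (\<integral>w. \<bar>u i w - u j w\<bar> \<partial>\<mu>) < e/2"
      using cau[of "e/2"] e by auto
    show "\<exists>N. \<forall>i\<ge>N. norm ((\<integral>w. \<bar>u (k i) w - v w\<bar> \<partial>\<mu>) - 0) < e"
    proof (intro exI[of _ N] allI impI)
      fix i assume "N \<le> i"
      then have "(\<integral>\<^sup>+w. ennreal \<bar>u (k i) w - v w\<bar> \<partial>\<mu>) \<le> ennreal (e/2)"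
        using close[of N "e/2" i] N by blast
      then have "ennreal (\<integral>w. \<bar>u (k i) w - v w\<bar> \<partial>\<mu>) \<le> ennreal (e/2)"
        using u(1) vi by (subst (asm) nn_integral_eq_integral) auto
      then show "norm ((\<integral>w. \<bar>u (k i) w - v w\<bar> \<partial>\<mu>) - 0) < e" using e by (simp add: ennreal_le_iff)
    qed
  qed
  show ?thesis by (rule that[OF k vi _ lim]) (simp add: v_def)
qed

text \<open>Lower semicontinuity: convergence in the mean gives convergence of every moment, hence
  of every partial sum of the energy series, whose terms are nonnegative.\<close>

lemma wsq_le_of_L1_limit:
  assumes u: "\<And>n. integrable \<mu> (u n)" and v: "integrable \<mu> v"
    and lim: "(\<lambda>n. \<integral>w. \<bar>u n w - v w\<bar> \<partial>\<mu>) \<longlonglongrightarrow> 0"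
    and t: "0 \<le> t" "t < 1" and C: "\<forall>\<^sub>F n in sequentially. wsq t (moment \<mu> (u n)) \<le> C"
  shows "wsq t (moment \<mu> v) \<le> C"
proof -
  have ml: "(\<lambda>n. moment \<mu> (u n) xs) \<longlonglongrightarrow> moment \<mu> v xs" for xs
  proof -
    have "norm (moment \<mu> (u n) xs - moment \<mu> v xs) \<le> (\<integral>w. \<bar>u n w - v w\<bar> \<partial>\<mu>)" for n
    proof -
      have "moment \<mu> (u n) xs - moment \<mu> v xs = (\<integral>w. mon w xs * of_real (u n w - v w) \<partial>\<mu>)"
        unfolding moment_def Bochner_Integration.integral_diff[OF integrable_mon[OF u] integrable_mon[OF v], symmetric]
        by (simp add: right_diff_distrib)
      also have "norm \<dots> \<le> 1 * (\<integral>w. \<bar>u n w - v w\<bar> \<partial>\<mu>)"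
        using u v by (intro norm_integral_le) (auto intro: cmod_mon_le)
      finally show ?thesis by simp
    qed
    then have "(\<lambda>n. moment \<mu> (u n) xs - moment \<mu> v xs) \<longlonglongrightarrow> 0"
      by (intro Lim_null_comparison[OF _ lim]) auto
    then show ?thesis by (simp add: LIM_zero_iff)
  qed
  have sums: "(\<lambda>n. a n * (t ^ n * word_sq n (moment \<mu> v))) sums wsq t (moment \<mu> v)"
    by (intro wsq_sums wbounded_moment v t)
  have "(\<Sum>n<N. a n * (t ^ n * word_sq n (moment \<mu> v))) \<le> C" for N
  proof (rule tendsto_upperbound)
    show "(\<lambda>i. \<Sum>n<N. a n * (t ^ n * word_sq n (moment \<mu> (u i)))) \<longlonglongrightarrow>
        (\<Sum>n<N. a n * (t ^ n * word_sq n (moment \<mu> v)))"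
      unfolding word_sq_def by (intro tendsto_intros ml)
    show "\<forall>\<^sub>F i in sequentially. (\<Sum>n<N. a n * (t ^ n * word_sq n (moment \<mu> (u i)))) \<le> C"
      using C
    proof eventually_elim
      case (elim i)
      have s: "(\<lambda>n. a n * (t ^ n * word_sq n (moment \<mu> (u i)))) sums wsq t (moment \<mu> (u i))"
        by (intro wsq_sums wbounded_moment u t)
      have "(\<Sum>n<N. a n * (t ^ n * word_sq n (moment \<mu> (u i)))) \<le> wsq t (moment \<mu> (u i))"
        unfolding sums_unique[OF s] using sums_summable[OF s] a_pos t word_sq_nonneg
        by (intro sum_le_suminf) (auto intro!: mult_nonneg_nonneg simp: less_imp_le)
      then show ?case using elim by simp
    qed
  qed simp
  then show ?thesis using sums unfolding sums_def by (intro LIMSEQ_le_const2) auto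
qed

text \<open>Here \<open>v\<close> is merely integrable, since a limit of near-minimisers may be
  unbounded.\<close>

definition carries_no_energy :: bool
  where "carries_no_energy \<longleftrightarrow> (\<forall>v. integrable \<mu> v \<longrightarrow> (\<forall>w. 0 \<le> v w) \<longrightarrow> (\<integral>w. v w \<partial>\<mu>) = 1 \<longrightarrow>
    (\<forall>C. \<exists>t. 0 \<le> t \<and> t < 1 \<and> C < wsq t (moment \<mu> v)))"

definition min_penalised :: "real \<Rightarrow> real" where "min_penalised r = Inf (penalised r ` densities)"

context
  assumes pos: "0 < measure \<mu> (space \<mu>)"
    and inf: carries_no_energy
begin

lemma densities_nonempty: "densities \<noteq> {}"
proof -
  have "(\<lambda>w. 1 / measure \<mu> (space \<mu>)) \<in> densities" using pos by (auto simp: densities_def)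
  then show ?thesis by blast
qed

lemma min_penalised_le:
  assumes "u \<in> densities" "0 \<le> r" "r < 1" shows "min_penalised r \<le> penalised r u"
  unfolding min_penalised_def using assms penalised_nonneg densities_integrable
  by (intro cINF_lower bdd_belowI[of _ 0]) auto

lemma near_minimiser:
  assumes "0 < e" "0 \<le> r" "r < 1" obtains u where "u \<in> densities" "penalised r u < min_penalised r + e"
proof -
  have "bdd_below (penalised r ` densities)"
    using assms penalised_nonneg densities_integrable by (intro bdd_belowI[of _ 0]) auto
  then show ?thesis
    using that cINF_less_iff[OF densities_nonempty, of "penalised r" "min_penalised r + e"] assms(1)
    unfolding min_penalised_def by auto
qed

lemma min_penalised_mono: assumes "0 \<le> r" "r \<le> s" "s < 1" shows "min_penalised r \<le> min_penalised s"
  unfolding min_penalised_def[of s]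
proof (rule cINF_greatest[OF densities_nonempty])
  fix u assume u: "u \<in> densities"
  have "min_penalised r \<le> penalised r u" using assms by (intro min_penalised_le u) auto
  also have "\<dots> \<le> penalised s u" using assms by (intro penalised_mono densities_integrable u)
  finally show "min_penalised r \<le> penalised s u" .
qed

text \<open>Bounded minima converge along increasing levels, and the parallelogram law then makes
  near-minimisers Cauchy. Their limit density would have energy bounded over all levels, which
  \<open>carries_no_energy\<close> excludes.\<close>

lemma min_penalised_unbounded: "\<exists>r. 1/2 \<le> r \<and> r < 1 \<and> C \<le> min_penalised r"
proof (rule ccontr)
  assume "\<not> ?thesis"
  then have less: "\<And>r. 1/2 \<le> r \<Longrightarrow> r < 1 \<Longrightarrow> min_penalised r < C" by (meson not_le)
  define r where "r n = 1 - 1 / real (n + 2)" for n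
  have r: "1/2 \<le> r n" "0 \<le> r n" "r n < 1" for n by (auto simp: r_def field_simps)
  have rmono: "r m \<le> r n" if "m \<le> n" for m n using that by (simp add: r_def frac_le)
  have rlim: "r \<longlonglongrightarrow> 1"
  proof -
    have "(\<lambda>n. 1 - inverse (real (Suc (Suc n)))) \<longlonglongrightarrow> 1 - 0"
      by (intro tendsto_intros LIMSEQ_Suc[OF LIMSEQ_inverse_real_of_nat])
    then show ?thesis by (simp add: r_def[abs_def] inverse_eq_divide)
  qed
  define i where "i n = min_penalised (r n)" for n
  have imono: "i m \<le> i n" if "m \<le> n" for m n
    unfolding i_def using that r by (intro min_penalised_mono rmono)
  have ile: "i n \<le> C" for n unfolding i_def using less r by (simp add: less_imp_le)
  have "incseq i" using imono by (simp add: incseq_def)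
  then have "convergent i" using ile by (meson incseq_convergent convergentI)
  then have "Cauchy i" by (rule convergent_Cauchy)
  have "\<exists>u\<in>densities. penalised (r n) u < i n + 1 / real (Suc n)" for n
    using near_minimiser[of "1 / real (Suc n)" "r n"] r unfolding i_def by (metis of_nat_0_less_iff zero_less_Suc zero_less_divide_1_iff)
  then obtain u where u: "\<And>n. u n \<in> densities" and pu: "\<And>n. penalised (r n) (u n) < i n + 1 / real (Suc n)"
    by metis
  \<comment> \<open>The parallelogram law is applied at the lower level \<open>r n\<close>, where
    \<open>u m\<close> costs no more than at its own level \<open>r m\<close>.\<close>
  have sq: "(\<integral>w. (u n w - u m w)\<^sup>2 \<partial>\<mu>) \<le> 2 * (i m - i n) + 4 / real (Suc n)" if "n \<le> m" for n m
  proof -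
    have "(\<integral>w. (u n w - u m w)\<^sup>2 \<partial>\<mu>) \<le> 2 * penalised (r n) (u n) + 2 * penalised (r n) (u m) - 4 * i n"
      unfolding i_def using r by (intro penalised_parallelogram u min_penalised_le)
    moreover have "penalised (r n) (u m) \<le> penalised (r m) (u m)"
      using r that by (intro penalised_mono densities_integrable u rmono)
    moreover have "1 / real (Suc m) \<le> 1 / real (Suc n)" using that by (simp add: frac_le)
    ultimately show ?thesis using pu[of n] pu[of m] by simp
  qed
  define S where "S = measure \<mu> (space \<mu>)"
  have cau: "\<exists>N. \<forall>n\<ge>N. \<forall>m\<ge>N. (\<integral>w. \<bar>u n w - u m w\<bar> \<partial>\<mu>) < e" if e: "0 < e" for e
  proof -
    define s where "s = e / (2 * (S + 1))"
    have s: "0 < s" "s * S < e / 2"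
      using e pos by (auto simp: s_def S_def field_simps add_pos_pos)
    have es: "0 < e * s / 8" using e s by simp
    obtain N1 where N1: "\<And>m n. N1 \<le> m \<Longrightarrow> N1 \<le> n \<Longrightarrow> \<bar>i m - i n\<bar> < e * s / 8"
      using CauchyD[OF \<open>Cauchy i\<close> es] by (auto simp: real_norm_def)
    obtain N2 where N2: "16 / (e * s) < real (Suc N2)"
      using reals_Archimedean2 less_trans by (metis lessI of_nat_less_iff)
    have main: "(\<integral>w. \<bar>u n w - u m w\<bar> \<partial>\<mu>) < e" if n: "max N1 N2 \<le> n" "n \<le> m" for n m
    proof -
      have bd: "bounded_fun (\<lambda>w. u n w - u m w)"
        using bounded_fun_add[OF densities_bounded[OF u] densities_bounded[OF u], of n "-1" m] by simp
      have i1: "integrable \<mu> (\<lambda>w. (u n w - u m w)\<^sup>2)"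
        using bounded_fun_integrable[OF bounded_fun_mult[OF bd bd]] by (simp add: power2_eq_square)
      \<comment> \<open>Passes from mean squares to means on a finite measure: the constant
        \<open>s\<close> contributes only \<open>s * S\<close>, which is below
        \<open>e / 2\<close>.\<close>
      have pt: "\<bar>x\<bar> \<le> s + x\<^sup>2 / s" for x :: real
      proof -
        have "0 \<le> (\<bar>x\<bar> - s)\<^sup>2 + s * \<bar>x\<bar>" using s by simp
        then have "\<bar>x\<bar> * s \<le> s * s + x\<^sup>2" by (simp add: power2_eq_square algebra_simps)
        then show ?thesis using s by (simp add: field_simps)
      qed
      have "(\<integral>w. \<bar>u n w - u m w\<bar> \<partial>\<mu>) \<le> (\<integral>w. s + (u n w - u m w)\<^sup>2 / s \<partial>\<mu>)"
        using pt i1 bounded_fun_integrable[OF bd] by (intro integral_mono) auto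
      also have "\<dots> = s * S + (\<integral>w. (u n w - u m w)\<^sup>2 \<partial>\<mu>) / s" using i1 by (simp add: S_def mult.commute)
      also have "\<dots> \<le> s * S + (2 * (i m - i n) + 4 / real (Suc n)) / s"
        using s sq[OF n(2)] by (intro add_left_mono divide_right_mono) auto
      also have "\<dots> < e"
      proof -
        have "real (Suc N2) \<le> real (Suc n)" using n by simp
        then have "16 / (e * s) < real (Suc n)" using N2 by linarith
        then have "4 / real (Suc n) < e * s / 4" using e s by (simp add: field_simps)
        moreover have "\<bar>i m - i n\<bar> < e * s / 8" using n by (intro N1) auto
        then have "i m - i n < e * s / 8" by linarith
        moreover have "2 * x + y < p / 2" if "y < p / 4" "x < p / 8" for x y p :: real using that by linarith
        ultimately have "2 * (i m - i n) + 4 / real (Suc n) < e * s / 2" by blast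
        then have "2 * (i m - i n) + 4 / real (Suc n) < (e / 2) * s" by simp
        then have "(2 * (i m - i n) + 4 / real (Suc n)) / s < e / 2" using s by (simp add: divide_less_eq)
        then show ?thesis using s(2) by linarith
      qed
      finally show ?thesis .
    qed
    have "(\<integral>w. \<bar>u n w - u m w\<bar> \<partial>\<mu>) < e" if "max N1 N2 \<le> n" "max N1 N2 \<le> m" for n m
      using main[of n m] main[of m n] that by (cases "n \<le> m") (simp_all add: abs_minus_commute)
    then show ?thesis by blast
  qed
  obtain k v where k: "strict_mono (k :: nat \<Rightarrow> nat)" and v: "integrable \<mu> v" "\<And>w. 0 \<le> v w"
    and lim: "(\<lambda>j. \<integral>w. \<bar>u (k j) w - v w\<bar> \<partial>\<mu>) \<longlonglongrightarrow> 0"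
    using L1_limit[of u, OF densities_integrable[OF u] _ cau] u unfolding densities_def by blast
  have "(\<integral>w. v w \<partial>\<mu>) = 1"
  proof -
    have "\<bar>1 - (\<integral>w. v w \<partial>\<mu>)\<bar> \<le> (\<integral>w. \<bar>u (k j) w - v w\<bar> \<partial>\<mu>)" for j
    proof -
      have "1 - (\<integral>w. v w \<partial>\<mu>) = (\<integral>w. u (k j) w - v w \<partial>\<mu>)"
        using v(1) densities_integrable[OF u] u[of "k j"] by (simp add: densities_def)
      then show ?thesis by (simp add: integral_abs_bound)
    qed
    then have "\<bar>1 - (\<integral>w. v w \<partial>\<mu>)\<bar> \<le> 0" by (intro LIMSEQ_le_const[OF lim]) auto
    then show ?thesis by simp
  qed
  moreover have "wsq t (moment \<mu> v) \<le> C + 1" if t: "0 \<le> t" "t < 1" for t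
  proof (rule wsq_le_of_L1_limit[OF densities_integrable[OF u] v(1) lim t])
    have "(\<lambda>j. r (k j)) \<longlonglongrightarrow> 1" using LIMSEQ_subseq_LIMSEQ[OF rlim k] by (simp add: o_def)
    then have "\<forall>\<^sub>F j in sequentially. t < r (k j)" by (rule order_tendstoD) (rule t)
    then show "\<forall>\<^sub>F j in sequentially. wsq t (moment \<mu> (u (k j))) \<le> C + 1"
    proof eventually_elim
      case (elim j)
      have "wsq t (moment \<mu> (u (k j))) \<le> wsq (r (k j)) (moment \<mu> (u (k j)))"
        using t elim r by (intro wsq_mono wbounded_moment densities_integrable u) auto
      also have "\<dots> \<le> penalised (r (k j)) (u (k j))" by (simp add: penalised_def)
      also have "\<dots> \<le> i (k j) + 1" using pu[of "k j"] by (smt (verit) divide_le_eq_1 of_nat_0_less_iff of_nat_1 of_nat_le_iff one_le_numeral Suc_le_mono le0 One_nat_def zero_less_Suc)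
      also have "\<dots> \<le> C + 1" using ile by simp
      finally show ?case .
    qed
  qed
  ultimately show False using inf v unfolding carries_no_energy_def by (meson not_le)
qed

text \<open>First variation of \<open>penalised r\<close> at a near-minimiser, in the direction of the normalised
  indicator function of the set where the potential is too small.\<close>

lemma minimiser_large:
  assumes r: "0 \<le> r" "r < 1" and I: "0 < min_penalised r" and \<delta>: "0 < \<delta>"
  obtains u where "u \<in> densities" "penalised r u \<le> min_penalised r + 1"
    "measure \<mu> {z \<in> space \<mu>. Re (potential r (moment \<mu> u) z) + u z < min_penalised r / 2} \<le> \<delta>"
proof -
  define I where "I = min_penalised r"
  have I0: "0 < I" using I by (simp add: I_def)
  \<comment> \<open>Bounds the penalised energy of the normalised indicator \<open>v\<close> of
    \<open>E\<close> below: \<open>kval r\<close> for the energy of a probability density, and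
    \<open>1 / \<delta>\<close> for the integral of the square when \<open>E\<close> has measure
    above \<open>\<delta>\<close>.\<close>
  define T where "T = kval r + 1 / \<delta>"
  have T: "0 < T" using kval_ge_1[OF r] \<delta> by (simp add: T_def add_pos_pos)
  define t where "t = min (1/2) (I / (4 * T))"
  have t: "0 < t" "t < 1" using I0 T by (auto simp: t_def)
  have "t * T \<le> I / (4 * T) * T" using T by (intro mult_right_mono) (auto simp: t_def)
  then have tT: "t * T \<le> I / 4" using T by simp
  \<comment> \<open>With these choices the slack \<open>\<eta>\<close> and the second order term
    \<open>t * (t * T)\<close> are each at most \<open>t * I / 4\<close>, whereas a potential too
    small on \<open>E\<close> would require their sum to be at least \<open>t * I\<close>.\<close>
  define \<eta> where "\<eta> = min 1 (t * I / 4)"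
  have \<eta>: "0 < \<eta>" "\<eta> \<le> 1" "\<eta> \<le> t * I / 4" using t I0 by (auto simp: \<eta>_def)
  obtain u where u: "u \<in> densities" "penalised r u < I + \<eta>"
    using near_minimiser[OF \<eta>(1) r] unfolding I_def by blast
  note ui = densities_integrable[OF u(1)]
  have um [measurable]: "u \<in> borel_measurable \<mu>" using u(1) by (simp add: densities_def)
  define E where "E = {z \<in> space \<mu>. Re (potential r (moment \<mu> u) z) + u z < I / 2}"
  have E [measurable]: "E \<in> sets \<mu>" unfolding E_def by measurable
  have "measure \<mu> E \<le> \<delta>"
  proof (rule ccontr)
    assume "\<not> measure \<mu> E \<le> \<delta>"
    then have \<beta>: "\<delta> < measure \<mu> E" by simp
    then have \<beta>0: "0 < measure \<mu> E" using \<delta> by simp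
    define v where "v z = indicat_real E z / measure \<mu> E" for z
    have v0: "0 \<le> v z" for z using \<beta>0 by (simp add: v_def)
    have vb: "v z \<le> 1 / measure \<mu> E" for z using \<beta>0 by (simp add: v_def indicator_def divide_right_mono)
    have vm: "v \<in> borel_measurable \<mu>" unfolding v_def by measurable
    have vint: "(\<integral>z. v z \<partial>\<mu>) = 1" unfolding v_def using \<beta>0 by simp
    have v: "v \<in> densities" unfolding densities_def using v0 vb vm vint by auto
    note vi = densities_integrable[OF v]
    have sqv: "(\<integral>z. (v z)\<^sup>2 \<partial>\<mu>) = 1 / measure \<mu> E"
    proof -
      have "(v z)\<^sup>2 = v z / measure \<mu> E" for z by (simp add: v_def indicator_def power2_eq_square)
      then show ?thesis using vint by simp
    qed
    have Pv: "penalised r v \<le> T"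
    proof -
      have "wsq r (moment \<mu> v) \<le> kval r"
        using r vi v0 vint by (intro wsq_le_kval word_sq_moment_le_1) auto
      moreover have "1 / measure \<mu> E \<le> 1 / \<delta>" using \<beta> \<delta> by (simp add: frac_le)
      ultimately show ?thesis unfolding penalised_def sqv T_def by simp
    qed
    define c where "c = Re (wform r (moment \<mu> u) (moment \<mu> v)) + (\<integral>z. u z * v z \<partial>\<mu>)"
    have c: "c \<le> I / 2"
    proof -
      note wb = wbounded_moment[OF ui] wbounded_moment[OF vi]
      have uv: "integrable \<mu> (\<lambda>z. u z * v z)"
        by (intro bounded_fun_integrable bounded_fun_mult densities_bounded u(1) v)
      note pi = wform_moment[OF vi wb(1) r, folded potential_eq_wform]
      have "Re (wform r (moment \<mu> u) (moment \<mu> v)) = Re (wform r (moment \<mu> v) (moment \<mu> u))"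
        using wform_cnj[OF wb r] by simp
      also have "\<dots> = (\<integral>z. Re (potential r (moment \<mu> u) z * of_real (v z)) \<partial>\<mu>)"
        unfolding pi(1)[symmetric] by (rule integral_Re[symmetric, OF pi(2)])
      finally have "c = (\<integral>z. Re (potential r (moment \<mu> u) z * of_real (v z)) + u z * v z \<partial>\<mu>)"
        unfolding c_def by (simp only: Bochner_Integration.integral_add[OF integrable_Re[OF pi(2)] uv])
      also have "\<dots> \<le> (\<integral>z. I / 2 * v z \<partial>\<mu>)"
      proof (rule integral_mono)
        show "integrable \<mu> (\<lambda>z. Re (potential r (moment \<mu> u) z * of_real (v z)) + u z * v z)"
          by (intro Bochner_Integration.integrable_add integrable_Re[OF pi(2)] uv)
        fix z assume z: "z \<in> space \<mu>"
        have "(Re (potential r (moment \<mu> u) z) + u z) * v z \<le> I / 2 * v z"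
        proof (cases "z \<in> E")
          case True
          then have "Re (potential r (moment \<mu> u) z) + u z \<le> I / 2" by (simp add: E_def)
          then show ?thesis by (rule mult_right_mono) (rule v0)
        qed (simp add: v_def)
        then show "Re (potential r (moment \<mu> u) z * of_real (v z)) + u z * v z \<le> I / 2 * v z"
          by (simp add: algebra_simps)
      qed (use vi in simp)
      also have "\<dots> = I / 2" using vint by simp
      finally show ?thesis .
    qed
    have bu: "bounded_fun u" and bv: "bounded_fun v" using u(1) v densities_bounded by auto
    have "I \<le> penalised r (\<lambda>w. (1 - t) * u w + t * v w)"
      unfolding I_def using t r by (intro min_penalised_le densities_convex u v) auto
    also have "(\<lambda>w. (1 - t) * u w + t * v w) = (\<lambda>w. u w + t * (v w + (-1) * u w))" by (auto simp: algebra_simps)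
    also have "penalised r \<dots> = (1 - t)\<^sup>2 * penalised r u + 2 * t * (1 - t) * c + t\<^sup>2 * penalised r v"
    proof -
      \<comment> \<open>Pulling out \<open>1 - t\<close> brings the convex combination to the form
        that \<open>penalised_add\<close> expands.\<close>
      have "(\<lambda>w. u w + t * (v w + (-1) * u w)) = (\<lambda>w. (1 - t) * (u w + (t / (1 - t)) * v w))"
        using t by (auto simp: field_simps)
      moreover have "penalised r (\<lambda>w. s * x w) = s\<^sup>2 * penalised r x" if x: "bounded_fun x" for x s
      proof -
        have z: "bounded_fun (\<lambda>w. 0)" unfolding bounded_fun_def by auto
        have m0: "moment \<mu> (\<lambda>w. 0) = (\<lambda>xs. 0)" by (simp add: moment_def fun_eq_iff)
        have 0: "penalised r (\<lambda>w. 0) = 0" by (simp add: penalised_def m0 wsq_def word_sq_def)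
        show ?thesis using penalised_add[OF z x r, of s] by (simp add: 0 m0 wform_def word_inner_def)
      qed
      ultimately have "penalised r (\<lambda>w. u w + t * (v w + (-1) * u w)) =
          (1 - t)\<^sup>2 * penalised r (\<lambda>w. u w + (t / (1 - t)) * v w)"
        using bounded_fun_add[OF bu bv] by (simp only:)
      also have "penalised r (\<lambda>w. u w + (t / (1 - t)) * v w) =
          penalised r u + 2 * (t / (1 - t)) * c + (t / (1 - t))\<^sup>2 * penalised r v"
        unfolding c_def by (rule penalised_add[OF bu bv r])
      also have "(1 - t)\<^sup>2 * \<dots> = (1 - t)\<^sup>2 * penalised r u + 2 * t * (1 - t) * c + t\<^sup>2 * penalised r v"
      proof -
        have q: "(1 - t) * (t / (1 - t)) = t" using t by simp
        have "(1 - t)\<^sup>2 * (P + 2 * q * c + q\<^sup>2 * R) =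
            (1 - t)\<^sup>2 * P + 2 * ((1 - t) * q) * (1 - t) * c + ((1 - t) * q)\<^sup>2 * R" for P q R
          by (simp add: power2_eq_square algebra_simps)
        from this[of _ "t / (1 - t)"] show ?thesis unfolding q .
      qed
      finally show ?thesis .
    qed
    also have "\<dots> \<le> (1 - t)\<^sup>2 * (I + \<eta>) + 2 * t * (1 - t) * (I / 2) + t\<^sup>2 * T"
      using u(2) c Pv t by (intro add_mono mult_left_mono) auto
    finally have "t * I \<le> (1 - t)\<^sup>2 * \<eta> + t * (t * T)" by (simp add: power2_eq_square algebra_simps)
    also have "\<dots> \<le> 1 * \<eta> + t * (I / 4)"
      using t tT \<eta> by (intro add_mono mult_right_mono mult_left_mono) (auto simp: power_le_one)
    also have "\<dots> \<le> t * I / 2" using \<eta>(3) by argo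
    finally show False using t I0 by simp
  qed
  then show ?thesis using u \<eta> by (intro that[of u]) (auto simp: E_def I_def)
qed

text \<open>Removes the density from the bound: by Markov's inequality \<open>u \<ge> I / 4\<close>
  only on measure at most \<open>4 / I\<close>, and off that set \<open>Re h + u \<ge> I / 2\<close>
  forces \<open>Re h \<ge> I / 4\<close>. With \<open>\<delta> = 1 / I\<close> in
  \<open>minimiser_large\<close> the exceptional sets add up to \<open>5 / I\<close>.\<close>

lemma large_potential:
  assumes M: "0 < M"
  obtains I r u where "M \<le> I" "1/2 \<le> r" "r < 1" "u \<in> densities" "wsq r (moment \<mu> u) \<le> I + 1"
    "measure \<mu> {z \<in> space \<mu>. Re (potential r (moment \<mu> u) z) < I / 4} \<le> 5 / I"
proof -
  obtain r where r: "1/2 \<le> r" "r < 1" "M \<le> min_penalised r" using min_penalised_unbounded by blast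
  define I where "I = min_penalised r"
  have I: "0 < I" "M \<le> I" using r M by (auto simp: I_def)
  have r0: "0 \<le> r" using r by simp
  have 1: "0 < 1 / I" using I by simp
  obtain u where u: "u \<in> densities" "penalised r u \<le> I + 1"
    "measure \<mu> {z \<in> space \<mu>. Re (potential r (moment \<mu> u) z) + u z < I / 2} \<le> 1 / I"
    using minimiser_large[OF r0 r(2) _ 1] I(1) unfolding I_def by blast
  note ui = densities_integrable[OF u(1)]
  have um [measurable]: "u \<in> borel_measurable \<mu>" using u(1) by (simp add: densities_def)
  have "measure \<mu> {z \<in> space \<mu>. I / 4 \<le> u z} \<le> (\<integral>z. u z \<partial>\<mu>) / (I / 4)"
    using u(1) I by (intro integral_Markov_inequality_measure[OF ui, of "{}"]) (auto simp: densities_def)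
  also have "\<dots> = 4 / I" using u(1) by (simp add: densities_def)
  finally have 2: "measure \<mu> {z \<in> space \<mu>. I / 4 \<le> u z} \<le> 4 / I" .
  define E where "E = {z \<in> space \<mu>. Re (potential r (moment \<mu> u) z) + u z < I / 2}"
  define F where "F = {z \<in> space \<mu>. I / 4 \<le> u z}"
  have EF: "E \<in> sets \<mu>" "F \<in> sets \<mu>" unfolding E_def F_def by measurable
  have "measure \<mu> {z \<in> space \<mu>. Re (potential r (moment \<mu> u) z) < I / 4} \<le> measure \<mu> (E \<union> F)"
    using EF by (intro finite_measure_mono) (auto simp: E_def F_def)
  also have "\<dots> \<le> measure \<mu> E + measure \<mu> F" by (rule measure_Un_le[OF EF])
  also have "\<dots> \<le> 1 / I + 4 / I" using u(3) 2 by (simp add: E_def F_def)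
  finally have "measure \<mu> {z \<in> space \<mu>. Re (potential r (moment \<mu> u) z) < I / 4} \<le> 5 / I"
    by (simp add: add_divide_distrib[symmetric])
  moreover have "wsq r (moment \<mu> u) \<le> I + 1" 
  proof -
    have "0 \<le> (\<integral>w. (u w)\<^sup>2 \<partial>\<mu>)" by simp
    then show ?thesis using u(2) unfolding penalised_def by linarith
  qed
  ultimately show ?thesis using I r u by (intro that[of I r u])
qed

end

end

section \<open>Inner regularity on the sphere\<close>

lemma sphere_sets: "E \<in> sets (sphere_borel :: (complex ^ 'd) measure) \<longleftrightarrow> E \<in> sets borel \<and> E \<subseteq> sphere 0 1"
  by (auto simp: sets_restrict_space_iff)

context sphere_measure
begin

text \<open>\<open>\<mu>\<close> is pushed forward along the inclusion of the sphere, so that inner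
  regularity of finite Borel measures on the whole space applies.\<close>

lemma inner_compact:
  assumes E: "E \<in> sets \<mu>" and e: "0 < e"
  obtains C where "compact C" "C \<subseteq> E" "C \<in> sets \<mu>" "measure \<mu> (E - C) < e"
proof -
  have id: "(\<lambda>x. x) \<in> measurable \<mu> borel" by (rule measurable_continuous) (rule continuous_on_id)
  define N where "N = distr \<mu> borel (\<lambda>x. x)"
  interpret N: finite_measure N unfolding N_def by (rule finite_measure_distr[OF id])
  have Eb: "E \<in> sets borel" "E \<subseteq> sphere 0 1" using E sets_eq sphere_sets by auto
  have em: "emeasure N A = emeasure \<mu> A" if "A \<in> sets borel" "A \<subseteq> sphere 0 1" for A
    unfolding N_def using that id by (subst emeasure_distr) (auto simp: space_eq intro!: arg_cong[of _ _ "emeasure \<mu>"])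
  have "emeasure N E = (SUP C\<in>{C. C \<subseteq> E \<and> compact C}. emeasure N C)"
    by (rule inner_regular) (auto simp: N_def Eb, metis N.emeasure_finite N_def infinity_ennreal_def space_distr space_borel)
  show ?thesis
  proof (cases "measure \<mu> E < e")
    case True
    then show ?thesis by (intro that[of "{}"]) auto
  next
    case False
    have "ennreal (measure \<mu> E - e) < ennreal (measure \<mu> E)" using False e by (subst ennreal_less_iff) auto
    also have "\<dots> = (SUP C\<in>{C. C \<subseteq> E \<and> compact C}. emeasure N C)"
      using \<open>emeasure N E = _\<close> em[OF Eb] emeasure_eq_measure by simp
    finally obtain C where C: "C \<subseteq> E" "compact C" "ennreal (measure \<mu> E - e) < emeasure N C"
      unfolding less_SUP_iff by blast
    have Cb: "C \<in> sets borel" "C \<subseteq> sphere 0 1" using C Eb by (auto intro: borel_compact)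
    then have Cm: "C \<in> sets \<mu>" using sets_eq sphere_sets by auto
    have "ennreal (measure \<mu> E - e) < ennreal (measure \<mu> C)" using C(3) em[OF Cb] emeasure_eq_measure by simp
    then have "measure \<mu> E - e < measure \<mu> C" using False by (subst (asm) ennreal_less_iff) auto
    moreover have "measure \<mu> (E - C) = measure \<mu> E - measure \<mu> C" using C E Cm by (intro finite_measure_Diff)
    ultimately show ?thesis using C Cm by (intro that[of C]) auto
  qed
qed

lemma fsigma_subset_full_measure:
  assumes E: "E \<in> sets \<mu>"
  obtains F where "fsigma F" "F \<subseteq> E" "F \<in> sets \<mu>" "emeasure \<mu> (E - F) = 0"
proof -
  have "\<exists>C. compact C \<and> C \<subseteq> E \<and> C \<in> sets \<mu> \<and> measure \<mu> (E - C) < 1 / real (Suc n)" for n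
    using inner_compact[OF E, of "1 / real (Suc n)"] by (metis of_nat_0_less_iff zero_less_Suc zero_less_divide_1_iff)
  then obtain C where C: "\<And>n. compact (C n)" "\<And>n. C n \<subseteq> E" "\<And>n. C n \<in> sets \<mu>"
    "\<And>n. measure \<mu> (E - C n) < 1 / real (Suc n)" by metis
  define F where "F = (\<Union>n :: nat. C n)"
  have Fm: "F \<in> sets \<mu>" unfolding F_def using C(3) by auto
  have "measure \<mu> (E - F) \<le> 1 / real (Suc n)" for n
  proof -
    have "measure \<mu> (E - F) \<le> measure \<mu> (E - C n)"
      using E C(3) by (intro finite_measure_mono) (auto simp: F_def)
    then show ?thesis using C(4)[of n] by simp
  qed
  then have "measure \<mu> (E - F) \<le> 0"
    using LIMSEQ_inverse_real_of_nat by (intro LIMSEQ_le_const[of "\<lambda>n. 1 / real (Suc n)"]) (auto simp: inverse_eq_divide)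
  then have "emeasure \<mu> (E - F) = 0" using emeasure_eq_measure measure_nonneg[of \<mu> "E - F"] by simp
  moreover have "fsigma F" unfolding F_def using C(1) by (intro fsigma.intros compact_imp_closed)
  ultimately show ?thesis using that Fm C(2) by (auto simp: F_def)
qed

lemma density_prob:
  assumes v: "integrable \<mu> v" "\<And>w. 0 \<le> v w" "(\<integral>w. v w \<partial>\<mu>) = 1"
  shows "sphere_prob (density \<mu> (\<lambda>w. ennreal (v w)))"
    and "moment (density \<mu> (\<lambda>w. ennreal (v w))) (\<lambda>_. 1) = moment \<mu> v"
proof -
  have vm [measurable]: "v \<in> borel_measurable \<mu>" using v(1) by auto
  have "emeasure (density \<mu> (\<lambda>w. ennreal (v w))) (space \<mu>) = (\<integral>\<^sup>+w. ennreal (v w) \<partial>\<mu>)"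
    by (subst emeasure_density) (auto intro!: nn_integral_cong)
  also have "\<dots> = 1" using v by (subst nn_integral_eq_integral) auto
  finally show "sphere_prob (density \<mu> (\<lambda>w. ennreal (v w)))"
    unfolding sphere_prob_def using sets_eq by (auto intro!: prob_spaceI)
  show "moment (density \<mu> (\<lambda>w. ennreal (v w))) (\<lambda>_. 1) = moment \<mu> v"
  proof
    fix xs
    have "(\<integral>w. mon w xs * of_real 1 \<partial>density \<mu> (\<lambda>w. ennreal (v w))) = (\<integral>w. v w *\<^sub>R (mon w xs * of_real 1) \<partial>\<mu>)"
      by (rule integral_density) (auto simp: v)
    then show "moment (density \<mu> (\<lambda>w. ennreal (v w))) (\<lambda>_. 1) xs = moment \<mu> v xs"
      by (simp add: moment_def scaleR_conv_of_real mult.commute)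
  qed
qed

end

context ball_kernel
begin

lemma sphere_prob_sphere_measure: "sphere_prob m \<Longrightarrow> sphere_measure a B m"
  unfolding sphere_prob_def sphere_measure_def sphere_measure_axioms_def
  using ball_kernel_axioms prob_space.finite_measure by blast

lemma compact_capacity_eq_0_iff:
  "compact_capacity a F = 0 \<longleftrightarrow>
    (\<forall>m :: (complex ^ 'd) measure. sphere_prob m \<longrightarrow> emeasure m (sphere 0 1 - F) = 0 \<longrightarrow> \<not> energy a m < \<infinity>)"
proof -
  have "1 / x = 0 \<longleftrightarrow> \<not> x < \<infinity>" for x :: ennreal
    by (cases "x = top") (auto simp: ennreal_divide_eq_0_iff less_top)
  then show ?thesis unfolding compact_capacity_def by (auto simp: SUP_eq_iff bot_ennreal[symmetric] intro!: antisym SUP_least)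
qed

text \<open>A probability measure of finite energy carried by a compact
  \<open>F \<subseteq> E\<close> would give mass 0 both to \<open>E\<close> and to the complement of
  \<open>F\<close>.\<close>

lemma inner_capacity_eq_0:
  assumes "\<And>m. sphere_prob m \<Longrightarrow> energy a m < \<infinity> \<Longrightarrow> emeasure m E = 0"
    and E: "E \<in> sets (sphere_borel :: (complex ^ 'd) measure)"
  shows "inner_capacity a E = 0"
proof -
  have "compact_capacity a F = 0" if F: "compact F" "F \<subseteq> E" for F
    unfolding compact_capacity_eq_0_iff
  proof (intro allI impI notI)
    fix m :: "(complex ^ 'd) measure"
    assume m: "sphere_prob m" "emeasure m (sphere 0 1 - F) = 0" "energy a m < \<infinity>"
    interpret sphere_measure a B m by (rule sphere_prob_sphere_measure[OF m(1)])
    have "E \<in> null_sets m" using assms m sets_eq by (auto simp: null_sets_def)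
    moreover have "F \<in> sets borel" using F(1) by (rule borel_compact)
    then have "sphere 0 1 - F \<in> null_sets m"
      using m(2) sets_eq by (auto simp: null_sets_def sphere_sets)
    ultimately have "E \<union> (sphere 0 1 - F) \<in> null_sets m" by (rule null_sets.Un)
    moreover have "E \<union> (sphere 0 1 - F) = space m" using F(2) E sphere_sets space_eq by auto
    ultimately show False using m(1) prob_space.emeasure_space_1[of m] by (auto simp: sphere_prob_def null_sets_def)
  qed
  then have "inner_capacity a E \<le> 0" unfolding inner_capacity_def by (intro SUP_least) auto
  then show ?thesis by simp
qed

end

section \<open>Boundary behaviour of potentials under the Pick property\<close>

section \<open>Potentials for a complete Pick kernel\<close>

locale pick_sphere_measure = sphere_measure a B \<mu> + pick_ball a B
  for a :: "nat \<Rightarrow> real" and B :: "(complex ^ 'd) set" and \<mu> :: "(complex ^ 'd) measure"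
begin

text \<open>\<open>K(z, r w)\<close> with \<open>z\<close> on the sphere is a value of \<open>K\<close> at points of the open ball.\<close>

lemma K_shift: "0 \<le> r \<Longrightarrow> K z (r *\<^sub>R w) = K (sqrt r *\<^sub>R z) (sqrt r *\<^sub>R w)"
proof -
  assume "0 \<le> r"
  then have "complex_of_real (sqrt r) * complex_of_real (sqrt r) = complex_of_real r"
    by (simp flip: of_real_mult)
  then have "hermitian_inner z (r *\<^sub>R w) = hermitian_inner (sqrt r *\<^sub>R z) (sqrt r *\<^sub>R w)"
    by (simp add: hermitian_inner_scaleR mult.assoc[symmetric])
  then show ?thesis by (simp add: ui_kernel_def)
qed

lemma sqrt_mem: "0 \<le> r \<Longrightarrow> r < 1 \<Longrightarrow> norm z \<le> 1 \<Longrightarrow> sqrt r *\<^sub>R z \<in> B"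
  using mult_left_mono[of "norm z" 1 "sqrt r"] by (auto simp: B_eq intro: le_less_trans)

text \<open>Unlike \<open>Re_ge_half\<close> this reaches the sphere, where potentials are
  integrated and inverted.\<close>

lemma Re_potential_ge_half:
  assumes u: "u \<in> densities" and r: "0 \<le> r" "r < 1" and z: "norm z \<le> 1"
  shows "1 / 2 \<le> Re (potential r (moment \<mu> u) z)"
proof -
  note ui = densities_integrable[OF u]
  have u0: "\<And>w. 0 \<le> u w" and u1: "(\<integral>w. u w \<partial>\<mu>) = 1" using u by (auto simp: densities_def)
  note P = potential_eq_integral[OF ui r z]
  have "1 / 2 = (\<integral>w. 1 / 2 * u w \<partial>\<mu>)" using u1 by simp
  also have "\<dots> \<le> (\<integral>w. Re (K z (r *\<^sub>R w) * of_real (u w)) \<partial>\<mu>)"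
  proof (rule integral_mono)
    show "integrable \<mu> (\<lambda>w. Re (K z (r *\<^sub>R w) * of_real (u w)))" by (rule integrable_Re[OF P(2)])
    fix w assume "w \<in> space \<mu>"
    then have "1 / 2 \<le> Re (K z (r *\<^sub>R w))"
      unfolding K_shift[OF r(1)] using r z by (intro Re_K_ge_half sqrt_mem) (auto simp: space_eq)
    then show "1 / 2 * u w \<le> Re (K z (r *\<^sub>R w) * of_real (u w))"
      using mult_right_mono[OF _ u0[of w], of "1/2" "Re (K z (r *\<^sub>R w))"] by simp
  qed (use ui in simp)
  also have "\<dots> = Re (potential r (moment \<mu> u) z)" unfolding P(1) by (rule integral_Re[OF P(2)])
  finally show ?thesis .
qed

text \<open>The condition on \<open>h\<close> holds for every kernel section and is affine in it, so
  it can be integrated against a probability density.\<close>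

lemma potential_positive:
  assumes u: "u \<in> densities" and r: "0 \<le> r" "r < 1" and F: "finite F" "F \<subseteq> B"
  shows "kernel_sq K F c \<le> 2 * Re (kernel_form K F (\<lambda>z. c z * potential r (moment \<mu> u) z) c)"
proof -
  note ui = densities_integrable[OF u]
  have u0: "\<And>w. 0 \<le> u w" and u1: "(\<integral>w. u w \<partial>\<mu>) = 1" using u by (auto simp: densities_def)
  have nz: "norm z \<le> 1" if "z \<in> F" for z using that F(2) by (auto simp: B_eq)
  define G where "G w = kernel_form K F (\<lambda>z. c z * K z (r *\<^sub>R w)) c * of_real (u w)" for w
  have G: "G w = (\<Sum>z\<in>F. \<Sum>x\<in>F. (c z * cnj (c x) * K z x) * (K z (r *\<^sub>R w) * of_real (u w)))" for w
    unfolding G_def kernel_form_def sum_distrib_right by (simp add: mult_ac)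
  have Gi: "integrable \<mu> G"
    unfolding G[abs_def] using nz
    by (intro Bochner_Integration.integrable_sum integrable_mult_right potential_eq_integral(2)[OF ui r]) auto
  have "(\<integral>w. G w \<partial>\<mu>) = (\<Sum>z\<in>F. \<Sum>x\<in>F. (c z * cnj (c x) * K z x) * potential r (moment \<mu> u) z)"
  proof -
    have "(\<integral>w. G w \<partial>\<mu>) = (\<Sum>z\<in>F. \<integral>w. (\<Sum>x\<in>F. (c z * cnj (c x) * K z x) * (K z (r *\<^sub>R w) * of_real (u w))) \<partial>\<mu>)"
      unfolding G using nz
      by (intro Bochner_Integration.integral_sum Bochner_Integration.integrable_sum integrable_mult_right
        potential_eq_integral(2)[OF ui r]) auto
    also have "\<dots> = (\<Sum>z\<in>F. \<Sum>x\<in>F. \<integral>w. (c z * cnj (c x) * K z x) * (K z (r *\<^sub>R w) * of_real (u w)) \<partial>\<mu>)"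
      using nz by (intro sum.cong refl Bochner_Integration.integral_sum integrable_mult_right
        potential_eq_integral(2)[OF ui r]) auto
    also have "\<dots> = (\<Sum>z\<in>F. \<Sum>x\<in>F. (c z * cnj (c x) * K z x) * potential r (moment \<mu> u) z)"
      using nz by (intro sum.cong refl) (simp only: integral_mult_right_zero potential_eq_integral(1)[OF ui r])
    finally show ?thesis .
  qed
  also have "\<dots> = kernel_form K F (\<lambda>z. c z * potential r (moment \<mu> u) z) c"
    unfolding kernel_form_def by (simp add: mult_ac)
  finally have Gint: "(\<integral>w. G w \<partial>\<mu>) = kernel_form K F (\<lambda>z. c z * potential r (moment \<mu> u) z) c" .
  have "kernel_sq K F c = (\<integral>w. kernel_sq K F c * u w \<partial>\<mu>)" using u1 by simp
  also have "\<dots> \<le> (\<integral>w. 2 * Re (G w) \<partial>\<mu>)"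
  proof (rule integral_mono)
    show "integrable \<mu> (\<lambda>w. 2 * Re (G w))" using integrable_Re[OF Gi] by simp
    fix w assume "w \<in> space \<mu>"
    then have "r *\<^sub>R w \<in> B" using r by (auto simp: space_eq B_eq)
    from mult_right_mono[OF kernel_section_positive[OF this F, of c] u0[of w]]
    show "kernel_sq K F c * u w \<le> 2 * Re (G w)" unfolding G_def by simp
  qed (use ui in simp)
  also have "\<dots> = 2 * Re (\<integral>w. G w \<partial>\<mu>)" using integral_Re[OF Gi] by simp
  finally show ?thesis unfolding Gint .
qed

text \<open>Moving a factor \<open>sqrt r\<close> to each argument brings
  \<open>off_diagonal\<close> into play, with |x - y|^2 = r |z - w|^2. The lower bound 1/2 on the
  levels keeps this away from 0, so that \<open>C\<close> serves all levels and densities.\<close>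

lemma potential_bounded_off_support:
  assumes z: "norm z = 1" "z \<notin> F" and F: "compact F" "AE w in \<mu>. w \<in> F"
  obtains C where "\<And>r u. 1/2 \<le> r \<Longrightarrow> r < 1 \<Longrightarrow> u \<in> densities \<Longrightarrow> cmod (potential r (moment \<mu> u) z) \<le> C"
proof -
  obtain c where c: "0 < c" "\<And>x y. x \<in> B \<Longrightarrow> y \<in> B \<Longrightarrow> c * (norm (x - y))\<^sup>2 \<le> Re (1 / K x y)"
    using off_diagonal by blast
  obtain \<delta> where \<delta>: "0 < \<delta>" "\<And>w. w \<in> F \<Longrightarrow> \<delta> \<le> dist z w"
    using separate_point_closed[OF compact_imp_closed[OF F(1)] z(2)] by blast
  define C where "C = 1 / (c * \<delta>\<^sup>2 / 2)"
  have Kb: "cmod (K z (r *\<^sub>R w)) \<le> C" if r: "1/2 \<le> r" "r < 1" and w: "w \<in> F" "norm w = 1" for r w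
  proof -
    let ?x = "sqrt r *\<^sub>R z" and ?y = "sqrt r *\<^sub>R w"
    have xy: "?x \<in> B" "?y \<in> B" using r z w by (auto intro!: sqrt_mem)
    have "c * \<delta>\<^sup>2 / 2 \<le> c * (r * (dist z w)\<^sup>2)"
    proof -
      have "(1/2) * \<delta>\<^sup>2 \<le> r * (dist z w)\<^sup>2" using r \<delta> w by (intro mult_mono power_mono) auto
      then show ?thesis using c(1) by simp
    qed
    also have "r * (dist z w)\<^sup>2 = (norm (?x - ?y))\<^sup>2"
      using r by (simp add: scaleR_diff_right[symmetric] dist_norm power_mult_distrib)
    also have "c * (norm (?x - ?y))\<^sup>2 \<le> cmod (1 / K ?x ?y)"
      using c(2)[OF xy] complex_Re_le_cmod order_trans by blast
    finally have "c * \<delta>\<^sup>2 / 2 \<le> 1 / cmod (K ?x ?y)" by (simp add: norm_divide)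
    moreover have "0 < cmod (K ?x ?y)" using K_nonzero[OF xy] by simp
    moreover have "0 < c * \<delta>\<^sup>2 / 2" using c \<delta> by simp
    ultimately have "cmod (K ?x ?y) \<le> C" by (simp add: C_def field_simps)
    then show ?thesis using K_shift[of r z w] r by simp
  qed
  have "cmod (potential r (moment \<mu> u) z) \<le> C" if r: "1/2 \<le> r" "r < 1" and u: "u \<in> densities" for r u
  proof -
    note ui = densities_integrable[OF u]
    have u0: "\<And>w. 0 \<le> u w" and u1: "(\<integral>w. u w \<partial>\<mu>) = 1" using u by (auto simp: densities_def)
    have r0: "0 \<le> r" using r by simp
    have z1: "norm z \<le> 1" using z by simp
    note P = potential_eq_integral[OF ui r0 r(2) z1]
    have "cmod (potential r (moment \<mu> u) z) \<le> (\<integral>w. cmod (K z (r *\<^sub>R w) * of_real (u w)) \<partial>\<mu>)"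
      unfolding P(1) by (rule integral_norm_bound)
    also have "\<dots> \<le> (\<integral>w. C * u w \<partial>\<mu>)"
    proof (rule integral_mono_AE)
      show "AE w in \<mu>. cmod (K z (r *\<^sub>R w) * of_real (u w)) \<le> C * u w"
        using F(2) AE_space
      proof eventually_elim
        case (elim w)
        then show ?case using Kb[OF r, of w] u0[of w] by (simp add: norm_mult space_eq mult_right_mono)
      qed
    qed (use ui integrable_norm[OF P(2)] in simp_all)
    also have "\<dots> = C" using u1 by simp
    finally show ?thesis .
  qed
  then show ?thesis using that by blast
qed

text \<open>The estimates of \<open>contraction_approximation\<close> hold in the open ball; they
  extend to the sphere radially, since along each radius a potential of level \<open>r\<close> is a
  power series converging beyond the sphere.\<close>

lemma contraction_polynomial:
  assumes u: "u \<in> densities" and r: "0 < r" "r < 1" and \<epsilon>: "0 < \<epsilon>"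
  obtains q where "polynomial_several q" "mult_bound K B 1 q"
    "\<And>z. norm z \<le> 1 \<Longrightarrow> cmod (1 - 1 / (2 * potential r (moment \<mu> u) z) - q z) \<le> \<epsilon>"
    "\<And>z. norm z \<le> 1 \<Longrightarrow> cmod (q z) \<le> 1"
proof -
  define h where "h = potential r (moment \<mu> u)"
  have r0: "0 \<le> r" using r by simp
  have ws: "word_sq n (moment \<mu> u) \<le> 1" for n
    using u by (intro word_sq_moment_le_1 densities_integrable) (auto simp: densities_def)
  obtain q where q: "polynomial_several q" "mult_bound K B 1 q"
      "\<And>z. z \<in> B \<Longrightarrow> cmod (1 - 1 / (2 * h z) - q z) \<le> \<epsilon>"
    using contraction_approximation[of h \<epsilon>] potential_positive[OF u r0 r(2)]
      approximable_potential[OF ws r] \<epsilon> unfolding h_def by blast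
  have q1: "cmod (q z) \<le> 1" if "z \<in> B" for z using mult_bound_eval[OF q(2) _ that] K_self(1)[OF that] by simp
  define s where "s n = 1 - 1 / real (Suc n)" for n
  have s: "0 \<le> s n" "s n < 1" for n by (auto simp: s_def)
  have slim: "s \<longlonglongrightarrow> 1"
    unfolding s_def[abs_def] using tendsto_diff[OF tendsto_const LIMSEQ_inverse_real_of_nat, of 1]
    by (simp add: inverse_eq_divide)
  have closure: "cmod (1 - 1 / (2 * h z) - q z) \<le> \<epsilon> \<and> cmod (q z) \<le> 1" if z: "norm z \<le> 1" for z
  proof -
    have sB: "s n *\<^sub>R z \<in> B" for n
      using s[of n] z mult_left_mono[OF z s(1)[of n]] by (auto simp: B_eq)
    have cq: "(\<lambda>n. q (s n *\<^sub>R z)) \<longlonglongrightarrow> q z"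
    proof -
      have "isCont q z"
        using continuous_on_polynomial_several[OF q(1), of UNIV] by (simp add: continuous_on_eq_continuous_at)
      moreover have "(\<lambda>n. s n *\<^sub>R z) \<longlonglongrightarrow> 1 *\<^sub>R z" by (intro tendsto_intros slim)
      ultimately show ?thesis using isCont_tendsto_compose by fastforce
    qed
    have ch: "(\<lambda>n. h (s n *\<^sub>R z)) \<longlonglongrightarrow> h z"
    proof -
      define f where "f n = complex_of_real (a n) * (of_real (r ^ n) * word_inner n (mon z) (moment \<mu> u))" for n
      have fs: "summable (\<lambda>n. f n * 1 ^ n)"
        using potential_sums(1)[OF ws r0 r(2) z] sums_summable by (simp add: f_def[abs_def])
      have hs: "h (s *\<^sub>R z) = (\<Sum>n. f n * of_real s ^ n)" for s
        unfolding h_def potential_scaleR by (simp add: potential_def f_def power_mult_distrib mult_ac)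
      \<comment> \<open>The radius lies strictly between 1 and \<open>1 / r\<close>, which puts 1 in
        the interior of the disc of convergence.\<close>
      have sumr: "summable (\<lambda>n. f n * of_real ((1 + 1 / r) / 2) ^ n)"
      proof -
        let ?x = "(1 + 1 / r) / 2"
        have x: "r * ?x < 1" "0 \<le> r * ?x" using r by (auto simp: field_simps)
        have "summable (\<lambda>n. cmod (complex_of_real (a n) * (of_real (r ^ n) * word_inner n (mon z) (moment \<mu> u) * of_real ?x ^ n)))"
        proof (rule summable_K_norm(1)[OF _ x(2,1)])
          fix n
          have "cmod (of_real (r ^ n) * word_inner n (mon z) (moment \<mu> u)) \<le> (r * norm z) ^ n"
            by (rule potential_sums(2)[OF ws r0 r(2) z])
          also have "\<dots> \<le> r ^ n" using r z by (intro power_mono) (auto simp: mult_left_le)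
          finally have "cmod (of_real (r ^ n) * word_inner n (mon z) (moment \<mu> u)) * ?x ^ n \<le> r ^ n * ?x ^ n"
            using r by (intro mult_right_mono) auto
          moreover have "cmod (complex_of_real ?x) = ?x" using r by (simp only: norm_of_real) simp
          ultimately show "cmod (of_real (r ^ n) * word_inner n (mon z) (moment \<mu> u) * of_real ?x ^ n) \<le> (r * ?x) ^ n"
            by (simp only: norm_mult norm_power power_mult_distrib)
        qed
        then show ?thesis unfolding f_def mult.assoc[of "of_real (a _)"] by (rule summable_norm_cancel)
      qed
      have "isCont (\<lambda>x. \<Sum>n. f n * x ^ n) (complex_of_real 1)"
      proof (rule isCont_powser[OF sumr])
        have "1 < (1 + 1 / r) / 2" using r by (simp add: field_simps)
        then show "norm (complex_of_real 1) < norm (complex_of_real ((1 + 1 / r) / 2))"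
          by (simp only: norm_of_real)
      qed
      moreover have "(\<lambda>n. complex_of_real (s n)) \<longlonglongrightarrow> of_real 1" by (intro tendsto_of_real slim)
      ultimately have "(\<lambda>n. \<Sum>k. f k * of_real (s n) ^ k) \<longlonglongrightarrow> (\<Sum>k. f k * of_real 1 ^ k)"
        by (rule isCont_tendsto_compose)
      then show ?thesis using hs[of 1] unfolding hs[symmetric] by simp
    qed
    have hz: "h z \<noteq> 0" using Re_potential_ge_half[OF u r0 r(2) z] unfolding h_def by auto
    have "(\<lambda>n. cmod (1 - 1 / (2 * h (s n *\<^sub>R z)) - q (s n *\<^sub>R z))) \<longlonglongrightarrow> cmod (1 - 1 / (2 * h z) - q z)"
      using hz by (intro tendsto_intros ch cq) auto
    then have "cmod (1 - 1 / (2 * h z) - q z) \<le> \<epsilon>" by (rule LIMSEQ_le_const2) (use q(3)[OF sB] in auto)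
    moreover have "cmod (q z) \<le> 1"
      by (rule LIMSEQ_le_const2[OF tendsto_norm[OF cq]]) (use q1[OF sB] in auto)
    ultimately show ?thesis ..
  qed
  show ?thesis by (rule that[OF q(1,2)]) (use closure in \<open>auto simp: h_def\<close>)
qed

end

section \<open>The implications between the three conditions on the measure\<close>

section \<open>Measures singular to all measures of finite energy\<close>

context pick_sphere_measure
begin

text \<open>Markov's inequality, where the integral of the potential against \<open>m\<close> is a
  mutual energy. Cauchy-Schwarz bounds it by the root of \<open>C * (I + 1) \<le> 2 * C * I\<close>,
  and division by \<open>I / 4\<close> leaves decay of order \<open>1 / sqrt I\<close>.\<close>

lemma measure_large_potential_le:
  fixes m :: "(complex ^ 'd) measure"
  assumes m: "sphere_prob m" and C: "\<And>t. 0 \<le> t \<Longrightarrow> t < 1 \<Longrightarrow> wsq t (moment m (\<lambda>_. 1)) \<le> C"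
    and u: "u \<in> densities" and r: "0 \<le> r" "r < 1" and I: "1 \<le> I" "wsq r (moment \<mu> u) \<le> I + 1"
  shows "measure m {z \<in> sphere 0 1. I / 4 \<le> Re (potential r (moment \<mu> u) z)} \<le> 4 * (sqrt C * sqrt 2 / sqrt I)"
proof -
  interpret m: sphere_measure a B m by (rule sphere_prob_sphere_measure[OF m])
  let ?h = "potential r (moment \<mu> u)"
  have one: "integrable m (\<lambda>_. 1 :: real)" by simp
  note wu = wbounded_moment[OF densities_integrable[OF u]]
  note P = m.wform_moment[OF one wu r, folded potential_eq_wform]
  have hi: "integrable m (\<lambda>z. Re (?h z))" using integrable_Re[OF P(2)] by simp
  have pos: "0 \<le> Re (?h z)" if "z \<in> space m" for z
  proof -
    have "norm z \<le> 1" using that by (simp add: m.space_eq)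
    then have "1 / 2 \<le> Re (?h z)" by (rule Re_potential_ge_half[OF u r])
    then show ?thesis by simp
  qed
  have "measure m {z \<in> space m. I / 4 \<le> Re (?h z)} \<le> (\<integral>z. Re (?h z) \<partial>m) / (I / 4)"
    using I(1) pos by (intro integral_Markov_inequality_measure[OF hi, of "{}"]) auto
  also have "(\<integral>z. Re (?h z) \<partial>m) = Re (wform r (moment m (\<lambda>_. 1)) (moment \<mu> u))"
    using integral_Re[OF P(2)] P(1) by simp
  also have "\<dots> \<le> sqrt (wsq r (moment m (\<lambda>_. 1))) * sqrt (wsq r (moment \<mu> u))"
    using cmod_wform_le[OF m.wbounded_moment[OF one] wu r] complex_Re_le_cmod order_trans by blast
  also have "\<dots> \<le> sqrt C * sqrt (2 * I)"
    using order_trans[OF wsq_nonneg[OF m.wbounded_moment[OF one] r] C[OF r]] C[OF r] I wsq_nonneg[OF wu r]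
    by (intro mult_mono) auto
  finally have "measure m {z \<in> space m. I / 4 \<le> Re (?h z)} \<le> sqrt C * sqrt (2 * I) / (I / 4)"
    using I(1) by (simp add: divide_right_mono)
  also have "\<dots> = 4 * (sqrt C * sqrt 2 * (sqrt I / I))" by (simp add: real_sqrt_mult)
  also have "sqrt I / I = 1 / sqrt I" using I(1) by (simp add: field_simps)
  finally show ?thesis by (simp add: m.space_eq)
qed

lemma carries_no_energyI:
  assumes "\<And>v C. integrable \<mu> v \<Longrightarrow> (\<And>w. 0 \<le> v w) \<Longrightarrow> (\<integral>w. v w \<partial>\<mu>) = 1 \<Longrightarrow>
    (\<And>t. 0 \<le> t \<Longrightarrow> t < 1 \<Longrightarrow> wsq t (moment \<mu> v) \<le> C) \<Longrightarrow> False"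
  shows carries_no_energy
  unfolding carries_no_energy_def using assms by (meson not_le)

text \<open>Taking the \<open>n\<close>-th minimum at least \<open>2 ^ n\<close> makes the measures
  \<open>5 / I n\<close> of the exceptional sets summable, and Borel-Cantelli applies.\<close>

lemma large_potential_sequence:
  assumes pos: "0 < measure \<mu> (space \<mu>)"
    and inf: carries_no_energy
  obtains I r u where "\<And>n. 2 ^ n \<le> I n" "\<And>n. 1/2 \<le> r n" "\<And>n. r n < 1" "\<And>n. u n \<in> densities"
    "\<And>n. wsq (r n) (moment \<mu> (u n)) \<le> I n + 1"
    "AE z in \<mu>. \<forall>\<^sub>F n in sequentially. I n / 4 \<le> Re (potential (r n) (moment \<mu> (u n)) z)"
proof -
  define Q where "Q n I r u \<longleftrightarrow> 2 ^ n \<le> I \<and> 1/2 \<le> r \<and> r < 1 \<and> u \<in> densities \<and> wsq r (moment \<mu> u) \<le> I + 1 \<and>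
      measure \<mu> {z \<in> space \<mu>. Re (potential r (moment \<mu> u) z) < I / 4} \<le> 5 / I" for n I r u
  have "\<exists>I r u. Q n I r u" for n
    by (rule large_potential[OF pos inf, where M = "2 ^ n"]) (simp, auto simp: Q_def)
  then obtain I r u where Q: "\<And>n. Q n (I n) (r n) (u n)" by metis
  then have I: "\<And>n. 2 ^ n \<le> I n" and r: "\<And>n. 1/2 \<le> r n" "\<And>n. r n < 1"
    and u: "\<And>n. u n \<in> densities" "\<And>n. wsq (r n) (moment \<mu> (u n)) \<le> I n + 1"
    and small: "\<And>n. measure \<mu> {z \<in> space \<mu>. Re (potential (r n) (moment \<mu> (u n)) z) < I n / 4} \<le> 5 / I n"
    unfolding Q_def by auto
  define A where "A n = {z \<in> space \<mu>. Re (potential (r n) (moment \<mu> (u n)) z) < I n / 4}" for n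
  have Am: "A n \<in> sets \<mu>" for n unfolding A_def by measurable
  have "summable (\<lambda>n. measure \<mu> (A n))"
  proof (rule summable_comparison_test')
    show "summable (\<lambda>n. 5 * (1/2 :: real) ^ n)" by (intro summable_mult summable_geometric) simp
    fix n
    have "0 < I n" by (rule less_le_trans[OF _ I]) simp
    then have "5 / I n \<le> 5 / 2 ^ n" using I[of n] by (intro divide_left_mono) auto
    then show "norm (measure \<mu> (A n)) \<le> 5 * (1/2) ^ n" using small[of n] by (simp add: A_def power_one_over)
  qed
  then have "AE z in \<mu>. \<forall>\<^sub>F n in sequentially. z \<in> space \<mu> - A n"
    by (intro borel_cantelli_AE1 Am) (auto simp: less_top[symmetric])
  then have "AE z in \<mu>. \<forall>\<^sub>F n in sequentially. I n / 4 \<le> Re (potential (r n) (moment \<mu> (u n)) z)"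
    by eventually_elim (auto simp: A_def elim: eventually_mono)
  then show ?thesis using that I r u by blast
qed

text \<open>The carrier is the set where the potentials, normalised to have energy tending to zero, are
  eventually at least \<open>1/4\<close>; a measure of finite energy does not charge it, by the Cauchy--Schwarz
  inequality for the energy form.\<close>

lemma singular_carrier:
  assumes sing: "\<And>m. sphere_prob m \<Longrightarrow> energy a m < \<infinity> \<Longrightarrow>
    \<exists>A\<in>sets sphere_borel. emeasure \<mu> (sphere 0 1 - A) = 0 \<and> emeasure m A = 0"
  obtains E where "E \<in> sets sphere_borel" "emeasure \<mu> (sphere 0 1 - E) = 0"
    "\<And>m. sphere_prob m \<Longrightarrow> energy a m < \<infinity> \<Longrightarrow> emeasure m E = 0"
proof (cases "measure \<mu> (space \<mu>) = 0")
  case True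
  then show ?thesis by (intro that[of "{}"]) (auto simp: emeasure_eq_measure space_eq)
next
  case False
  then have pos: "0 < measure \<mu> (space \<mu>)" by (simp add: zero_less_measure_iff)
  \<comment> \<open>A density of finite energy would be absolutely continuous and singular with
    respect to \<open>\<mu>\<close> at once, hence of total mass 0.\<close>
  have inf: carries_no_energy
  proof (rule carries_no_energyI)
    fix v C
    assume v: "integrable \<mu> v" "\<And>w. 0 \<le> v w" "(\<integral>w. v w \<partial>\<mu>) = 1"
      and C: "\<And>t. 0 \<le> t \<Longrightarrow> t < 1 \<Longrightarrow> wsq t (moment \<mu> v) \<le> C"
    let ?m = "density \<mu> (\<lambda>w. ennreal (v w))"
    note m = density_prob[OF v]
    interpret m: sphere_measure a B ?m by (rule sphere_prob_sphere_measure[OF m(1)])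
    have "energy a ?m < \<infinity>" unfolding m.finite_energy_iff m(2) using C by blast
    then obtain A where A: "A \<in> sets sphere_borel" "emeasure \<mu> (sphere 0 1 - A) = 0" "emeasure ?m A = 0"
      using sing[OF m(1)] by blast
    have vm: "(\<lambda>w. ennreal (v w)) \<in> borel_measurable \<mu>" using v(1) by auto
    have "sphere 0 1 - A \<in> null_sets \<mu>" using A(1,2) sets_eq space_eq sets.compl_sets[of A \<mu>] by (auto simp: null_sets_def)
    then have "sphere 0 1 - A \<in> null_sets ?m"
      using absolutely_continuousI_density[OF vm] by (auto simp: absolutely_continuous_def)
    moreover have "A \<in> null_sets ?m" using A sets_eq by (auto simp: null_sets_def)
    ultimately have "(sphere 0 1 - A) \<union> A \<in> null_sets ?m" by (rule null_sets.Un)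
    moreover have "(sphere 0 1 - A) \<union> A = space ?m" using A(1) sphere_sets m.space_eq by auto
    ultimately show False
      using m(1) prob_space.emeasure_space_1[of ?m] by (auto simp: sphere_prob_def null_sets_def)
  qed
  obtain I r u where I: "\<And>n. 2 ^ n \<le> I n" and r: "\<And>n. 1/2 \<le> r n" "\<And>n. r n < 1"
    and u: "\<And>n. u n \<in> densities" "\<And>n. wsq (r n) (moment \<mu> (u n)) \<le> I n + 1"
    and AE: "AE z in \<mu>. \<forall>\<^sub>F n in sequentially. I n / 4 \<le> Re (potential (r n) (moment \<mu> (u n)) z)"
    using large_potential_sequence[OF pos inf] by blast
  define D where "D n = {z \<in> sphere 0 1. I n / 4 \<le> Re (potential (r n) (moment \<mu> (u n)) z)}" for n
  have Dm: "D n \<in> sets \<mu>" for n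
    unfolding D_def space_eq[symmetric] by measurable
  define E where "E = (\<Union>N. \<Inter>n\<in>{N..}. D n)"
  have Em: "E \<in> sets \<mu>" unfolding E_def using Dm by (intro sets.countable_UN sets.countable_INT) auto
  show ?thesis
  proof (rule that[of E])
    show "E \<in> sets sphere_borel" using Em sets_eq by simp
    have "AE z in \<mu>. z \<in> E"
      using AE AE_space
    proof eventually_elim
      case (elim z)
      then show ?case by (auto simp: E_def D_def eventually_sequentially space_eq)
    qed
    then show "emeasure \<mu> (sphere 0 1 - E) = 0"
      using Em by (subst (asm) AE_iff_measurable[where N = "sphere 0 1 - E"]) (auto simp: space_eq[symmetric])
    fix m :: "(complex ^ 'd) measure" assume m: "sphere_prob m" "energy a m < \<infinity>"
    interpret m: sphere_measure a B m by (rule sphere_prob_sphere_measure[OF m(1)])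
    obtain C where C: "\<And>t. 0 \<le> t \<Longrightarrow> t < 1 \<Longrightarrow> wsq t (moment m (\<lambda>_. 1)) \<le> C"
      using m(2) unfolding m.finite_energy_iff by blast
    have Dmm: "D n \<in> sets m" for n using Dm sets_eq m.sets_eq by simp
    have null: "measure m (\<Inter>n\<in>{N..}. D n) = 0" for N
    proof -
      have le: "measure m (\<Inter>n\<in>{N..}. D n) \<le> 4 * (sqrt C * sqrt 2 * sqrt ((1/2) ^ n))" if n: "N \<le> n" for n
      proof -
        have I1: "1 \<le> I n" by (rule order_trans[OF one_le_power I]) simp
        have "measure m (\<Inter>n\<in>{N..}. D n) \<le> measure m (D n)"
          using n Dmm by (intro m.finite_measure_mono) auto
        also have "\<dots> \<le> 4 * (sqrt C * sqrt 2 / sqrt (I n))"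
          unfolding D_def using r[of n] I1 by (intro measure_large_potential_le m(1) C u) auto
        also have "\<dots> \<le> 4 * (sqrt C * sqrt 2 / sqrt (2 ^ n))"
        proof -
          have "0 \<le> C" using C[of 0] wsq_nonneg[OF m.wbounded_moment[of "\<lambda>_. 1"], of 0] by simp
          then show ?thesis using I[of n] I1 by (intro mult_left_mono divide_left_mono) auto
        qed
        finally show ?thesis by (simp add: power_one_over real_sqrt_divide)
      qed
      have "(\<lambda>n. 4 * (sqrt C * sqrt 2 * sqrt ((1/2) ^ n))) \<longlonglongrightarrow> 4 * (sqrt C * sqrt 2 * sqrt 0)"
        by (intro tendsto_intros LIMSEQ_realpow_zero) auto
      then have "measure m (\<Inter>n\<in>{N..}. D n) \<le> 4 * (sqrt C * sqrt 2 * sqrt 0)"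
        by (rule LIMSEQ_le_const) (use le in blast)
      then show ?thesis by (intro antisym) simp_all
    qed
    have "(\<Inter>n\<in>{N..}. D n) \<in> null_sets m" for N
      using null Dmm by (auto simp: null_sets_def m.emeasure_eq_measure)
    then have "E \<in> null_sets m" unfolding E_def by (intro null_sets_UN)
    then show "emeasure m E = 0" by auto
  qed
qed

end

section \<open>Henkin measures\<close>

locale pick_space = regular_unitarily_invariant_space H ip a
  for H :: "(complex ^ 'd \<Rightarrow> complex) set"
    and ip :: "(complex ^ 'd \<Rightarrow> complex) \<Rightarrow> (complex ^ 'd \<Rightarrow> complex) \<Rightarrow> complex"
    and a :: "nat \<Rightarrow> real" +
  assumes complete_pick: "complete_pick_kernel (ball (0 :: complex ^ 'd) 1) (ui_kernel a)"
begin

abbreviation \<B> :: "(complex ^ 'd) set" where "\<B> \<equiv> ball 0 1"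

sublocale pick_ball a "\<B>"
  by unfold_locales (use coeff_pos coeff_0 coeff_ratio complete_pick in auto)

lemma hnorm_kernel_comb_eq:
  assumes "finite F" "F \<subseteq> \<B>"
  shows "(hnorm ip (kernel_comb \<B> K F c))\<^sup>2 = kernel_sq K F (\<lambda>w. cnj (c w))"
  unfolding hnorm_kernel_comb[OF assms] kernel_form_def by simp

text \<open>The adjoint of multiplication sends the section at \<open>w\<close> to
  \<open>cnj (\<phi> w)\<close> times itself, so the kernel inequality bounds it on combinations of
  sections; \<open>riesz\<close> then places the product in \<open>H\<close>.\<close>

lemma mult_bound_imp_Mult:
  assumes \<phi>: "mult_bound K \<B> C \<phi>" and C: "0 \<le> C" and f: "f \<in> H"
  shows "(\<lambda>z. \<phi> z * f z) \<in> H" "hnorm ip (\<lambda>z. \<phi> z * f z) \<le> C * hnorm ip f"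
proof -
  have bd: "cmod (\<Sum>w\<in>F. c w * cnj (\<phi> w * f w)) \<le> C * hnorm ip f * hnorm ip (kernel_comb \<B> K F c)"
    if F: "finite F" "F \<subseteq> \<B>" for F c
  proof -
    let ?d = "\<lambda>w. c w * cnj (\<phi> w)"
    have "(\<Sum>w\<in>F. c w * cnj (\<phi> w * f w)) = cnj (ip f (kernel_comb \<B> K F ?d))"
      using F f by (simp add: ip_kernel_comb mult_ac)
    then have "cmod (\<Sum>w\<in>F. c w * cnj (\<phi> w * f w)) \<le> hnorm ip f * hnorm ip (kernel_comb \<B> K F ?d)"
      using Cauchy_Schwarz[OF f kernel_comb_mem[OF F]] by (simp only: complex_mod_cnj)
    also have "\<dots> \<le> hnorm ip f * (C * hnorm ip (kernel_comb \<B> K F c))"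
    proof (rule mult_left_mono[OF _ hnorm_nonneg[OF f]])
      show "hnorm ip (kernel_comb \<B> K F ?d) \<le> C * hnorm ip (kernel_comb \<B> K F c)"
      proof (rule power2_le_imp_le)
        show "(hnorm ip (kernel_comb \<B> K F ?d))\<^sup>2 \<le> (C * hnorm ip (kernel_comb \<B> K F c))\<^sup>2"
        using mult_boundD[OF \<phi> F, of "\<lambda>w. cnj (c w)"]
        by (simp add: hnorm_kernel_comb_eq[OF F] power_mult_distrib)
      qed (use C hnorm_nonneg[OF kernel_comb_mem[OF F]] in simp)
    qed
    finally show ?thesis by (simp add: mult_ac)
  qed
  have "(\<lambda>z. \<phi> z * f z) \<in> H \<and> hnorm ip (\<lambda>z. \<phi> z * f z) \<le> C * hnorm ip f"
    using riesz[OF _ _ bd] zero_outside[OF f] C hnorm_nonneg[OF f] by simp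
  then show "(\<lambda>z. \<phi> z * f z) \<in> H" "hnorm ip (\<lambda>z. \<phi> z * f z) \<le> C * hnorm ip f" by auto
qed

lemma mult_norm_le:
  assumes \<phi>: "mult_bound K \<B> C \<phi>" and C: "0 \<le> C" shows "mult_norm H ip \<phi> \<le> ennreal C"
proof -
  have "\<phi> \<in> Mult H" using mult_bound_imp_Mult(1)[OF \<phi> C] by (simp add: Mult_def)
  moreover have "hnorm ip (\<lambda>z. \<phi> z * f z) \<le> C" if "f \<in> H" "hnorm ip f \<le> 1" for f
    using mult_bound_imp_Mult(2)[OF \<phi> C that(1)] mult_left_mono[OF that(2) C] by simp
  ultimately show ?thesis unfolding mult_norm_def by (auto intro!: SUP_least ennreal_leI)
qed

text \<open>Elements of \<open>H\<close> vanish off the ball, whereas polynomials do not.\<close>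

definition restrict_ball :: "(complex ^ 'd \<Rightarrow> complex) \<Rightarrow> complex ^ 'd \<Rightarrow> complex"
  where "restrict_ball p z = (if z \<in> \<B> then p z else 0)"

text \<open>Because \<open>a 0 = 1\<close>, the section at 0 is the constant 1 on the ball and has
  norm 1; multiplying it by \<open>p\<close> gives both claims.\<close>

lemma restrict_ball_mem:
  assumes "mult_norm H ip p \<le> ennreal M" "0 \<le> M"
  shows "restrict_ball p \<in> H" "hnorm ip (restrict_ball p) \<le> M"
proof -
  have z: "(0 :: complex ^ 'd) \<in> \<B>" by simp
  have K0: "K z 0 = 1" for z
    using powser_zero[of "\<lambda>n. complex_of_real (a n)"] by (simp add: ui_kernel_def coeff_0)
  let ?e = "kernel_section \<B> K 0"
  have eH: "?e \<in> H" by (rule kernel_mem[OF z])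
  have e1: "hnorm ip ?e = 1"
    using hnorm_kernel_section[OF z] hnorm_nonneg[OF eH] by (simp add: K0 power2_eq_1_iff)
  have M: "p \<in> Mult H"
    by (rule ccontr) (use assms(1) in \<open>simp add: mult_norm_def top_unique\<close>)
  have eq: "(\<lambda>z. p z * ?e z) = restrict_ball p" by (auto simp: kernel_section_def restrict_ball_def K0)
  have "(\<lambda>z. p z * ?e z) \<in> H" using M eH by (simp add: Mult_def)
  then show "restrict_ball p \<in> H" unfolding eq .
  have "ennreal (hnorm ip (\<lambda>z. p z * ?e z)) \<le> mult_norm H ip p"
    unfolding mult_norm_def using M eH e1 by (auto intro!: SUP_upper)
  then have "ennreal (hnorm ip (restrict_ball p)) \<le> ennreal M" unfolding eq using assms(1) by (rule order_trans)
  then show "hnorm ip (restrict_ball p) \<le> M" using assms(2) by (simp add: ennreal_le_iff)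
qed

end

locale pick_space_prob = pick_space H ip a
  for H :: "(complex ^ 'd \<Rightarrow> complex) set"
    and ip :: "(complex ^ 'd \<Rightarrow> complex) \<Rightarrow> (complex ^ 'd \<Rightarrow> complex) \<Rightarrow> complex"
    and a :: "nat \<Rightarrow> real" +
  fixes \<mu> :: "(complex ^ 'd) measure"
  assumes prob: "sphere_prob \<mu>"
begin

sublocale sphere_measure a "\<B>" \<mu>
  by (rule sphere_prob_sphere_measure[OF prob])

lemma prob_UNIV: "measure \<mu> (space \<mu>) = 1"
  using prob prob_space.prob_space unfolding sphere_prob_def by blast

abbreviation m :: "'d list \<Rightarrow> complex" where "m \<equiv> moment \<mu> (\<lambda>_. 1)"

text \<open>In degree \<open>n\<close> the two integrals differ through the factor
  \<open>s ^ n - r ^ n\<close>, whose square is at most \<open>(s^2) ^ n - (r^2) ^ n\<close>.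
  Cauchy-Schwarz thus separates the norm of \<open>g\<close> from the increase of the energy between
  the levels \<open>r^2\<close> and \<open>s^2\<close>.\<close>

lemma kernel_comb_integral_diff:
  fixes c :: "complex ^ 'd \<Rightarrow> complex"
  assumes F: "finite F" "F \<subseteq> \<B>" and rs: "0 \<le> r" "r \<le> s" "s < 1"
  defines "g \<equiv> kernel_comb \<B> K F c"
  shows "cmod ((\<integral>z. g (s *\<^sub>R z) \<partial>\<mu>) - (\<integral>z. g (r *\<^sub>R z) \<partial>\<mu>)) \<le>
      hnorm ip g * sqrt (wsq (s\<^sup>2) m - wsq (r\<^sup>2) m)"
    and "0 \<le> t \<Longrightarrow> t < 1 \<Longrightarrow> integrable \<mu> (\<lambda>z. g (t *\<^sub>R z))"
proof -
  have one: "integrable \<mu> (\<lambda>_. 1 :: real)" by simp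
  note wm = wbounded_moment[OF one]
  \<comment> \<open>Coefficient family of \<open>g\<close>: its kernel form is the squared norm of
    \<open>g\<close>, and pairing it with \<open>m\<close> gives the integrals. The conjugate
    appears because sections are antilinear in their base point, degree by degree.\<close>
  define y where "y = comb F (\<lambda>w. cnj (c w))"
  have g: "g (t *\<^sub>R z) = (\<Sum>w\<in>F. c w * wform t (mon z) (mon w))" if t: "0 \<le> t" "t < 1" and z: "norm z = 1" for t z
  proof -
    have "t *\<^sub>R z \<in> \<B>" using t z by simp
    then have "g (t *\<^sub>R z) = (\<Sum>w\<in>F. c w * K (t *\<^sub>R z) w)"
      by (simp add: g_def kernel_comb_def kernel_section_def)
    also have "\<dots> = (\<Sum>w\<in>F. c w * wform t (mon z) (mon w))"
    proof (intro sum.cong refl)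
      fix w assume "w \<in> F"
      then have "norm w \<le> 1" using F(2) by auto
      then show "c w * K (t *\<^sub>R z) w = c w * wform t (mon z) (mon w)"
        using K_eq_wform[of z w t] t z by (simp add: ui_kernel_def hermitian_inner_scaleR)
    qed
    finally show ?thesis .
  qed
  have wi: "integrable \<mu> (\<lambda>z. wform t (mon z) (mon w))" "(\<integral>z. wform t (mon z) (mon w) \<partial>\<mu>) = wform t m (mon w)"
    if t: "0 \<le> t" "t < 1" and w: "w \<in> F" for t w
  proof -
    have "wbounded (mon w)" using w F(2) by (intro wbounded_mon) auto
    from wform_moment[OF one this t] show "integrable \<mu> (\<lambda>z. wform t (mon z) (mon w))"
      "(\<integral>z. wform t (mon z) (mon w) \<partial>\<mu>) = wform t m (mon w)" by auto
  qed
  show gi: "integrable \<mu> (\<lambda>z. g (t *\<^sub>R z))" if t: "0 \<le> t" "t < 1" for t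
  proof -
    have "integrable \<mu> (\<lambda>z. \<Sum>w\<in>F. c w * wform t (mon z) (mon w))"
      using wi(1)[OF t] by (intro Bochner_Integration.integrable_sum integrable_mult_right) auto
    then show ?thesis using g[OF t]
      by (subst Bochner_Integration.integrable_cong[OF refl]) (auto simp: space_eq)
  qed
  have sums: "(\<lambda>n. of_real (a n) * (of_real (t ^ n) * word_inner n m y)) sums (\<integral>z. g (t *\<^sub>R z) \<partial>\<mu>)"
    if t: "0 \<le> t" "t < 1" for t
  proof -
    have "(\<integral>z. g (t *\<^sub>R z) \<partial>\<mu>) = (\<integral>z. (\<Sum>w\<in>F. c w * wform t (mon z) (mon w)) \<partial>\<mu>)"
      using g[OF t] by (intro Bochner_Integration.integral_cong refl) (simp add: space_eq)
    also have "\<dots> = (\<Sum>w\<in>F. \<integral>z. c w * wform t (mon z) (mon w) \<partial>\<mu>)"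
      using wi(1)[OF t] by (intro Bochner_Integration.integral_sum integrable_mult_right) auto
    also have "\<dots> = (\<Sum>w\<in>F. c w * wform t m (mon w))"
      using wi(2)[OF t] by (intro sum.cong refl) (simp only: integral_mult_right_zero)
    finally have e: "(\<integral>z. g (t *\<^sub>R z) \<partial>\<mu>) = (\<Sum>w\<in>F. c w * wform t m (mon w))" .
    have "(\<lambda>n. \<Sum>w\<in>F. c w * (of_real (a n) * (of_real (t ^ n) * word_inner n m (mon w)))) sums
        (\<Sum>w\<in>F. c w * wform t m (mon w))"
      using F(2) t by (intro sums_sum sums_mult wform_sums(1) wm wbounded_mon) auto
    moreover have "(\<Sum>w\<in>F. c w * (of_real (a n) * (of_real (t ^ n) * word_inner n m (mon w)))) =
        of_real (a n) * (of_real (t ^ n) * word_inner n m y)" for n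
      unfolding y_def comb_def word_inner_def cnj_sum sum_distrib_left
      by (subst sum.swap) (simp add: mult_ac)
    ultimately show ?thesis unfolding e by simp
  qed
  have s2: "0 \<le> s\<^sup>2" "s\<^sup>2 < 1" "0 \<le> r\<^sup>2" "r\<^sup>2 < 1"
    using rs by (auto simp: power_less_one_iff abs_square_less_1)
  have diff: "(\<lambda>n. of_real (a n) * (of_real (s ^ n) * word_inner n m y) - of_real (a n) * (of_real (r ^ n) * word_inner n m y)) sums
      ((\<integral>z. g (s *\<^sub>R z) \<partial>\<mu>) - (\<integral>z. g (r *\<^sub>R z) \<partial>\<mu>))"
    using rs by (intro sums_diff sums) auto
  have dl: "0 \<le> wsq (s\<^sup>2) m - wsq (r\<^sup>2) m"
    using wsq_mono[OF wm s2(3) _ s2(2)] rs by (simp add: power_mono)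
  have hn: "(hnorm ip g)\<^sup>2 = kernel_sq K F (\<lambda>w. cnj (c w))"
    unfolding g_def by (rule hnorm_kernel_comb_eq[OF F])
  have main: "2 * cmod ((\<integral>z. g (s *\<^sub>R z) \<partial>\<mu>) - (\<integral>z. g (r *\<^sub>R z) \<partial>\<mu>)) \<le>
      \<theta> * (hnorm ip g)\<^sup>2 + (wsq (s\<^sup>2) m - wsq (r\<^sup>2) m) / \<theta>" if \<theta>: "0 < \<theta>" for \<theta>
  proof -
    let ?d = "\<lambda>n. of_real (a n) * (of_real (s ^ n) * word_inner n m y) - of_real (a n) * (of_real (r ^ n) * word_inner n m y)"
    let ?b = "\<lambda>n. (\<theta> * (a n * word_sq n y) +
        (a n * ((s\<^sup>2) ^ n * word_sq n m) - a n * ((r\<^sup>2) ^ n * word_sq n m)) / \<theta>) / 2"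
    have bs: "?b sums ((\<theta> * (hnorm ip g)\<^sup>2 + (wsq (s\<^sup>2) m - wsq (r\<^sup>2) m) / \<theta>) / 2)"
      unfolding hn y_def
      by (intro sums_divide sums_add sums_mult sums_diff wsq_sums wm s2 kernel_sq_sums F)
    have le: "cmod (?d n) \<le> ?b n" for n
    proof -
      have mono: "r ^ n \<le> s ^ n" using rs by (intro power_mono)
      have sq: "(s ^ n - r ^ n)\<^sup>2 \<le> (s\<^sup>2) ^ n - (r\<^sup>2) ^ n"
      proof -
        have "0 \<le> 2 * r ^ n * (s ^ n - r ^ n)" using rs mono by simp
        then show ?thesis by (simp add: power2_eq_square power_mult_distrib algebra_simps)
      qed
      have wn: "word_inner n y (\<lambda>xs. of_real (s ^ n - r ^ n) * m xs) = of_real (s ^ n - r ^ n) * cnj (word_inner n m y)"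
        by (simp add: word_inner_def sum_distrib_left mult_ac)
      have ws: "word_sq n (\<lambda>xs. of_real (s ^ n - r ^ n) * m xs) = (s ^ n - r ^ n)\<^sup>2 * word_sq n m"
        unfolding word_sq_def sum_distrib_left norm_mult norm_of_real by (simp add: power_mult_distrib)
      have "?d n = of_real (a n) * (of_real (s ^ n - r ^ n) * word_inner n m y)" by (simp add: algebra_simps)
      then have "2 * cmod (?d n) = a n * (2 * cmod (word_inner n y (\<lambda>xs. of_real (s ^ n - r ^ n) * m xs)))"
        using a_pos[of n] unfolding wn by (simp add: norm_mult)
      also have "\<dots> \<le> a n * (\<theta> * word_sq n y + (s ^ n - r ^ n)\<^sup>2 * word_sq n m / \<theta>)"
        using two_cmod_word_inner_le[OF \<theta>, of n y "\<lambda>xs. of_real (s ^ n - r ^ n) * m xs"] a_pos[of n]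
        unfolding ws by (intro mult_left_mono) auto
      also have "\<dots> \<le> a n * (\<theta> * word_sq n y + ((s\<^sup>2) ^ n - (r\<^sup>2) ^ n) * word_sq n m / \<theta>)"
        using sq a_pos[of n] \<theta> word_sq_nonneg[of n m]
        by (intro mult_left_mono add_left_mono divide_right_mono mult_right_mono) auto
      finally show ?thesis by (simp add: algebra_simps diff_divide_distrib)
    qed
    have sn: "summable (\<lambda>n. cmod (?d n))"
      by (rule summable_comparison_test'[OF sums_summable[OF bs], of 0]) (use le in simp)
    have "cmod (\<Sum>n. ?d n) \<le> (\<theta> * (hnorm ip g)\<^sup>2 + (wsq (s\<^sup>2) m - wsq (r\<^sup>2) m) / \<theta>) / 2"
      by (rule order_trans[OF summable_norm[OF sn] sums_le[OF le summable_sums[OF sn] bs]])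
    then show ?thesis unfolding sums_unique[OF diff, symmetric] by simp
  qed
  have "cmod ((\<integral>z. g (s *\<^sub>R z) \<partial>\<mu>) - (\<integral>z. g (r *\<^sub>R z) \<partial>\<mu>)) \<le>
      sqrt ((hnorm ip g)\<^sup>2) * sqrt (wsq (s\<^sup>2) m - wsq (r\<^sup>2) m)"
    by (rule le_sqrt_mult_sqrtI[OF _ dl main]) simp
  moreover have "0 \<le> hnorm ip g" unfolding g_def by (intro hnorm_nonneg kernel_comb_mem F)
  ultimately show "cmod ((\<integral>z. g (s *\<^sub>R z) \<partial>\<mu>) - (\<integral>z. g (r *\<^sub>R z) \<partial>\<mu>)) \<le>
      hnorm ip g * sqrt (wsq (s\<^sup>2) m - wsq (r\<^sup>2) m)" by simp
qed

lemma cmod_eval_scaled_le: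
  assumes f: "f \<in> H" and t: "0 \<le> t" "t < 1" and z: "norm z = 1"
  shows "cmod (f (t *\<^sub>R z)) \<le> hnorm ip f * sqrt (kval (t\<^sup>2))"
proof -
  have tz: "t *\<^sub>R z \<in> \<B>" using t z by simp
  have "Re (K (t *\<^sub>R z) (t *\<^sub>R z)) \<le> kval (t\<^sup>2)"
    using cmod_K_le[of "t *\<^sub>R z" "t *\<^sub>R z" "t\<^sup>2"] t z complex_Re_le_cmod order_trans
    by (fastforce simp: hermitian_inner_self power_less_one_iff abs_square_less_1 norm_power)
  then have "hnorm ip (kernel_section \<B> K (t *\<^sub>R z)) \<le> sqrt (kval (t\<^sup>2))"
    using hnorm_kernel_section[OF tz] by (intro real_le_rsqrt) simp
  then show ?thesis using norm_eval_le[OF f tz] hnorm_nonneg[OF f] by (meson mult_left_mono order_trans)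
qed

lemma polynomial_integrable:
  assumes "polynomial_several p" shows "integrable \<mu> (\<lambda>z. p (t *\<^sub>R z))"
proof -
  have c: "continuous_on UNIV (\<lambda>z. p (t *\<^sub>R z))"
    by (intro continuous_on_compose2[OF continuous_on_polynomial_several[OF assms, of UNIV]] continuous_intros) auto
  have "compact ((\<lambda>z. p (t *\<^sub>R z)) ` sphere 0 1)"
    by (intro compact_continuous_image continuous_on_subset[OF c]) auto
  then obtain C where C: "\<And>z. z \<in> sphere 0 1 \<Longrightarrow> cmod (p (t *\<^sub>R z)) \<le> C"
    using compact_imp_bounded bounded_iff by (metis (no_types, lifting) imageI)
  show ?thesis
    by (rule integrable_const_bound[of _ C]) (use C measurable_continuous[OF c] in \<open>auto simp: space_eq\<close>)
qed

text \<open>Density of kernel combinations carries the estimate over to polynomials: at fixed radii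
  below 1, point evaluations are uniformly bounded, so a small change in \<open>H\<close> changes
  each integral little.\<close>

lemma polynomial_integral_diff:
  assumes p: "polynomial_several p" "restrict_ball p \<in> H" and rs: "0 \<le> r" "r \<le> s" "s < 1"
  shows "cmod ((\<integral>z. p (s *\<^sub>R z) \<partial>\<mu>) - (\<integral>z. p (r *\<^sub>R z) \<partial>\<mu>)) \<le>
      hnorm ip (restrict_ball p) * sqrt (wsq (s\<^sup>2) m - wsq (r\<^sup>2) m)"
proof (rule field_le_epsilon)
  let ?f = "restrict_ball p" and ?\<delta> = "sqrt (wsq (s\<^sup>2) m - wsq (r\<^sup>2) m)"
  fix e :: real assume e: "0 < e"
  have r1: "r < 1" "0 \<le> s" using rs by auto
  \<comment> \<open>Total cost of replacing \<open>p\<close> by \<open>g\<close>: one evaluation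
    bound for each radius and one for the norm of \<open>g\<close>. The final 1 keeps
    \<open>Q\<close> positive.\<close>
  define Q where "Q = sqrt (kval (s\<^sup>2)) + sqrt (kval (r\<^sup>2)) + \<bar>?\<delta>\<bar> + 1"
  have kv: "0 \<le> kval (t\<^sup>2)" if "0 \<le> t" "t < 1" for t
    using kval_ge_1[of "t\<^sup>2"] that by (simp add: power_less_one_iff abs_square_less_1)
  have Q: "0 < Q" unfolding Q_def using kv rs r1 by (simp add: add_nonneg_pos)
  define \<epsilon> where "\<epsilon> = e / Q"
  have \<epsilon>: "0 < \<epsilon>" "\<epsilon> * Q = e" using e Q by (auto simp: \<epsilon>_def)
  obtain F c where F: "finite F" "F \<subseteq> \<B>" and close: "hnorm ip (\<lambda>x. kernel_comb \<B> K F c x - ?f x) < \<epsilon>"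
    using kernel_comb_dense[OF p(2) \<epsilon>(1)] by blast
  define g where "g = kernel_comb \<B> K F c"
  have gH: "g \<in> H" unfolding g_def by (rule kernel_comb_mem[OF F])
  have dH: "(\<lambda>x. g x - ?f x) \<in> H" by (rule diff_mem[OF gH p(2)])
  have close: "hnorm ip (\<lambda>x. g x - ?f x) < \<epsilon>" using close by (simp add: g_def)
  have ap: "cmod ((\<integral>z. p (t *\<^sub>R z) \<partial>\<mu>) - (\<integral>z. g (t *\<^sub>R z) \<partial>\<mu>)) \<le> \<epsilon> * sqrt (kval (t\<^sup>2))"
    if t: "0 \<le> t" "t < 1" for t
  proof -
    have gi: "integrable \<mu> (\<lambda>z. g (t *\<^sub>R z))"
      unfolding g_def by (rule kernel_comb_integral_diff(2)[OF F rs t])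
    have b: "cmod (p (t *\<^sub>R z) - g (t *\<^sub>R z)) \<le> \<epsilon> * sqrt (kval (t\<^sup>2))" if z: "z \<in> space \<mu>" for z
    proof -
      have z1: "norm z = 1" using z by (simp add: space_eq)
      then have "p (t *\<^sub>R z) = ?f (t *\<^sub>R z)" using t by (simp add: restrict_ball_def)
      then have "cmod (p (t *\<^sub>R z) - g (t *\<^sub>R z)) = cmod (g (t *\<^sub>R z) - ?f (t *\<^sub>R z))"
        by (simp add: norm_minus_commute)
      also have "\<dots> \<le> hnorm ip (\<lambda>x. g x - ?f x) * sqrt (kval (t\<^sup>2))" by (rule cmod_eval_scaled_le[OF dH t z1])
      also have "\<dots> \<le> \<epsilon> * sqrt (kval (t\<^sup>2))" using close kv[OF t] by (intro mult_right_mono) auto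
      finally show ?thesis .
    qed
    have "(\<integral>z. p (t *\<^sub>R z) \<partial>\<mu>) - (\<integral>z. g (t *\<^sub>R z) \<partial>\<mu>) = (\<integral>z. p (t *\<^sub>R z) - g (t *\<^sub>R z) \<partial>\<mu>)"
      using polynomial_integrable[OF p(1)] gi by simp
    also have "cmod \<dots> \<le> (\<integral>z. cmod (p (t *\<^sub>R z) - g (t *\<^sub>R z)) \<partial>\<mu>)" by (rule integral_norm_bound)
    also have "\<dots> \<le> (\<integral>z. \<epsilon> * sqrt (kval (t\<^sup>2)) \<partial>\<mu>)"
      using b polynomial_integrable[OF p(1)] gi by (intro integral_mono integrable_norm) auto
    also have "\<dots> = \<epsilon> * sqrt (kval (t\<^sup>2))" by (simp add: prob_UNIV)
    finally show ?thesis .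
  qed
  have "cmod ((\<integral>z. g (s *\<^sub>R z) \<partial>\<mu>) - (\<integral>z. g (r *\<^sub>R z) \<partial>\<mu>)) \<le> hnorm ip g * ?\<delta>"
    unfolding g_def by (rule kernel_comb_integral_diff(1)[OF F rs])
  also have "\<dots> \<le> hnorm ip ?f * ?\<delta> + \<epsilon> * \<bar>?\<delta>\<bar>"
  proof -
    have "hnorm ip g \<le> hnorm ip ?f + \<epsilon>" using hnorm_triangle[OF p(2) dH] close by simp
    moreover have "0 \<le> ?\<delta>"
      using wsq_mono[OF wbounded_moment[of "\<lambda>_. 1"], of "r\<^sup>2" "s\<^sup>2"] rs r1
      by (simp add: power_mono power_less_one_iff abs_square_less_1)
    ultimately have "hnorm ip g * ?\<delta> \<le> (hnorm ip ?f + \<epsilon>) * ?\<delta>" by (intro mult_right_mono)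
    then show ?thesis using \<open>0 \<le> ?\<delta>\<close> by (simp add: distrib_right)
  qed
  finally have mid: "cmod ((\<integral>z. g (s *\<^sub>R z) \<partial>\<mu>) - (\<integral>z. g (r *\<^sub>R z) \<partial>\<mu>)) \<le> hnorm ip ?f * ?\<delta> + \<epsilon> * \<bar>?\<delta>\<bar>" .
  have tri: "cmod (x - y) \<le> cmod (x - x') + cmod (x' - y') + cmod (y - y')" for x y x' y' :: complex
    using norm_triangle_ineq[of "x - x'" "(x' - y') + (y' - y)"] norm_triangle_ineq[of "x' - y'" "y' - y"]
    by (simp add: norm_minus_commute[of y y'])
  have "cmod ((\<integral>z. p (s *\<^sub>R z) \<partial>\<mu>) - (\<integral>z. p (r *\<^sub>R z) \<partial>\<mu>)) \<le>
      \<epsilon> * sqrt (kval (s\<^sup>2)) + (hnorm ip ?f * ?\<delta> + \<epsilon> * \<bar>?\<delta>\<bar>) + \<epsilon> * sqrt (kval (r\<^sup>2))"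
    by (rule order_trans[OF tri[of _ _ "\<integral>z. g (s *\<^sub>R z) \<partial>\<mu>" "\<integral>z. g (r *\<^sub>R z) \<partial>\<mu>"]])
      (intro add_mono ap mid rs r1)
  also have "\<dots> \<le> hnorm ip ?f * ?\<delta> + \<epsilon> * Q" using \<epsilon>(1) unfolding Q_def by (simp add: algebra_simps)
  finally show "cmod ((\<integral>z. p (s *\<^sub>R z) \<partial>\<mu>) - (\<integral>z. p (r *\<^sub>R z) \<partial>\<mu>)) \<le> hnorm ip ?f * ?\<delta> + e"
    using \<epsilon>(2) by simp
qed

text \<open>The integrals over the sphere and at radius \<open>r\<close> differ by at most
  \<open>M\<close> times the root of the energy still missing at level \<open>r^2\<close>, uniformly
  in \<open>n\<close>. For fixed \<open>r\<close>, dominated convergence sends the integrals at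
  radius \<open>r\<close> to 0.\<close>

lemma finite_energy_henkin:
  assumes "energy a \<mu> < \<infinity>" shows "henkin H ip (complex_measure_of \<mu>)"
  unfolding henkin_def
proof (intro conjI allI impI)
  have \<mu>: "finite_measure \<mu>" by (rule finite_measure_axioms)
  show "complex_measure sphere_borel (complex_measure_of \<mu>)" by (rule complex_measure_of[OF \<mu> sets_eq])
  fix p :: "nat \<Rightarrow> complex ^ 'd \<Rightarrow> complex"
  assume p: "\<forall>n. polynomial_several (p n)" and bd: "(SUP n. mult_norm H ip (p n)) < \<infinity>"
    and lim: "\<forall>z\<in>\<B>. (\<lambda>n. p n z) \<longlonglongrightarrow> 0"
  obtain M where M: "(SUP n. mult_norm H ip (p n)) = ennreal M" "0 \<le> M"
    using bd by (cases "SUP n. mult_norm H ip (p n)") auto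
  have pM: "mult_norm H ip (p n) \<le> ennreal M" for n unfolding M(1)[symmetric] by (rule SUP_upper) simp
  note pH = restrict_ball_mem[OF pM M(2)]
  obtain C where C: "\<And>t. 0 \<le> t \<Longrightarrow> t < 1 \<Longrightarrow> wsq t m \<le> C" using assms unfolding finite_energy_iff by blast
  define L where "L = Sup ((\<lambda>t. wsq t m) ` {0..<1})"
  have bdd: "bdd_above ((\<lambda>t. wsq t m) ` {0..<1})" using C by (intro bdd_aboveI[of _ C]) auto
  have L: "wsq t m \<le> L" if "0 \<le> t" "t < 1" for t unfolding L_def using that by (intro cSUP_upper bdd) auto
  have diff: "cmod ((\<integral>z. p n z \<partial>\<mu>) - (\<integral>z. p n (r *\<^sub>R z) \<partial>\<mu>)) \<le> M * sqrt (L - wsq (r\<^sup>2) m)"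
    if r: "0 \<le> r" "r < 1" for n r
  proof -
    define s where "s k = 1 - 1 / real (Suc k)" for k
    have s: "0 \<le> s k" "s k < 1" for k by (auto simp: s_def)
    have slim: "s \<longlonglongrightarrow> 1"
      unfolding s_def[abs_def] using tendsto_diff[OF tendsto_const LIMSEQ_inverse_real_of_nat, of 1]
      by (simp add: inverse_eq_divide)
    have c: "continuous_on UNIV (p n)" using p continuous_on_polynomial_several by blast
    have "bounded (p n ` cball 0 1)"
      by (intro compact_imp_bounded compact_continuous_image continuous_on_subset[OF c]) auto
    then obtain D where D: "\<And>z. norm z \<le> 1 \<Longrightarrow> cmod (p n z) \<le> D"
      unfolding bounded_iff by (metis image_eqI mem_cball_0)
    have "(\<lambda>k. \<integral>z. p n (s k *\<^sub>R z) \<partial>\<mu>) \<longlonglongrightarrow> (\<integral>z. p n z \<partial>\<mu>)"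
    proof (rule integral_dominated_convergence[where w = "\<lambda>_. D"])
      show "p n \<in> borel_measurable \<mu>" by (rule measurable_continuous[OF c])
      show "(\<lambda>z. p n (s k *\<^sub>R z)) \<in> borel_measurable \<mu>" for k
        using p by (intro borel_measurable_integrable polynomial_integrable) blast
      show "AE z in \<mu>. (\<lambda>k. p n (s k *\<^sub>R z)) \<longlonglongrightarrow> p n z"
      proof (rule AE_I2)
        fix z :: "complex ^ 'd"
        have "(\<lambda>k. s k *\<^sub>R z) \<longlonglongrightarrow> 1 *\<^sub>R z" by (intro tendsto_intros slim)
        moreover have "isCont (p n) (1 *\<^sub>R z)" using c by (simp add: continuous_on_eq_continuous_at)
        ultimately show "(\<lambda>k. p n (s k *\<^sub>R z)) \<longlonglongrightarrow> p n z" using isCont_tendsto_compose by fastforce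
      qed
      show "AE z in \<mu>. norm (p n (s k *\<^sub>R z)) \<le> D" for k
      proof (rule AE_I2)
        fix z assume "z \<in> space \<mu>"
        then have "norm (s k *\<^sub>R z) \<le> 1" using s[of k] by (simp add: space_eq)
        then show "norm (p n (s k *\<^sub>R z)) \<le> D" by (rule D)
      qed
    qed simp
    then have "(\<lambda>k. cmod ((\<integral>z. p n (s k *\<^sub>R z) \<partial>\<mu>) - (\<integral>z. p n (r *\<^sub>R z) \<partial>\<mu>))) \<longlonglongrightarrow>
        cmod ((\<integral>z. p n z \<partial>\<mu>) - (\<integral>z. p n (r *\<^sub>R z) \<partial>\<mu>))"
      by (intro tendsto_intros)
    then show ?thesis
    proof (rule tendsto_upperbound)
      have "\<forall>\<^sub>F k in sequentially. r < s k" by (rule order_tendstoD(1)[OF slim r(2)])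
      then show "\<forall>\<^sub>F k in sequentially. cmod ((\<integral>z. p n (s k *\<^sub>R z) \<partial>\<mu>) - (\<integral>z. p n (r *\<^sub>R z) \<partial>\<mu>)) \<le> M * sqrt (L - wsq (r\<^sup>2) m)"
      proof eventually_elim
        case (elim k)
        have "cmod ((\<integral>z. p n (s k *\<^sub>R z) \<partial>\<mu>) - (\<integral>z. p n (r *\<^sub>R z) \<partial>\<mu>)) \<le>
            hnorm ip (restrict_ball (p n)) * sqrt (wsq ((s k)\<^sup>2) m - wsq (r\<^sup>2) m)"
          using p elim r s[of k] by (intro polynomial_integral_diff pH) auto
        also have "\<dots> \<le> M * sqrt (L - wsq (r\<^sup>2) m)"
        proof (rule mult_mono)
          have "wsq (r\<^sup>2) m \<le> wsq ((s k)\<^sup>2) m"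
            using elim r s[of k] by (intro wsq_mono wbounded_moment) (auto simp: power_mono power_less_one_iff abs_square_less_1)
          then show "0 \<le> sqrt (wsq ((s k)\<^sup>2) m - wsq (r\<^sup>2) m)" by simp
          have "wsq ((s k)\<^sup>2) m \<le> L" using s[of k] by (intro L) (auto simp: power_less_one_iff abs_square_less_1)
          then show "sqrt (wsq ((s k)\<^sup>2) m - wsq (r\<^sup>2) m) \<le> sqrt (L - wsq (r\<^sup>2) m)" by simp
        qed (use pH M in auto)
        finally show ?case .
      qed
    qed simp
  qed
  have rlim: "(\<lambda>n. \<integral>z. p n (r *\<^sub>R z) \<partial>\<mu>) \<longlonglongrightarrow> 0" if r: "0 \<le> r" "r < 1" for r
  proof -
    have "(\<lambda>n. \<integral>z. p n (r *\<^sub>R z) \<partial>\<mu>) \<longlonglongrightarrow> (\<integral>z. 0 \<partial>\<mu>)"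
    proof (rule integral_dominated_convergence[where w = "\<lambda>_. M * sqrt (kval (r\<^sup>2))"])
      show "(\<lambda>z. p n (r *\<^sub>R z)) \<in> borel_measurable \<mu>" for n
        using p by (intro borel_measurable_integrable polynomial_integrable) blast
      show "AE z in \<mu>. (\<lambda>n. p n (r *\<^sub>R z)) \<longlonglongrightarrow> 0"
        using lim r by (intro AE_I2) (simp add: space_eq)
      show "AE z in \<mu>. norm (p n (r *\<^sub>R z)) \<le> M * sqrt (kval (r\<^sup>2))" for n
      proof (rule AE_I2)
        fix z assume "z \<in> space \<mu>"
        then have z: "norm z = 1" by (simp add: space_eq)
        have "cmod (restrict_ball (p n) (r *\<^sub>R z)) \<le> hnorm ip (restrict_ball (p n)) * sqrt (kval (r\<^sup>2))"
          by (rule cmod_eval_scaled_le[OF pH(1) r z])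
        also have "\<dots> \<le> M * sqrt (kval (r\<^sup>2))"
          using kval_ge_1[of "r\<^sup>2"] r by (intro mult_right_mono pH(2)) (auto simp: power_less_one_iff abs_square_less_1)
        finally show "norm (p n (r *\<^sub>R z)) \<le> M * sqrt (kval (r\<^sup>2))" using r z by (simp add: restrict_ball_def)
      qed
    qed auto
    then show ?thesis by simp
  qed
  have "(\<lambda>n. \<integral>z. p n z \<partial>\<mu>) \<longlonglongrightarrow> 0"
  proof (rule LIMSEQ_I)
    fix e :: real assume e: "0 < e"
    \<comment> \<open>Chosen so that \<open>M * sqrt \<eta> \<le> e / 2\<close>;
      \<open>M + 1\<close> avoids division by 0.\<close>
    define \<eta> where "\<eta> = (e / (2 * (M + 1)))\<^sup>2"
    have \<eta>: "0 < \<eta>" using e M(2) by (simp add: \<eta>_def)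
    then obtain t where t: "t \<in> {0..<1}" "L - \<eta> < wsq t m"
      using less_cSUP_iff[OF _ bdd, of "L - \<eta>"] unfolding L_def by auto
    define r where "r = sqrt t"
    have r: "0 \<le> r" "r < 1" "r\<^sup>2 = t" using t by (auto simp: r_def)
    have "sqrt (L - wsq (r\<^sup>2) m) \<le> sqrt \<eta>" using t r by (intro real_sqrt_le_mono) simp
    also have "sqrt \<eta> = e / (2 * (M + 1))" using e M(2) by (simp add: \<eta>_def)
    finally have "M * sqrt (L - wsq (r\<^sup>2) m) \<le> M * (e / (2 * (M + 1)))" using M(2) by (intro mult_left_mono)
    also have "\<dots> \<le> e / 2" using M(2) e by (simp add: field_simps)
    finally have half: "M * sqrt (L - wsq (r\<^sup>2) m) \<le> e / 2" .
    obtain N where N: "\<And>n. N \<le> n \<Longrightarrow> cmod (\<integral>z. p n (r *\<^sub>R z) \<partial>\<mu>) < e / 2"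
      using LIMSEQ_D[OF rlim[OF r(1,2)], of "e/2"] e by auto
    have "norm ((\<integral>z. p n z \<partial>\<mu>) - 0) < e" if "N \<le> n" for n
      using diff[OF r(1,2), of n] half N[OF that]
        norm_triangle_ineq[of "(\<integral>z. p n z \<partial>\<mu>) - (\<integral>z. p n (r *\<^sub>R z) \<partial>\<mu>)" "\<integral>z. p n (r *\<^sub>R z) \<partial>\<mu>"] by simp
    then show "\<exists>N. \<forall>n\<ge>N. norm ((\<integral>z. p n z \<partial>\<mu>) - 0) < e" by blast
  qed
  then show "(\<lambda>n. complex_measure_integral sphere_borel (complex_measure_of \<mu>) (p n)) \<longlonglongrightarrow> 0"
    unfolding complex_measure_integral_of[OF \<mu> sets_eq] .
qed

end

section \<open>Compact sets of capacity zero are null for Henkin measures\<close>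

lemma cmod_le_variation:
  assumes \<nu>: "complex_measure M \<nu>" and A: "A \<in> sets M" shows "cmod (\<nu> A) \<le> measure (variation M \<nu>) A"
proof -
  interpret J1: finite_measure "jordan_pos M (\<lambda>A. Re (\<nu> A))" by (intro finite_measure_jordan_pos signed_measures \<nu>)
  interpret J2: finite_measure "jordan_pos M (\<lambda>A. - Re (\<nu> A))" by (intro finite_measure_jordan_pos signed_measures \<nu>)
  interpret J3: finite_measure "jordan_pos M (\<lambda>A. Im (\<nu> A))" by (intro finite_measure_jordan_pos signed_measures \<nu>)
  interpret J4: finite_measure "jordan_pos M (\<lambda>A. - Im (\<nu> A))" by (intro finite_measure_jordan_pos signed_measures \<nu>)
  let ?j1 = "measure (jordan_pos M (\<lambda>A. Re (\<nu> A))) A" and ?j2 = "measure (jordan_pos M (\<lambda>A. - Re (\<nu> A))) A"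
    and ?j3 = "measure (jordan_pos M (\<lambda>A. Im (\<nu> A))) A" and ?j4 = "measure (jordan_pos M (\<lambda>A. - Im (\<nu> A))) A"
  have "cmod (\<nu> A) = cmod (Complex (?j1 - ?j2) (?j3 - ?j4))"
    by (subst complex_measure_jordan[OF \<nu> A]) (simp only: Complex_eq of_real_diff)
  also have "\<dots> \<le> \<bar>?j1 - ?j2\<bar> + \<bar>?j3 - ?j4\<bar>" using cmod_le[of "Complex (?j1 - ?j2) (?j3 - ?j4)"] by simp
  also have "\<dots> \<le> ?j1 + ?j2 + (?j3 + ?j4)"
    using measure_nonneg[of "jordan_pos M (\<lambda>A. Re (\<nu> A))" A] measure_nonneg[of "jordan_pos M (\<lambda>A. - Re (\<nu> A))" A]
      measure_nonneg[of "jordan_pos M (\<lambda>A. Im (\<nu> A))" A] measure_nonneg[of "jordan_pos M (\<lambda>A. - Im (\<nu> A))" A]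
    by linarith
  also have "\<dots> = measure (variation M \<nu>) A"
    by (rule measure_eq_emeasure_eq_ennreal[symmetric])
      (simp_all add: emeasure_variation[OF A] J1.emeasure_eq_measure J2.emeasure_eq_measure
        J3.emeasure_eq_measure J4.emeasure_eq_measure)
  finally show ?thesis .
qed

lemma complex_measure_diff:
  assumes "complex_measure M \<nu>" "A \<in> sets M" "B \<in> sets M" "B \<subseteq> A"
  shows "\<nu> (A - B) = \<nu> A - \<nu> B"
  using signed_measure_diff[OF signed_measure_Re_Im(1)[OF assms(1)] assms(2-4)]
    signed_measure_diff[OF signed_measure_Re_Im(2)[OF assms(1)] assms(2-4)]
  by (simp add: complex_eq_iff)

text \<open>With \<open>w = 1 / h\<close> the half-plane \<open>Re h \<ge> 1 / 2\<close> becomes a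
  disc in which |w|^2 is at most 2 Re w, and |1 - w / 2|^2 expands to 1 - Re w + |w|^2 / 4.\<close>

lemma norm_one_minus_half_reciprocal:
  assumes "1 / 2 \<le> Re h" shows "(cmod (1 - 1 / (2 * h)))\<^sup>2 \<le> 1 - (1 / cmod h)\<^sup>2 / 4"
proof -
  define w where "w = 1 / h"
  have h: "h \<noteq> 0" using assms by auto
  have "(1 / 2) / (cmod h)\<^sup>2 \<le> Re h / (cmod h)\<^sup>2" using assms by (intro divide_right_mono) auto
  also have "\<dots> = Re w" by (simp add: w_def Re_divide cmod_power2)
  finally have "(cmod w)\<^sup>2 / 2 \<le> Re w" by (simp add: w_def norm_divide power_divide)
  moreover have "(cmod (1 - w / 2))\<^sup>2 = 1 - Re w + (cmod w)\<^sup>2 / 4"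
    unfolding cmod_power2 by (simp add: power2_eq_square algebra_simps)
  moreover have "1 - 1 / (2 * h) = 1 - w / 2" by (simp add: w_def)
  moreover have "cmod w = 1 / cmod h" by (simp add: w_def norm_divide)
  ultimately show ?thesis by (simp only:)
qed

context pick_space
begin

lemma variation_sphere_measure:
  fixes \<mu> :: "(complex ^ 'd) set \<Rightarrow> complex"
  assumes "complex_measure sphere_borel \<mu>" shows "pick_sphere_measure a \<B> (variation sphere_borel \<mu>)"
proof -
  interpret finite_measure "variation sphere_borel \<mu>" by (rule finite_measure_variation[OF assms])
  show ?thesis by unfold_locales simp
qed

lemma henkin_compact_eq_0:
  assumes \<mu>: "henkin H ip \<mu>" and F: "compact F" "F \<subseteq> sphere 0 1" and cap: "compact_capacity a F = 0"
  shows "\<mu> F = 0"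
proof -
  define \<tau> where "\<tau> = variation sphere_borel \<mu>"
  have cm: "complex_measure sphere_borel \<mu>" using \<mu> by (simp add: henkin_def)
  interpret \<tau>: pick_sphere_measure a \<B> \<tau> unfolding \<tau>_def by (rule variation_sphere_measure[OF cm])
  have Fs: "F \<in> sets sphere_borel" using F by (simp add: sphere_sets borel_compact)
  have F\<tau> [measurable]: "F \<in> sets \<tau>" using Fs \<tau>.sets_eq by simp
  \<comment> \<open>The densities are taken on \<open>F\<close> alone: one of finite energy would
    contradict capacity zero, and the potentials stay bounded off \<open>F\<close>.\<close>
  define \<sigma> where "\<sigma> = density \<tau> (indicator F)"
  have em\<sigma>: "emeasure \<sigma> A = emeasure \<tau> (F \<inter> A)" if "A \<in> sets \<tau>" for A
    unfolding \<sigma>_def using that by (subst emeasure_density) (auto simp: nn_integral_indicator indicator_inter_arith[symmetric])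
  interpret \<sigma>f: finite_measure \<sigma>
    by (rule finite_measureI) (simp add: em\<sigma> \<sigma>_def[THEN arg_cong[of _ _ space]])
  interpret \<sigma>: pick_sphere_measure a \<B> \<sigma>
    by unfold_locales (simp add: \<sigma>_def \<tau>.sets_eq)
  have AEF: "AE w in \<sigma>. w \<in> F" unfolding \<sigma>_def by (subst AE_density) (auto simp: indicator_def)
  show ?thesis
  proof (cases "measure \<sigma> (space \<sigma>) = 0")
    case True
    then have "emeasure \<sigma> (space \<tau>) = 0" using \<sigma>f.emeasure_eq_measure by (simp add: \<sigma>_def)
    then have "emeasure \<tau> F = 0" using em\<sigma>[OF sets.top] sets.sets_into_space[OF F\<tau>] by (simp add: Int_absorb2)
    then show ?thesis using variation_eq_0_iff[OF cm Fs] Fs unfolding \<tau>_def by blast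
  next
    case False
    then have pos: "0 < measure \<sigma> (space \<sigma>)" by (simp add: zero_less_measure_iff)
    have inf: "\<sigma>.carries_no_energy"
    proof (rule \<sigma>.carries_no_energyI)
      fix v C
      assume v: "integrable \<sigma> v" "\<And>w. 0 \<le> v w" "(\<integral>w. v w \<partial>\<sigma>) = 1"
        and C: "\<And>t. 0 \<le> t \<Longrightarrow> t < 1 \<Longrightarrow> wsq t (moment \<sigma> v) \<le> C"
      let ?m = "density \<sigma> (\<lambda>w. ennreal (v w))"
      note m = \<sigma>.density_prob[OF v]
      interpret m: sphere_measure a \<B> ?m by (rule sphere_prob_sphere_measure[OF m(1)])
      have en: "energy a ?m < \<infinity>" unfolding m.finite_energy_iff m(2) using C by blast
      have vm: "(\<lambda>w. ennreal (v w)) \<in> borel_measurable \<sigma>" using v(1) by auto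
      have "AE w in ?m. w \<in> F" using AEF by (subst AE_density[OF vm]) auto
      then have "emeasure ?m (sphere 0 1 - F) = 0"
        using F\<tau> by (subst (asm) AE_iff_measurable[where N = "sphere 0 1 - F"])
          (auto simp: \<sigma>.sets_eq \<sigma>.space_eq sphere_sets F borel_compact)
      then show False using cap m(1) en unfolding compact_capacity_eq_0_iff by blast
    qed
    obtain I r u where I: "\<And>n. 2 ^ n \<le> I n" and r: "\<And>n. 1/2 \<le> r n" "\<And>n. r n < 1"
      and u: "\<And>n. u n \<in> \<sigma>.densities" and "\<And>n. wsq (r n) (moment \<sigma> (u n)) \<le> I n + 1"
      and AEh: "AE z in \<sigma>. \<forall>\<^sub>F n in sequentially. I n / 4 \<le> Re (potential (r n) (moment \<sigma> (u n)) z)"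
      using \<sigma>.large_potential_sequence[OF pos inf] by blast
    have r0: "0 \<le> r n" "0 < r n" for n using r(1)[of n] by linarith+
    define h where "h n = potential (r n) (moment \<sigma> (u n))" for n
    define \<phi> where "\<phi> n z = 1 - 1 / (2 * h n z)" for n z
    \<comment> \<open>Raising to the \<open>n\<close>-th power multiplies the error by at most
      \<open>n\<close>, so an error of order \<open>1 / n^2\<close> still tends to 0.\<close>
    define \<epsilon> where "\<epsilon> n = 1 / (real (Suc n))\<^sup>2" for n
    have "\<exists>q. polynomial_several q \<and> mult_bound K \<B> 1 q \<and>
        (\<forall>z. norm z \<le> 1 \<longrightarrow> cmod (\<phi> n z - q z) \<le> \<epsilon> n \<and> cmod (q z) \<le> 1)" for n
      using \<sigma>.contraction_polynomial[OF u r0(2) r(2), of "\<epsilon> n" n n] unfolding \<phi>_def h_def \<epsilon>_def by (metis zero_less_divide_1_iff zero_less_power of_nat_0_less_iff zero_less_Suc)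
    then obtain q where q: "\<And>n. polynomial_several (q n)" "\<And>n. mult_bound K \<B> 1 (q n)"
      "\<And>n z. norm z \<le> 1 \<Longrightarrow> cmod (\<phi> n z - q n z) \<le> \<epsilon> n" "\<And>n z. norm z \<le> 1 \<Longrightarrow> cmod (q n z) \<le> 1"
      by metis
    define p where "p n z = q n z ^ n" for n z
    have Reh: "1 / 2 \<le> Re (h n z)" if "norm z \<le> 1" for n z
      unfolding h_def by (rule \<sigma>.Re_potential_ge_half[OF u r0(1) r(2) that])
    have \<phi>sq: "(cmod (\<phi> n z))\<^sup>2 \<le> 1 - (1 / cmod (h n z))\<^sup>2 / 4" if "norm z \<le> 1" for n z
      unfolding \<phi>_def by (rule norm_one_minus_half_reciprocal[OF Reh[OF that]])
    have \<phi>1: "cmod (\<phi> n z) \<le> 1" if "norm z \<le> 1" for n z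
    proof -
      have "(cmod (\<phi> n z))\<^sup>2 \<le> 1\<^sup>2" 
        using \<phi>sq[OF that, of n] zero_le_power2[of "1 / cmod (h n z)"] unfolding power_one by linarith
      then show ?thesis by (rule power2_le_imp_le) simp
    qed
    have p\<phi>: "cmod (\<phi> n z ^ n - p n z) \<le> 1 / real (Suc n)" if z: "norm z \<le> 1" for n z
    proof -
      have "cmod (\<phi> n z ^ n - p n z) \<le> real n * cmod (\<phi> n z - q n z)"
        unfolding p_def by (rule norm_power_diff[OF \<phi>1[OF z] q(4)[OF z]])
      also have "\<dots> \<le> real (Suc n) * \<epsilon> n" using q(3)[OF z, of n] by (intro mult_mono) auto
      also have "\<dots> = 1 / real (Suc n)" by (simp add: \<epsilon>_def power2_eq_square)
      finally show ?thesis .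
    qed
    have inv0: "(\<lambda>n. 1 / real (Suc n)) \<longlonglongrightarrow> 0"
      using LIMSEQ_inverse_real_of_nat by (simp add: inverse_eq_divide)
    have plim: "(\<lambda>n. p n z) \<longlonglongrightarrow> l" if z: "norm z \<le> 1" and l: "(\<lambda>n. \<phi> n z ^ n) \<longlonglongrightarrow> l" for z l
    proof -
      have "(\<lambda>n. \<phi> n z ^ n - p n z) \<longlonglongrightarrow> 0"
        by (rule Lim_null_comparison[OF _ inv0]) (use p\<phi>[OF z] in auto)
      from tendsto_diff[OF l this] show ?thesis by simp
    qed
    have zero: "(\<lambda>n. p n z) \<longlonglongrightarrow> 0" if z: "norm z \<le> 1" and C: "\<And>n. cmod (h n z) \<le> C" for z C
    proof (rule plim[OF z])
      \<comment> \<open>A bound \<open>C\<close> for the potentials at \<open>z\<close>, uniform in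
        \<open>n\<close>, keeps all \<open>\<phi> n z\<close> inside one disc of radius
        \<open>\<kappa> < 1\<close>.\<close>
      define \<kappa> where "\<kappa> = sqrt (1 - (1 / C)\<^sup>2 / 4)"
      have h0: "1 / 2 \<le> cmod (h n z)" for n using Reh[OF z, of n] complex_Re_le_cmod[of "h n z"] by linarith
      then have C0: "1 / 2 \<le> C" using C[of 0] order_trans by blast
      have "(1 / C)\<^sup>2 \<le> 2\<^sup>2" using C0 by (intro power_mono) (auto simp: field_simps)
      then have \<kappa>: "0 \<le> \<kappa>" "\<kappa> < 1" using C0 by (auto simp: \<kappa>_def)
      have "cmod (\<phi> n z) \<le> \<kappa>" for n
        unfolding \<kappa>_def
      proof (rule real_le_rsqrt)
        have hp: "0 < cmod (h n z)" using h0[of n] by linarith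
        have "1 / C \<le> 1 / cmod (h n z)" using C[of n] hp C0 by (intro frac_le) auto
        then have "(1 / C)\<^sup>2 \<le> (1 / cmod (h n z))\<^sup>2" using C0 by (intro power_mono) auto
        then show "(cmod (\<phi> n z))\<^sup>2 \<le> 1 - (1 / C)\<^sup>2 / 4" using \<phi>sq[OF z, of n] by linarith
      qed
      then have "norm (\<phi> n z ^ n) \<le> \<kappa> ^ n" for n unfolding norm_power by (intro power_mono) auto
      then show "(\<lambda>n. \<phi> n z ^ n) \<longlonglongrightarrow> 0"
        by (intro Lim_null_comparison[OF _ LIMSEQ_realpow_zero[OF \<kappa>]] always_eventually allI)
    qed
    have one: "(\<lambda>n. p n z) \<longlonglongrightarrow> 1"
      if z: "norm z \<le> 1" and ev: "\<forall>\<^sub>F n in sequentially. I n / 4 \<le> Re (h n z)" for z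
    proof (rule plim[OF z])
      have "\<forall>\<^sub>F n in sequentially. norm (\<phi> n z ^ n - 1) \<le> 2 * (real n * (1/2) ^ n)"
        using ev
      proof eventually_elim
        case (elim n)
        have "2 ^ n / 4 \<le> cmod (h n z)" using elim I[of n] complex_Re_le_cmod[of "h n z"] by linarith
        then have "1 / (2 * cmod (h n z)) \<le> 1 / (2 * (2 ^ n / 4))" by (intro frac_le) auto
        \<comment> \<open>Exponential closeness to 1 absorbs the factor \<open>n\<close> that comes
          from the \<open>n\<close>-th power.\<close>
        then have 1: "cmod (\<phi> n z - 1) \<le> 2 * (1/2) ^ n"
          by (simp add: \<phi>_def norm_divide norm_mult power_one_over)
        have "norm (\<phi> n z ^ n - 1 ^ n) \<le> real n * cmod (\<phi> n z - 1)"
          by (rule norm_power_diff[OF \<phi>1[OF z]]) simp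
        also have "\<dots> \<le> real n * (2 * (1/2) ^ n)" using 1 by (intro mult_left_mono) auto
        finally show ?case by simp
      qed
      moreover have "(\<lambda>n. 2 * (real n * (1/2) ^ n)) \<longlonglongrightarrow> 0"
        by (rule tendsto_mult_right_zero[OF powser_times_n_limit_0]) simp
      ultimately have "(\<lambda>n. \<phi> n z ^ n - 1) \<longlonglongrightarrow> 0"
        by (rule Lim_null_comparison)
      then show "(\<lambda>n. \<phi> n z ^ n) \<longlonglongrightarrow> 1" by (simp add: LIM_zero_iff)
    qed
    have pp: "polynomial_several (p n)" for n unfolding p_def[abs_def] by (intro polynomial_several_power q)
    have pb: "cmod (p n z) \<le> 1" if "norm z \<le> 1" for n z
      unfolding p_def norm_power using q(4)[OF that] by (simp add: power_le_one)
    have "mult_norm H ip (p n) \<le> ennreal 1" for n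
      using mult_bound_power[OF q(2), of n n] unfolding p_def[abs_def] by (intro mult_norm_le) auto
    then have "(SUP n. mult_norm H ip (p n)) \<le> 1" by (intro SUP_least) simp
    then have bd: "(SUP n. mult_norm H ip (p n)) < \<infinity>" by (rule order_le_less_trans) simp
    have inball: "(\<lambda>n. p n z) \<longlonglongrightarrow> 0" if z: "z \<in> \<B>" for z
    proof (rule zero)
      show z1: "norm z \<le> 1" using z by simp
      show "cmod (h n z) \<le> kval (norm z)" for n
      proof -
        have ws: "word_sq k (moment \<sigma> (u n)) \<le> 1" for k
          using u by (intro \<sigma>.word_sq_moment_le_1 \<sigma>.densities_integrable) (auto simp: \<sigma>.densities_def)
        have "cmod (h n z) \<le> kval (r n * norm z)"
          unfolding h_def by (rule potential_sums(3)[OF ws r0(1) r(2) z1])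
        also have "\<dots> \<le> kval (norm z)"
        proof -
          have rz: "r n * norm z \<le> norm z" "0 \<le> r n * norm z" "norm z < 1"
            using r(2)[of n] r0(1)[of n] z by (auto simp: mult_left_le_one_le)
          then show ?thesis unfolding kval_def using a_pos
            by (intro suminf_le summable_a) (auto intro!: mult_left_mono power_mono simp: less_imp_le)
        qed
        finally show ?thesis .
      qed
    qed
    have ind: "AE z in \<tau>. (\<lambda>n. p n z) \<longlonglongrightarrow> indicator F z"
    proof -
      have "AE z in \<tau>. 0 < (indicator F z :: ennreal) \<longrightarrow> (\<forall>\<^sub>F n in sequentially. I n / 4 \<le> Re (h n z))"
        using AEh unfolding \<sigma>_def h_def by (subst (asm) AE_density) (auto simp: \<sigma>_def)
      then show ?thesis
        using AE_space
      proof eventually_elim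
        case (elim z)
        have z: "norm z = 1" using elim(2) by (simp add: \<tau>.space_eq)
        show ?case
        proof (cases "z \<in> F")
          case True
          then show ?thesis using one[of z] elim(1) z by simp
        next
          case False
          then obtain C where "\<And>n. cmod (h n z) \<le> C"
            using \<sigma>.potential_bounded_off_support[OF z False F(1) AEF] r u unfolding h_def by metis
          then show ?thesis using zero[of z C] z False by simp
        qed
      qed
    qed
    \<comment> \<open>Dominated convergence for each of the four Jordan parts of
      \<open>\<mu>\<close>; all are absolutely continuous with respect to \<open>\<tau>\<close>, for
      which the limit is known almost everywhere.\<close>
    have Jlim: "(\<lambda>n. \<integral>z. p n z \<partial>J) \<longlonglongrightarrow> of_real (measure J F)"
      if J: "finite_measure J" "sets J = sets sphere_borel" and le: "\<And>A. A \<in> sets sphere_borel \<Longrightarrow> emeasure \<tau> A = 0 \<Longrightarrow> emeasure J A = 0" for J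
    proof -
      interpret J: sphere_measure a \<B> J
        using J ball_kernel_axioms by (simp add: sphere_measure_def sphere_measure_axioms_def)
      have FJ [measurable]: "F \<in> sets J" using Fs J by simp
      have ac: "absolutely_continuous \<tau> J"
        unfolding absolutely_continuous_def using le \<tau>.sets_eq J(2) by (auto simp: null_sets_def)
      have "(\<lambda>n. \<integral>z. p n z \<partial>J) \<longlonglongrightarrow> (\<integral>z. indicator F z \<partial>J)"
      proof (rule integral_dominated_convergence[where w = "\<lambda>_. 1"])
        show "(\<lambda>z. indicator F z :: complex) \<in> borel_measurable J" by measurable
        show "p n \<in> borel_measurable J" for n
          by (rule J.measurable_continuous[OF continuous_on_polynomial_several[OF pp]])
        show "AE z in J. (\<lambda>n. p n z) \<longlonglongrightarrow> indicator F z"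
          by (rule absolutely_continuous_AE[OF _ ac ind]) (simp add: J \<tau>.sets_eq)
        show "AE z in J. norm (p n z) \<le> 1" for n
          by (rule AE_I2) (simp add: pb J.space_eq)
      qed simp
      also have "(\<integral>z. indicator F z \<partial>J) = complex_of_real (measure J F)"
      proof -
        have "(\<integral>z. indicator F z \<partial>J) = (\<integral>z. complex_of_real (indicator F z) \<partial>J)"
          by (intro Bochner_Integration.integral_cong) (auto simp: indicator_def)
        also have "\<dots> = complex_of_real (measure J F)" by (simp add: Int_absorb2 sets.sets_into_space[OF FJ])
        finally show ?thesis .
      qed
      finally show ?thesis .
    qed
    note S = signed_measures[OF cm]
    have ev: "emeasure \<tau> A = 0 \<Longrightarrow> emeasure (jordan_pos sphere_borel (\<lambda>A. Re (\<mu> A))) A = 0"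
      "emeasure \<tau> A = 0 \<Longrightarrow> emeasure (jordan_pos sphere_borel (\<lambda>A. - Re (\<mu> A))) A = 0"
      "emeasure \<tau> A = 0 \<Longrightarrow> emeasure (jordan_pos sphere_borel (\<lambda>A. Im (\<mu> A))) A = 0"
      "emeasure \<tau> A = 0 \<Longrightarrow> emeasure (jordan_pos sphere_borel (\<lambda>A. - Im (\<mu> A))) A = 0"
      if "A \<in> sets sphere_borel" for A
      unfolding \<tau>_def emeasure_variation[OF that] by auto
    have "(\<lambda>n. complex_measure_integral sphere_borel \<mu> (p n)) \<longlonglongrightarrow> \<mu> F"
      unfolding complex_measure_integral_def
      by (subst complex_measure_jordan[OF cm Fs])
        (intro tendsto_intros Jlim finite_measure_jordan_pos S sets_jordan_pos ev)
    moreover have "(\<lambda>n. complex_measure_integral sphere_borel \<mu> (p n)) \<longlonglongrightarrow> 0"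
      using \<mu> pp bd inball unfolding henkin_def by blast
    ultimately show ?thesis by (rule LIMSEQ_unique)
  qed
qed

text \<open>\<open>henkin_compact_eq_0\<close> only gives \<open>\<mu> F = 0\<close>, where masses
  may cancel. It applies to every compact subset of \<open>F\<close> as well, and inner regularity
  then reaches every Borel subset.\<close>

lemma henkin_variation_compact_eq_0:
  assumes \<mu>: "henkin H ip \<mu>" and F: "compact F" "F \<subseteq> sphere 0 1" and cap: "compact_capacity a F = 0"
  shows "emeasure (variation sphere_borel \<mu>) F = 0"
proof -
  have cm: "complex_measure sphere_borel \<mu>" using \<mu> by (simp add: henkin_def)
  interpret \<tau>: pick_sphere_measure a \<B> "variation sphere_borel \<mu>" by (rule variation_sphere_measure[OF cm])
  have Fs: "F \<in> sets sphere_borel" using F by (simp add: sphere_sets borel_compact)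
  have "\<mu> A = 0" if A: "A \<in> sets sphere_borel" "A \<subseteq> F" for A
  proof -
    have "cmod (\<mu> A) \<le> 0 + e" if e: "0 < e" for e
    proof -
      obtain C where C: "compact C" "C \<subseteq> A" "C \<in> sets sphere_borel" "measure (variation sphere_borel \<mu>) (A - C) < e"
        using \<tau>.inner_compact[of A e] A(1) e by (auto simp del: sets_restrict_space)
      have "compact_capacity a C = 0"
        unfolding compact_capacity_eq_0_iff
      proof (intro allI impI)
        fix m :: "(complex ^ 'd) measure" assume m: "sphere_prob m" "emeasure m (sphere 0 1 - C) = 0"
        have "C \<in> sets m" "sphere 0 1 \<in> sets m" using m(1) C(3) by (auto simp: sphere_prob_def sphere_sets)
        then have "emeasure m (sphere 0 1 - F) \<le> emeasure m (sphere 0 1 - C)"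
          using C(2) A(2) by (intro emeasure_mono) auto
        then have "emeasure m (sphere 0 1 - F) = 0" using m(2) by simp
        then show "\<not> energy a m < \<infinity>" using cap m(1) unfolding compact_capacity_eq_0_iff by blast
      qed
      then have "\<mu> C = 0" using C A(2) F(2) by (intro henkin_compact_eq_0[OF \<mu>]) auto
      then have "\<mu> A = \<mu> (A - C)" using complex_measure_diff[OF cm A(1) C(3,2)] by simp
      then have "cmod (\<mu> A) \<le> measure (variation sphere_borel \<mu>) (A - C)"
        using cmod_le_variation[OF cm sets.Diff[OF A(1) C(3)]] by simp
      then show ?thesis using C(4) by simp
    qed
    then have "cmod (\<mu> A) \<le> 0" by (rule field_le_epsilon)
    then show ?thesis by simp
  qed
  then show ?thesis using variation_eq_0_iff[OF cm Fs] by blast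
qed

text \<open>The carrier from \<open>singular_carrier\<close> is only Borel; an F-sigma subset of
  full variation is still null for all measures of finite energy.\<close>

lemma finite_energy_singular_imp_fsigma:
  fixes \<nu> :: "(complex ^ 'd) set \<Rightarrow> complex"
  assumes \<nu>: "complex_measure sphere_borel \<nu>"
    and sing: "\<And>\<mu>. sphere_prob \<mu> \<Longrightarrow> energy a \<mu> < \<infinity> \<Longrightarrow> mutually_singular sphere_borel \<nu> (complex_measure_of \<mu>)"
  shows "\<exists>E. fsigma E \<and> E \<subseteq> sphere 0 1 \<and> inner_capacity a E = 0 \<and> concentrated_on sphere_borel \<nu> E"
proof -
  interpret \<tau>: pick_sphere_measure a \<B> "variation sphere_borel \<nu>" by (rule variation_sphere_measure[OF \<nu>])
  have sp: "space (sphere_borel :: (complex ^ 'd) measure) = sphere 0 1" by (simp add: space_restrict_space)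
  have "\<exists>A\<in>sets sphere_borel. emeasure (variation sphere_borel \<nu>) (sphere 0 1 - A) = 0 \<and> emeasure m A = 0"
    if m: "sphere_prob m" "energy a m < \<infinity>" for m
  proof -
    interpret m: sphere_measure a \<B> m by (rule sphere_prob_sphere_measure[OF m(1)])
    have fm: "finite_measure m" by (rule m.finite_measure_axioms)
    show ?thesis
      using sing[OF m] unfolding mutually_singular_iff[OF \<nu> complex_measure_of[OF fm m.sets_eq]]
        variation_complex_measure_of[OF fm m.sets_eq] sp .
  qed
  then obtain E where E: "E \<in> sets sphere_borel" "emeasure (variation sphere_borel \<nu>) (sphere 0 1 - E) = 0"
    "\<And>m. sphere_prob m \<Longrightarrow> energy a m < \<infinity> \<Longrightarrow> emeasure m E = 0"
    using \<tau>.singular_carrier by blast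
  have E\<tau>: "E \<in> sets (variation sphere_borel \<nu>)" using E(1) by simp
  obtain F where F: "fsigma F" "F \<subseteq> E" "F \<in> sets (variation sphere_borel \<nu>)"
    "emeasure (variation sphere_borel \<nu>) (E - F) = 0"
    using \<tau>.fsigma_subset_full_measure[OF E\<tau>] by blast
  have Fs: "F \<in> sets sphere_borel" using F(3) by simp
  have "emeasure m F = 0" if m: "sphere_prob m" "energy a m < \<infinity>" for m
  proof -
    have "emeasure m F \<le> emeasure m E" using m(1) E(1) F(2) by (intro emeasure_mono) (auto simp: sphere_prob_def)
    then show ?thesis using E(3)[OF m] by simp
  qed
  then have "inner_capacity a F = 0" using Fs by (rule inner_capacity_eq_0)
  moreover have "emeasure (variation sphere_borel \<nu>) (sphere 0 1 - F) = 0"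
  proof -
    have "emeasure (variation sphere_borel \<nu>) (sphere 0 1 - F) \<le>
        emeasure (variation sphere_borel \<nu>) ((sphere 0 1 - E) \<union> (E - F))"
      using E(1) Fs sets.compl_sets[OF E(1)] sp by (intro emeasure_mono) auto
    also have "\<dots> \<le> 0"
      using emeasure_subadditive[of "sphere 0 1 - E" "variation sphere_borel \<nu>" "E - F"] E F(4) Fs
        sets.compl_sets[OF E(1)] sp by auto
    finally show ?thesis by simp
  qed
  moreover have "F \<subseteq> sphere 0 1" using Fs sphere_sets by blast
  ultimately show ?thesis using F(1) Fs concentrated_on_iff[OF \<nu>, of F] sp by auto
qed

text \<open>The closed pieces of \<open>E\<close> lie in the sphere and are compact, so each is null
  for the variation of any Henkin measure. Hence so is their union, which carries
  \<open>\<nu>\<close>.\<close>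

lemma fsigma_capacity_0_imp_totally_singular:
  fixes \<nu> :: "(complex ^ 'd) set \<Rightarrow> complex"
  assumes \<nu>: "complex_measure sphere_borel \<nu>"
    and E: "fsigma E" "E \<subseteq> sphere 0 1" "inner_capacity a E = 0" "concentrated_on sphere_borel \<nu> E"
  shows "totally_singular H ip \<nu>"
  unfolding totally_singular_def
proof (intro conjI allI impI)
  show "complex_measure sphere_borel \<nu>" by (rule \<nu>)
  fix \<mu> assume \<mu>: "henkin H ip \<mu>"
  then have cm: "complex_measure sphere_borel \<mu>" by (simp add: henkin_def)
  obtain C :: "nat \<Rightarrow> (complex ^ 'd) set" where C: "\<And>n. closed (C n)" "E = (\<Union>n. C n)"
    using E(1) by (auto elim: fsigma.cases)
  have CS: "C n \<subseteq> sphere 0 1" for n using C(2) E(2) by auto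
  have comp: "compact (C n)" for n
  proof -
    have "C n = sphere 0 1 \<inter> C n" using CS[of n] by blast
    then show ?thesis using compact_Int_closed[OF compact_sphere C(1)] by metis
  qed
  have "emeasure (variation sphere_borel \<mu>) (C n) = 0" for n
  proof (rule henkin_variation_compact_eq_0[OF \<mu> comp CS])
    have "compact_capacity a (C n) \<le> inner_capacity a E"
      unfolding inner_capacity_def using comp C(2) by (intro SUP_upper) auto
    then show "compact_capacity a (C n) = 0" using E(3) by simp
  qed
  then have "C n \<in> null_sets (variation sphere_borel \<mu>)" for n
    using comp CS by (auto simp: null_sets_def sphere_sets borel_compact)
  then have "E \<in> null_sets (variation sphere_borel \<mu>)" unfolding C(2) by (intro null_sets_UN)
  then have "emeasure (variation sphere_borel \<mu>) E = 0" by auto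
  then show "mutually_singular sphere_borel \<nu> \<mu>"
    using E(4) unfolding mutually_singular_iff[OF \<nu> cm] concentrated_on_iff[OF \<nu>] by blast
qed

end

theorem theorem8p7:
  fixes H :: "(complex ^ 'd \<Rightarrow> complex) set"
    and ip :: "(complex ^ 'd \<Rightarrow> complex) \<Rightarrow> (complex ^ 'd \<Rightarrow> complex) \<Rightarrow> complex"
    and a :: "nat \<Rightarrow> real"
    and \<nu> :: "(complex ^ 'd) set \<Rightarrow> complex"
  assumes "regular_unitarily_invariant_space H ip a"
    and "complete_pick_kernel (ball (0 :: complex ^ 'd) 1) (ui_kernel a)"
    and "complex_measure (sphere_borel :: (complex ^ 'd) measure) \<nu>"
  shows "(totally_singular H ip \<nu> \<longleftrightarrow>
           (\<forall>\<mu>. sphere_prob \<mu> \<and> energy a \<mu> < \<infinity> \<longrightarrow>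
              mutually_singular sphere_borel \<nu> (complex_measure_of \<mu>))) \<and>
         (totally_singular H ip \<nu> \<longleftrightarrow>
           (\<exists>E. fsigma E \<and> E \<subseteq> sphere 0 1 \<and> inner_capacity a E = 0 \<and>
              concentrated_on sphere_borel \<nu> E))"
proof -
  have ps: "pick_space H ip a" using assms(1,2) by (simp add: pick_space_def pick_space_axioms_def)
  interpret pick_space H ip a by (rule ps)
  have 12: "mutually_singular sphere_borel \<nu> (complex_measure_of \<mu>)"
    if "totally_singular H ip \<nu>" "sphere_prob \<mu>" "energy a \<mu> < \<infinity>" for \<mu>
  proof -
    interpret pick_space_prob H ip a \<mu>
      using ps that(2) by (simp add: pick_space_prob_def pick_space_prob_axioms_def)
    show ?thesis using that(1) finite_energy_henkin[OF that(3)] unfolding totally_singular_def by blast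
  qed
  note 23 = finite_energy_singular_imp_fsigma[OF assms(3)]
  note 31 = fsigma_capacity_0_imp_totally_singular[OF assms(3)]
  \<comment> \<open>The three implications form a cycle, which yields both equivalences.\<close>
  show ?thesis using 12 23 31 by blast
qed

end
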